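(* Let $\mathbf m\in\Sigma^*$ and consider the maximal zigzag $\mathbf m=\mathbf m^{(1)},\mathbf m^{(2)},\mathbf m^{(3)},\dots$ originating from $\mathbf m$ in the extended Markoff tree. Then $(\mathbf x_{\mathbf m^{(i)}})_{i\ge1}$ is a sequence of symmetric matrices in $\mathrm{SL}_2(\mathbb Z)$ corresponding to an extremal number $\xi_{\mathbf m}$ in $\mathcal E_3^+\cap(1/2,1)$, and we have \[\xi_{\mathbf m}=\lim_{i\to\infty}\alpha_{\mathbf m^{(i)}}=\lim_{i\to\infty}(\bar\alpha_{\mathbf m^{(i)}}+3).\] Moreover, each element of $\mathcal E_3^+$ is $\mathrm{GL}_2(\mathbb Z)$-equivalent to $\xi_{\mathbf m}$ for one and only one $\mathbf m\in\Sigma^*$.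
   Context: Let $\gamma=(1+\sqrt5)/2$. A real number $\xi$ is \emph{extremal} if it is neither rational nor quadratic over $\mathbb Q$ and there is a constant $c>0$ such that, for each real $X\ge 1$, the inequalities $|x_0|\le X$, $|x_0\xi-x_1|\le cX^{-1/\gamma}$, $|x_0\xi^2-x_2|\le cX^{-1/\gamma}$ admit a non-zero solution $(x_0,x_1,x_2)\in\mathbb Z^3$. $\mathrm{GL}_2(\mathbb Z)$ acts on $\mathbb R\setminus\mathbb Q$ by $\begin{pmatrix}a&b\\c&d\end{pmatrix}\cdot\xi=\frac{a\xi+b}{c\xi+d}$; two numbers are equivalent if they lie in the same orbit. The norm $\|\mathbf x\|$ of a real matrix or vector is the largest absolute value of its coefficients. A sequence $(\mathbf x_i)_{i\ge1}$ of symmetric matrices in $\mathrm{SL}_2(\mathbb Z)$ is said to \emph{correspond} to an extremal number $\xi$ if it is unbounded and satisfies $\|\mathbf x_{i+1}\|\asymp\|\mathbf x_i\|^\gamma$ and $\|(\xi,-1)\mathbf x_i\|\asymp\|\mathbf x_i\|^{-1}$ for all $i\ge1$, where $A\asymp B$ means $c_1B\le A\le c_2B$ with constants $c_1,c_2>0$ independent of $i$. $\mathcal E_3^+$ denotes the set of extremal numbers having a corresponding sequence $(\mathbf x_i)_{i\ge1}$ of symmetric matrices in $\mathrm{SL}_2(\mathbb Z)$ such that $\mathbf x_{i+2}=\mathbf x_{i+1}M_{i+1}\mathbf x_i$ for each $i\ge1$, where $M_i=\begin{pmatrix}3&(-1)^i\\(-1)^{i+1}&0\end{pmatrix}$. Extended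 Markoff tree: $\Sigma^*$ is the set of nodes of the following tree of ordered triples of positive integers, all of which are solutions of $m^2+m_1^2+m_2^2=3mm_1m_2$. The root is $(2,1,1)$; it has a single successor, $(5,1,2)$, which is a left successor. Every other node $(m,m_1,m_2)$ has a left successor $(3mm_1-m_2,m_1,m)$ and a right successor $(3mm_2-m_1,m,m_2)$. A \emph{zigzag} is an infinite sequence of nodes $\mathbf m^{(1)},\mathbf m^{(2)},\dots$ such that, for each $i\ge1$, $\mathbf m^{(i+1)}$ is a successor of $\mathbf m^{(i)}$ on some side (left or right) and $\mathbf m^{(i+2)}$ is a successor of $\mathbf m^{(i+1)}$ on the other side. It is \emph{maximal} if it cannot be extended to a zigzag by inserting the ancestor of $\mathbf m^{(1)}$ (the node of which it is a successor) as first element. Each $\mathbf m\in\Sigma^*$ is the first element of a unique maximal zigzag. Matrices: put $M=\begin{pmatrix}3&1\\-1&0\end{pmatrix}$ and consider the binary tree of triples of matrices with root $\left(\begin{pmatrix}5&3\\3&2\end{pmatrix},\begin{pmatrix}1&1\\1&2\end{pmatrix},\begin{pmatrix}2&1\\1&1\end{pmatrix}\right)$, where each node $(\mathbf x,\mathbf x_1,\mathbf x_2)$ has left successor $(\mathbf x_1M\mathbf x,\mathbf x_1,\mathbf x)$ and right successor $(\mathbf xM\mathbf x_2,\mathbf x,\mathbf x_2)$. For $\mathbf m\in\Sigma^*$, $\mathbf m\ne(2,1,1)$, let $\mathbf x_{\mathbf m}$ be the first component of the node of this matrix tree occupying the same position as $\mathbf m$ in the subtree of the Markoff tree rooted at $(5,1,2)$;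 put $\mathbf x_{(2,1,1)}=\begin{pmatrix}2&1\\1&1\end{pmatrix}$. For $\mathbf m=(m,m_1,m_2)$, the matrix $\mathbf x_{\mathbf m}=\begin{pmatrix}m&k\\k&\ell\end{pmatrix}$ has upper left entry $m$, and one sets $\alpha_{\mathbf m}=\frac{2k-3m+\sqrt{9m^2-4}}{2m}$ and $\bar\alpha_{\mathbf m}=\frac{2k-3m-\sqrt{9m^2-4}}{2m}$. *)

theory Defs
  imports
    "HOL-Analysis.Analysis"
    "HOL-Computational_Algebra.Polynomial"
begin

section \<open>Extremal numbers and corresponding sequences\<close>

definition golden :: real where
  "golden = (1 + sqrt 5) / 2"

definition quadratic_over_rat :: "real \<Rightarrow> bool" where
  "quadratic_over_rat \<xi> \<longleftrightarrow>
     (\<exists>p :: rat poly. irreducible p \<and> degree p = 2 \<and> poly (map_poly of_rat p) \<xi> = 0)"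

definition extremal :: "real \<Rightarrow> bool" where
  "extremal \<xi> \<longleftrightarrow>
     \<xi> \<notin> \<rat> \<and> \<not> quadratic_over_rat \<xi> \<and>
     (\<exists>c>0. \<forall>X::real. X \<ge> 1 \<longrightarrow>
       (\<exists>x0 x1 x2 :: int. (x0, x1, x2) \<noteq> (0, 0, 0) \<and>
          \<bar>of_int x0\<bar> \<le> X \<and>
          \<bar>of_int x0 * \<xi> - of_int x1\<bar> \<le> c * X powr (- 1 / golden) \<and>
          \<bar>of_int x0 * \<xi>\<^sup>2 - of_int x2\<bar> \<le> c * X powr (- 1 / golden)))"

definition mat2 :: "'a::zero \<Rightarrow> 'a \<Rightarrow> 'a \<Rightarrow> 'a \<Rightarrow> 'a^2^2" where
  "mat2 a b c d = vector [vector [a, b], vector [c, d]]"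

definition gl2z_equiv :: "real \<Rightarrow> real \<Rightarrow> bool" where
  "gl2z_equiv \<xi> \<eta> \<longleftrightarrow> \<xi> \<notin> \<rat> \<and> \<eta> \<notin> \<rat> \<and>
     (\<exists>a b c d :: int. invertible (mat2 a b c d) \<and>
        \<eta> = (of_int a * \<xi> + of_int b) / (of_int c * \<xi> + of_int d))"

abbreviation real_mat :: "int^2^2 \<Rightarrow> real^2^2" where
  "real_mat \<equiv> map_matrix of_int"

definition asymp_eq :: "(nat \<Rightarrow> real) \<Rightarrow> (nat \<Rightarrow> real) \<Rightarrow> bool" where
  "asymp_eq A B \<longleftrightarrow>
     (\<exists>c1>0. \<exists>c2>0. \<forall>i. c1 * B i \<le> A i \<and> A i \<le> c2 * B i)"

text \<open>
  All sequences are indexed from 0, so that \<open>x i\<close> is the term usually written $x_{i+1}$.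
  On \<open>real^2\<close> and \<open>real^2^2\<close>, \<^const>\<open>infnorm\<close> is the largest absolute value of the coefficients.
\<close>

definition corresponds :: "(nat \<Rightarrow> int^2^2) \<Rightarrow> real \<Rightarrow> bool" where
  "corresponds x \<xi> \<longleftrightarrow>
     extremal \<xi> \<and>
     (\<forall>i. transpose (x i) = x i \<and> det (x i) = 1) \<and>
     \<not> bdd_above (range (\<lambda>i. infnorm (real_mat (x i)))) \<and>
     asymp_eq (\<lambda>i. infnorm (real_mat (x (i + 1))))
              (\<lambda>i. infnorm (real_mat (x i)) powr golden) \<and>
     asymp_eq (\<lambda>i. infnorm (vector [\<xi>, -1] v* real_mat (x i)))
              (\<lambda>i. inverse (infnorm (real_mat (x i))))"

definition M_alt :: "nat \<Rightarrow> int^2^2" where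
  "M_alt i = mat2 3 ((-1) ^ i) ((-1) ^ (i + 1)) 0"

text \<open>
  With \<open>x i\<close> standing for $x_{i+1}$, the recurrence $x_{i+2} = x_{i+1} M_{i+1} x_i$ for $i \ge 1$
  becomes the one below: the subscript of $M$ remains the 1-based index of the middle factor.
\<close>

definition E3_plus :: "real set" where
  "E3_plus = {\<xi>. extremal \<xi> \<and>
     (\<exists>x. corresponds x \<xi> \<and> (\<forall>i. x (i + 2) = x (i + 1) ** M_alt (i + 2) ** x i))}"


section \<open>The extended Markoff tree and its zigzags\<close>

type_synonym triple = "int \<times> int \<times> int"

datatype side = Lft | Rgt

fun other :: "side \<Rightarrow> side" where
  "other Lft = Rgt"
| "other Rgt = Lft"

fun child :: "side \<Rightarrow> triple \<Rightarrow> triple" where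
  "child Lft (m, m1, m2) = (3 * m * m1 - m2, m1, m)"
| "child Rgt (m, m1, m2) = (3 * m * m2 - m1, m, m2)"

text \<open>The formula for left children also gives the single successor \<open>(5, 1, 2)\<close> of the root.\<close>

definition is_succ :: "side \<Rightarrow> triple \<Rightarrow> triple \<Rightarrow> bool" where
  "is_succ s m m' \<longleftrightarrow> m' = child s m \<and> (m = (2, 1, 1) \<longrightarrow> s = Lft)"

inductive_set Sigma_star :: "triple set" where
  root: "(2, 1, 1) \<in> Sigma_star"
| succ: "m \<in> Sigma_star \<Longrightarrow> is_succ s m m' \<Longrightarrow> m' \<in> Sigma_star"

definition zigzag :: "(nat \<Rightarrow> triple) \<Rightarrow> bool" where
  "zigzag z \<longleftrightarrow> (\<forall>i. z i \<in> Sigma_star) \<and>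
     (\<forall>i. \<exists>s. is_succ s (z i) (z (i + 1)) \<and> is_succ (other s) (z (i + 1)) (z (i + 2)))"

text \<open>
  \<open>case_nat n z\<close> is the sequence \<open>n, z 0, z 1, \<dots>\<close>; if it is a zigzag, then \<open>z 0\<close> is a successor
  of \<open>n\<close>.
\<close>

definition maximal_zigzag :: "(nat \<Rightarrow> triple) \<Rightarrow> bool" where
  "maximal_zigzag z \<longleftrightarrow> zigzag z \<and> \<not> (\<exists>n. zigzag (case_nat n z))"

definition zigzag_from :: "triple \<Rightarrow> nat \<Rightarrow> triple" where
  "zigzag_from m = (THE z. maximal_zigzag z \<and> z 0 = m)"


section \<open>The tree of matrices\<close>

type_synonym mtriple = "(int^2^2) \<times> (int^2^2) \<times> (int^2^2)"

definition M_mat :: "int^2^2" where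
  "M_mat = mat2 3 1 (-1) 0"

fun mchild :: "side \<Rightarrow> mtriple \<Rightarrow> mtriple" where
  "mchild Lft (x, x1, x2) = (x1 ** M_mat ** x, x1, x)"
| "mchild Rgt (x, x1, x2) = (x ** M_mat ** x2, x, x2)"

inductive same_position :: "triple \<Rightarrow> mtriple \<Rightarrow> bool" where
  root: "same_position (5, 1, 2) (mat2 5 3 3 2, mat2 1 1 1 2, mat2 2 1 1 1)"
| child: "same_position m X \<Longrightarrow> same_position (child s m) (mchild s X)"

definition x_mat :: "triple \<Rightarrow> int^2^2" where
  "x_mat m = (if m = (2, 1, 1) then mat2 2 1 1 1 else fst (THE X. same_position m X))"

definition alpha :: "triple \<Rightarrow> real" where
  "alpha m = (let n = of_int (fst m); k = of_int (x_mat m $ 1 $ 2)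
              in (2 * k - 3 * n + sqrt (9 * n\<^sup>2 - 4)) / (2 * n))"

definition alpha_bar :: "triple \<Rightarrow> real" where
  "alpha_bar m = (let n = of_int (fst m); k = of_int (x_mat m $ 1 $ 2)
                  in (2 * k - 3 * n - sqrt (9 * n\<^sup>2 - 4)) / (2 * n))"


section \<open>The definite descriptions are justified\<close>

text \<open>Every node other than the root is regular; this determines its ancestor.\<close>

definition regular :: "triple \<Rightarrow> bool" where
  "regular t \<longleftrightarrow> (case t of (m, m1, m2) \<Rightarrow>
     1 \<le> m1 \<and> 1 \<le> m2 \<and> m1 < m \<and> m2 < m \<and> m1 \<noteq> m2 \<and> 5 \<le> m)"

lemma child_grows:
  assumes "regular t"
  shows "regular (child s t)" "fst t < fst (child s t)"
proof -
  obtain m m1 m2 where t: "t = (m, m1, m2)" by (cases t) auto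
  have r: "1 \<le> m1" "1 \<le> m2" "m1 < m" "m2 < m" "5 \<le> m"
    using assms by (auto simp: regular_def t)
  have "3 * m \<le> 3 * m * m1" "3 * m \<le> 3 * m * m2"
    using mult_left_mono[of 1 m1 "3 * m"] mult_left_mono[of 1 m2 "3 * m"] r by simp_all
  then have "m < 3 * m * m1 - m2" "m < 3 * m * m2 - m1"
    using r by linarith+
  then have "regular (child s t) \<and> fst t < fst (child s t)"
    unfolding t regular_def using r by (cases s) simp_all
  then show "regular (child s t)" "fst t < fst (child s t)" by blast+
qed

lemma same_position_regular: "same_position m X \<Longrightarrow> regular m"
proof (induction rule: same_position.induct)
  case root
  then show ?case by (simp add: regular_def)
qed (rule child_grows(1))

lemma child_inject:
  assumes "regular t" "regular t'" "child s t = child s' t'"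
  shows "s = s' \<and> t = t'"
proof -
  obtain m m1 m2 n n1 n2 where t: "t = (m, m1, m2)" "t' = (n, n1, n2)"
    by (cases t, cases t') blast
  have "m1 < m" "m2 < m" "n1 < n" "n2 < n"
    using assms(1,2) unfolding t regular_def by simp_all
  then show ?thesis
    using assms(3) unfolding t by (cases s; cases s') auto
qed

lemma child_neq_first:
  assumes "regular t" shows "child s t \<noteq> (5, 1, 2)"
  using child_grows(2)[OF assms, of s] assms by (auto simp: regular_def)

lemma same_position_unique:
  "same_position m X \<Longrightarrow> same_position m Y \<Longrightarrow> X = Y"
proof (induction arbitrary: Y rule: same_position.induct)
  case root
  then show ?case
    by (cases rule: same_position.cases)
       (use child_neq_first same_position_regular in metis)+
next
  case (child m X s)
  from child.prems show ?case
  proof (cases rule: same_position.cases)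
    case root
    then show ?thesis using child_neq_first same_position_regular child.hyps by metis
  next
    case (child m' X' s')
    then show ?thesis
      using child_inject same_position_regular \<open>same_position m X\<close> \<open>\<And>Y. same_position m Y \<Longrightarrow> X = Y\<close>
      by metis
  qed
qed

lemma Sigma_star_same_position:
  "m \<in> Sigma_star \<Longrightarrow> m \<noteq> (2, 1, 1) \<Longrightarrow> \<exists>X. same_position m X"
proof (induction rule: Sigma_star.induct)
  case root
  then show ?case by simp
next
  case (succ m s m')
  show ?case
  proof (cases "m = (2, 1, 1)")
    case True
    then have "m' = (5, 1, 2)" using succ.hyps by (simp add: is_succ_def)
    then show ?thesis using same_position.root by blast
  next
    case False
    then show ?thesis using succ same_position.child by (metis is_succ_def)
  qed
qed

theorem ex1_same_position:
  assumes "m \<in> Sigma_star" "m \<noteq> (2, 1, 1)"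
  shows "\<exists>!X. same_position m X"
  using Sigma_star_same_position[OF assms] same_position_unique by blast

lemma Sigma_star_cases: "m \<in> Sigma_star \<Longrightarrow> m = (2, 1, 1) \<or> regular m"
  using Sigma_star_same_position same_position_regular by blast

lemma is_succ_regular: "m \<in> Sigma_star \<Longrightarrow> is_succ s m m' \<Longrightarrow> regular m'"
proof -
  assume m: "m \<in> Sigma_star" and s: "is_succ s m m'"
  from Sigma_star_cases[OF m] show "regular m'"
  proof
    assume "m = (2, 1, 1)"
    then show ?thesis using s by (simp add: is_succ_def regular_def)
  next
    assume "regular m"
    then show ?thesis using s child_grows(1) by (simp add: is_succ_def)
  qed
qed

lemma is_succ_side:
  assumes "n \<in> Sigma_star" "n' \<in> Sigma_star" "is_succ s n m" "is_succ s' n' m"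
  shows "s = s'"
proof -
  have m: "m = child s n" "m = child s' n'" using assms by (simp_all add: is_succ_def)
  from Sigma_star_cases[OF assms(1)] Sigma_star_cases[OF assms(2)]
  consider "n = (2, 1, 1)" "n' = (2, 1, 1)" | "n = (2, 1, 1)" "regular n'"
    | "regular n" "n' = (2, 1, 1)" | "regular n" "regular n'"
    by blast
  then show ?thesis
  proof cases
    case 1
    then show ?thesis using assms by (simp add: is_succ_def)
  next
    case 2
    then have "m = (5, 1, 2)" using assms by (simp add: is_succ_def)
    then show ?thesis using m(2) child_neq_first[OF 2(2), of s'] by simp
  next
    case 3
    then have "m = (5, 1, 2)" using assms by (simp add: is_succ_def)
    then show ?thesis using m(1) child_neq_first[OF 3(1), of s] by simp
  next
    case 4
    then show ?thesis using m child_inject by simp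
  qed
qed

lemma child_sides:
  assumes "m \<in> Sigma_star" "is_succ s m n" "is_succ s' m n" shows "s = s'"
  using is_succ_side[OF assms(1) assms(1)] assms by blast

lemma other_other [simp]: "other (other s) = s" by (cases s) auto
lemma other_neq [simp]: "other s \<noteq> s" "s \<noteq> other s" by (cases s; simp)+
lemma neq_other: "s \<noteq> s' \<longleftrightarrow> s = other s'" by (cases s; cases s') auto

primrec zz :: "side \<Rightarrow> triple \<Rightarrow> nat \<Rightarrow> triple" where
  "zz s m 0 = m"
| "zz s m (Suc i) = child (if even i then s else other s) (zz s m i)"

lemma zigzag_zz:
  assumes "m \<in> Sigma_star" "m = (2, 1, 1) \<longrightarrow> s = Lft"
  shows "zigzag (zz s m)"
proof -
  have step: "zz s m i \<in> Sigma_star \<and>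
      is_succ (if even i then s else other s) (zz s m i) (zz s m (Suc i))" for i
  proof (induction i)
    case 0
    then show ?case using assms by (simp add: is_succ_def)
  next
    case (Suc i)
    have a: "zz s m (Suc i) \<in> Sigma_star" using Suc Sigma_star.succ by blast
    have "regular (zz s m (Suc i))" using Suc is_succ_regular by blast
    then have "zz s m (Suc i) \<noteq> (2, 1, 1)" by (auto simp: regular_def)
    with a show ?case by (simp add: is_succ_def)
  qed
  have "\<exists>t. is_succ t (zz s m i) (zz s m (i + 1)) \<and> is_succ (other t) (zz s m (i + 1)) (zz s m (i + 2))"
    for i
    using step[of i] step[of "Suc i"]
    by (intro exI[of _ "if even i then s else other s"]) (cases "even i"; simp)
  then show ?thesis using step by (simp add: zigzag_def)
qed

lemma zigzag_eq_zz:
  assumes z: "zigzag z" and s: "is_succ s (z 0) (z 1)"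
  shows "z = zz s (z 0)"
proof -
  have step: "is_succ (if even i then s else other s) (z i) (z (Suc i))" for i
  proof (induction i)
    case 0
    then show ?case using s by simp
  next
    case (Suc i)
    obtain t where t: "is_succ t (z i) (z (Suc i))" "is_succ (other t) (z (Suc i)) (z (Suc (Suc i)))"
      using z by (simp add: zigzag_def) blast
    have "z i \<in> Sigma_star" using z by (simp add: zigzag_def)
    from child_sides[OF this t(1) Suc] have "other t = (if even (Suc i) then s else other s)"
      by (cases "even i") simp_all
    with t(2) show ?case by simp
  qed
  have "z i = zz s (z 0) i" for i
  proof (induction i)
    case (Suc i)
    have "z (Suc i) = child (if even i then s else other s) (z i)"
      using step[of i] by (simp only: is_succ_def)
    with Suc show ?case by (simp only: zz.simps)
  qed simp
  then show ?thesis by blast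
qed

lemma zigzag_first: "zigzag z \<Longrightarrow> \<exists>s. is_succ s (z 0) (z 1)"
  unfolding zigzag_def by (metis add_0)

theorem ex1_maximal_zigzag:
  assumes m: "m \<in> Sigma_star"
  shows "\<exists>!z. maximal_zigzag z \<and> z 0 = m"
proof -
  have ext: "zigzag (case_nat n z) \<longleftrightarrow>
      n \<in> Sigma_star \<and> zigzag z \<and>
      (\<exists>s. is_succ s n (z 0) \<and> is_succ (other s) (z 0) (z 1))" for n z
  proof -
    have all: "(\<forall>i. P i) \<longleftrightarrow> P 0 \<and> (\<forall>i. P (Suc i))" for P :: "nat \<Rightarrow> bool"
    proof
      assume "P 0 \<and> (\<forall>i. P (Suc i))"
      then have "P i" for i by (cases i) simp_all
      then show "\<forall>i. P i" ..
    qed simp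
    have "(\<forall>i. case_nat n z i \<in> Sigma_star) \<longleftrightarrow> n \<in> Sigma_star \<and> (\<forall>i. z i \<in> Sigma_star)"
      by (subst all) simp
    moreover have "(\<forall>i. \<exists>s. is_succ s (case_nat n z i) (case_nat n z (i + 1)) \<and>
                 is_succ (other s) (case_nat n z (i + 1)) (case_nat n z (i + 2))) \<longleftrightarrow>
        (\<exists>s. is_succ s n (z 0) \<and> is_succ (other s) (z 0) (z 1)) \<and>
        (\<forall>i. \<exists>s. is_succ s (z i) (z (i + 1)) \<and> is_succ (other s) (z (i + 1)) (z (i + 2)))"
      by (subst all) (simp add: numeral_2_eq_2)
    ultimately show ?thesis unfolding zigzag_def by argo
  qed
  show ?thesis
  proof (cases "m = (2, 1, 1)")
    case True
    have no_anc: "\<not> is_succ s n m" if "n \<in> Sigma_star" for s n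
    proof
      assume "is_succ s n m"
      then have "regular m" using is_succ_regular that by blast
      then show False by (simp add: True regular_def)
    qed
    have max: "maximal_zigzag (zz Lft m)"
      using zigzag_zz[OF m] no_anc by (simp add: maximal_zigzag_def ext)
    have "z = zz Lft m" if "maximal_zigzag z" "z 0 = m" for z
    proof -
      have z: "zigzag z" using that by (simp add: maximal_zigzag_def)
      then obtain s where "is_succ s (z 0) (z 1)" using zigzag_first by blast
      moreover from this have "s = Lft" using that True by (simp add: is_succ_def)
      ultimately show ?thesis using zigzag_eq_zz[OF z] that by blast
    qed
    then show ?thesis using max zz.simps(1) by metis
  next
    case False
    then obtain n s where n: "n \<in> Sigma_star" "is_succ s n m"
      using Sigma_star.cases[OF m] by metis
    have z1: "is_succ s m (zz s m 1)" using False by (simp add: is_succ_def)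
    have zig: "zigzag (zz s m)" using zigzag_zz[OF m] False by blast
    have max: "maximal_zigzag (zz s m)"
    proof -
      have False if "n' \<in> Sigma_star" "is_succ t n' m" "is_succ (other t) m (zz s m 1)" for n' t
        using is_succ_side[OF n(1) that(1) n(2) that(2)] child_sides[OF m z1 that(3)]
        by simp
      then have "\<not> zigzag (case_nat n' (zz s m))" for n'
        unfolding ext zz.simps(1) by blast
      then show ?thesis using zig unfolding maximal_zigzag_def by blast
    qed
    have "z = zz s m" if z: "maximal_zigzag z" "z 0 = m" for z
    proof -
      have zz: "zigzag z" using z by (simp add: maximal_zigzag_def)
      then obtain t where t: "is_succ t (z 0) (z 1)" using zigzag_first by blast
      have "t = s"
      proof (rule ccontr)
        assume "t \<noteq> s"
        then have "is_succ (other s) (z 0) (z 1)" using t neq_other by simp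
        then have "zigzag (case_nat n z)" unfolding ext using zz n z(2) by blast
        then show False using z(1) unfolding maximal_zigzag_def by blast
      qed
      then show ?thesis using zigzag_eq_zz[OF zz] t z(2) by blast
    qed
    then show ?thesis using max zz.simps(1) by metis
  qed
qed

end

theory Submission
  imports Defs
begin

text \<open>
  The symmetric matrices in play have determinant 1 and are written $(a, b; b, c)$. For such matrices
  $y$, $x$ with $yMx$ again symmetric, the upper left entries of $x$, $y$, $yMx$ solve Markoff's
  equation, and the polar form of the determinant takes at $(y, yMx)$ and $(x, yMx)$ the values three
  times the upper left entry of $x$ and of $y$ (\<open>markoff\<close>, \<open>symmetric_product\<close>).
  A Gram determinant then shows that any three consecutive terms
  $x_i, x_{i+1}, x_{i+2}$ of a sequence with $x_{i+2} = x_{i+1} M_{i+1} x_i$ span a sublattice of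
  determinant $\pm 2$ (\<open>det3_sq\<close>).

  Along a zigzag the matrices form such a sequence, with positive entries $a_i$ that at least double
  and satisfy $a_{i+2} \asymp a_{i+1} a_i$. Hence $b_i / a_i$ converges to some $\xi$ with
  $|a_i \xi - b_i| \le 1 / a_i$, the growth $a_{i+1} \asymp a_i^\gamma$ follows by taking logarithms,
  and the linear independence of consecutive triples excludes a quadratic (or linear) equation for $\xi$.
  This gives the first half of the theorem. The bounds $1/2 \le b/a \le 1$ pass down the matrix tree.

  Every number in $\mathcal E_3^+$ is reached: after a change of signs its sequence has positive
  upper left entries. They solve Markoff's equation, and being unbounded they have a term that exceeds
  the two preceding ones. By Vieta descent (\<open>markoff_descent\<close>) that triple is a node, and from there
  on the sequence runs along a zigzag. Two sequences with the same coprime upper left entries have ratios $b/a$ that differ by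
  a sign and an integer translation (\<open>same_denominators_equivalent\<close>), so the limits are equivalent.

  Uniqueness rests on \<open>rigidity\<close>: if $y$ is a symmetric integral matrix of determinant 1
  that approximates $\xi$ as well as the $x_i$ do (up to a constant) and is large enough, then $y$ is
  some $x_i$. If $a_i \le p < a_{i+1}$, where $p$ is the upper left entry of $y$, then
  $\det(y, x_i, x_{i+1})$ is small, hence zero, so $2y = f x_i + g x_{i+1}$ with integers $f, g$;
  the equation $f^2 + g^2 + 3 a_{i-1} f g = 4$ and the size of $y$ leave only $fg = 0$. An equivalence
  between two of the limits therefore carries one matrix sequence to a tail of the other, one step
  to one step. Since it preserves the polar form, and consecutive polar forms are $3 a_i$,
  the sequences $a_i$ have a common tail; this determines the maximal zigzag.
\<close>

section \<open>Two by two matrices\<close>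

lemma mat2_nth [simp]:
  "mat2 a b c d $ 1 $ 1 = a" "mat2 a b c d $ 1 $ 2 = b"
  "mat2 a b c d $ 2 $ 1 = c" "mat2 a b c d $ 2 $ 2 = d"
  by (simp_all add: mat2_def)

lemma mat2_eq_iff:
  "A = mat2 a b c d \<longleftrightarrow> A $ 1 $ 1 = a \<and> A $ 1 $ 2 = b \<and> A $ 2 $ 1 = c \<and> A $ 2 $ 2 = d"
  by (auto simp: vec_eq_iff forall_2)

lemma mat2_mult:
  fixes a b c d :: "'a::semiring_1"
  shows "mat2 a b c d ** mat2 a' b' c' d' =
    mat2 (a * a' + b * c') (a * b' + b * d') (c * a' + d * c') (c * b' + d * d')"
  by (simp add: mat2_eq_iff matrix_matrix_mult_def sum_2)

lemma transpose_mat2: "transpose (mat2 a b c d) = mat2 a c b d"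
  by (simp add: mat2_eq_iff transpose_def)

lemma det_mat2: "det (mat2 a b c d) = a * d - b * (c :: 'a::comm_ring_1)"
  by (simp add: det_2)

lemma invertible_mat2_iff:
  fixes a b c d :: int
  shows "invertible (mat2 a b c d) \<longleftrightarrow> \<bar>a * d - b * c\<bar> = 1"
proof
  assume "invertible (mat2 a b c d)"
  then obtain A' where "mat2 a b c d ** A' = mat 1"
    unfolding invertible_def by blast
  then have "det (mat2 a b c d) * det A' = 1"
    using det_mul det_I by metis
  then show "\<bar>a * d - b * c\<bar> = 1"
    by (metis det_mat2 abs_zmult_eq_1 abs_one)
next
  assume D: "\<bar>a * d - b * c\<bar> = 1"
  define e where "e = a * d - b * c"
  have "e = 1 \<or> e = -1" using D unfolding e_def by linarith
  then have e: "e * e = 1" by auto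
  have I: "mat 1 = mat2 1 0 0 (1::int)"
    by (simp add: mat2_eq_iff mat_def)
  have "mat2 a b c d ** mat2 (e * d) (- e * b) (- e * c) (e * a) = mat 1"
    "mat2 (e * d) (- e * b) (- e * c) (e * a) ** mat2 a b c d = mat 1"
    unfolding I mat2_mult mat2_eq_iff mat2_nth using e by (auto simp: e_def algebra_simps)
  then show "invertible (mat2 a b c d)" unfolding invertible_def by blast
qed

lemma infnorm_matrix_ge: "\<bar>A $ i $ j\<bar> \<le> infnorm (A :: real^'n^'m)"
proof -
  have "axis i (axis j (1::real)) \<in> Basis" by (simp add: axis_in_Basis_iff)
  from Basis_le_infnorm[OF this, of A] show ?thesis by (simp add: inner_axis)
qed

lemma infnorm_matrix_le:
  assumes "\<And>i j. \<bar>A $ i $ j\<bar> \<le> K"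
  shows "infnorm (A :: real^'n^'m) \<le> K"
proof -
  have "\<bar>A \<bullet> u\<bar> \<le> K" if "u \<in> Basis" for u
    using that assms by (auto simp: Basis_vec_def inner_axis)
  then show ?thesis by (simp add: infnorm_Max)
qed

lemma infnorm_vector_le:
  assumes "\<And>i. \<bar>v $ i\<bar> \<le> K"
  shows "infnorm (v :: real^'n) \<le> K"
proof -
  have "\<bar>v \<bullet> u\<bar> \<le> K" if "u \<in> Basis" for u
    using that assms by (auto simp: Basis_vec_def inner_axis)
  then show ?thesis by (simp add: infnorm_Max)
qed

lemma vector_mult_mat2_nth:
  "(vector [\<xi>, -1] v* real_mat (mat2 a b c d)) $ 1 = of_int a * \<xi> - of_int c"
  "(vector [\<xi>, -1] v* real_mat (mat2 a b c d)) $ 2 = of_int b * \<xi> - of_int d"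
  by (simp_all add: vector_matrix_mult_def sum_2 map_matrix_def)

lemma real_mat_nth: "real_mat A $ i $ j = of_int (A $ i $ j)"
  by (simp add: map_matrix_def)

section \<open>Symmetric matrices of determinant one\<close>

text \<open>
  The triple \<open>(a, b, c)\<close> stands for the symmetric matrix with rows $(a, b)$ and $(b, c)$.
  \<open>polar\<close> is the polar form of the determinant $ac - b^2$, normalised so that its value at a pair
  of equal arguments is twice the determinant.
\<close>
definition polar :: "int \<times> int \<times> int \<Rightarrow> int \<times> int \<times> int \<Rightarrow> int" where
  "polar x y = (case (x, y) of ((a, b, c), (a', b', c')) \<Rightarrow> a * c' + c * a' - 2 * b * b')"

text \<open>The determinant with the three triples as rows.\<close>
definition det3 :: "int \<times> int \<times> int \<Rightarrow> int \<times> int \<times> int \<Rightarrow> int \<times> int \<times> int \<Rightarrow> int" where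
  "det3 x y z = (case (x, y, z) of ((a, b, c), (a', b', c'), (a'', b'', c'')) \<Rightarrow>
     a * (b' * c'' - b'' * c') - a' * (b * c'' - b'' * c) + a'' * (b * c' - b' * c))"

text \<open>
  Since $a'b - b'a$ is small for matrices that approximate the same number, the polar form is close to
  $a/a' + a'/a$.
\<close>
lemma polar_mult:
  assumes "a * c - b\<^sup>2 = 1" "a' * c' - b'\<^sup>2 = 1"
  shows "polar (a, b, c) (a', b', c') * a * a' = a\<^sup>2 + a'\<^sup>2 + (a' * b - b' * a)\<^sup>2"
proof -
  have "polar (a, b, c) (a', b', c') * a * a'
      = a\<^sup>2 * (a' * c' - b'\<^sup>2) + a'\<^sup>2 * (a * c - b\<^sup>2) + (a' * b - b' * a)\<^sup>2"
    unfolding polar_def by (simp add: algebra_simps power2_eq_square)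
  then show ?thesis using assms by simp
qed

text \<open>The Gram determinant with respect to the polar form, whose discriminant is 2.\<close>
lemma gram_det3:
  assumes "a * c - b\<^sup>2 = 1" "a' * c' - b'\<^sup>2 = 1" "a'' * c'' - b''\<^sup>2 = 1"
    and "P = polar (a, b, c) (a', b', c')" "Q = polar (a', b', c') (a'', b'', c'')"
      "R = polar (a, b, c) (a'', b'', c'')"
  shows "(det3 (a, b, c) (a', b', c') (a'', b'', c''))\<^sup>2 = 4 + P * Q * R - P\<^sup>2 - Q\<^sup>2 - R\<^sup>2"
proof -
  define u u' u'' where u: "u = a * c - b\<^sup>2" "u' = a' * c' - b'\<^sup>2" "u'' = a'' * c'' - b''\<^sup>2"
  have "(det3 (a, b, c) (a', b', c') (a'', b'', c''))\<^sup>2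
      = 4 * u * u' * u'' + P * Q * R - u'' * P\<^sup>2 - u * Q\<^sup>2 - u' * R\<^sup>2"
    unfolding u assms(4-6) polar_def det3_def split by (simp add: algebra_simps power2_eq_square)
  then show ?thesis using assms(1-3) by (simp add: u)
qed

lemma cramer3:
  fixes x y z w :: "int \<times> int \<times> int"
  shows "det3 x y z * fst w = det3 w y z * fst x + det3 x w z * fst y + det3 x y w * fst z"
    "det3 x y z * fst (snd w)
      = det3 w y z * fst (snd x) + det3 x w z * fst (snd y) + det3 x y w * fst (snd z)"
    "det3 x y z * snd (snd w)
      = det3 w y z * snd (snd x) + det3 x w z * snd (snd y) + det3 x y w * snd (snd z)"
  by (cases x; cases y; cases z; cases w; simp add: det3_def algebra_simps)+

text \<open>
  Here \<open>(A, B, C)\<close> is the product $yMx$, where $M$ has rows $(3, e)$ and $(-e, 0)$; the two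
  expressions for \<open>B\<close> say that the product is symmetric.
\<close>
lemma symmetric_product:
  fixes a b c a' b' c' e A B C :: int
  assumes det: "a * c - b\<^sup>2 = 1" "a' * c' - b'\<^sup>2 = 1"
    and A: "A = 3 * a' * a + e * (a' * b - b' * a)"
    and B: "B = 3 * a' * b + e * (a' * c - b' * b)"
    and B': "B = 3 * b' * a + e * (b' * b - c' * a)"
    and C: "C = 3 * b' * b + e * (b' * c - c' * b)"
  shows "A * b' - B * a' = e * a" "A * b - B * a = - e * a'"
    "polar (a', b', c') (A, B, C) = 3 * a" "polar (a, b, c) (A, B, C) = 3 * a'"
proof -
  have 1: "A * b' - B * a' = e * a * (a' * c' - b'\<^sup>2)"
    unfolding A B' by (simp add: algebra_simps power2_eq_square)
  have 2: "A * b - B * a = - e * a' * (a * c - b\<^sup>2)"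
    unfolding A B by (simp add: algebra_simps power2_eq_square)
  have 3: "a' * C - b' * B = - e * b * (a' * c' - b'\<^sup>2)"
    unfolding C B by (simp add: algebra_simps power2_eq_square)
  have 4: "c' * A - b' * B = (3 * a + e * b) * (a' * c' - b'\<^sup>2)"
    unfolding A B' by (simp add: algebra_simps power2_eq_square)
  have 5: "a * C - b * B = e * b' * (a * c - b\<^sup>2)"
    unfolding C B' by (simp add: algebra_simps power2_eq_square)
  have 6: "c * A - b * B = (3 * a' - e * b') * (a * c - b\<^sup>2)"
    unfolding A B by (simp add: algebra_simps power2_eq_square)
  show "A * b' - B * a' = e * a" "A * b - B * a = - e * a'"
    using 1 2 det by simp_all
  show "polar (a', b', c') (A, B, C) = 3 * a" using 3 4 det by (simp add: polar_def)
  show "polar (a, b, c) (A, B, C) = 3 * a'" using 5 6 det by (simp add: polar_def)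
qed

section \<open>Sequences with Markoff recurrence\<close>

text \<open>
  A sequence of symmetric integral matrices of determinant 1 with $x_{i+2} = x_{i+1} M x_i$, where $M$
  has rows $(3, e_i)$ and $(-e_i, 0)$ and the sign $e_i$ alternates. The entries of the recurrence are
  assumptions, the off-diagonal entry occurring twice. No condition is put on the sign of $e_0$, so
  that every tail is again such a sequence.
\<close>
locale matrix_seq =
  fixes a b c e :: "nat \<Rightarrow> int"
  assumes e_sq: "e i * e i = 1"
    and e_Suc: "e (Suc i) = - e i"
    and det1: "a i * c i - (b i)\<^sup>2 = 1"
    and rec_a: "a (Suc (Suc i)) = 3 * a (Suc i) * a i + e i * (a (Suc i) * b i - b (Suc i) * a i)"
    and rec_b: "b (Suc (Suc i)) = 3 * a (Suc i) * b i + e i * (a (Suc i) * c i - b (Suc i) * b i)"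
    and rec_b': "b (Suc (Suc i)) = 3 * b (Suc i) * a i + e i * (b (Suc i) * b i - c (Suc i) * a i)"
    and rec_c: "c (Suc (Suc i)) = 3 * b (Suc i) * b i + e i * (b (Suc i) * c i - c (Suc i) * b i)"
begin

abbreviation pt :: "nat \<Rightarrow> int \<times> int \<times> int" where "pt i \<equiv> (a i, b i, c i)"

definition delta :: "nat \<Rightarrow> int" where "delta i = a (Suc i) * b i - b (Suc i) * a i"

lemma e_cases: "e i = 1 \<or> e i = - 1"
  using e_sq[of i] by (simp add: square_eq_1_iff)

lemma a_Suc_Suc: "a (Suc (Suc i)) = 3 * a (Suc i) * a i + e i * delta i"
  unfolding delta_def by (rule rec_a)

lemma delta_eq: "delta i = e i * (a (Suc (Suc i)) - 3 * a (Suc i) * a i)"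
  using e_cases[of i] by (auto simp: a_Suc_Suc)

text \<open>This is the symmetry of $x_{i+2}$.\<close>
lemma polar_Suc_delta: "polar (pt i) (pt (Suc i)) = - 3 * e i * delta i"
proof -
  have "3 * delta i + e i * polar (pt i) (pt (Suc i)) = 0"
    using rec_b[of i] rec_b'[of i] unfolding delta_def polar_def by (simp add: algebra_simps)
  then show ?thesis using e_cases[of i] by auto
qed

lemmas product_step = symmetric_product[OF det1 det1 rec_a rec_b rec_b' rec_c]

lemma delta_Suc: "delta (Suc i) = e i * a i"
  using product_step(1)[of i] by (simp add: delta_def)

lemma a_rec3: "a (Suc (Suc (Suc i))) = 3 * a (Suc (Suc i)) * a (Suc i) - a i"
  using a_Suc_Suc[of "Suc i"] e_cases[of i] by (auto simp: delta_Suc e_Suc)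

lemma polar_Suc_Suc: "polar (pt (Suc i)) (pt (Suc (Suc i))) = 3 * a i"
  by (rule product_step(3))

lemma polar_Suc2: "polar (pt i) (pt (Suc (Suc i))) = 3 * a (Suc i)"
  by (rule product_step(4))

lemma polar_mult_a: "polar (pt i) (pt (Suc i)) * a i * a (Suc i)
    = (a i)\<^sup>2 + (a (Suc i))\<^sup>2 + (delta i)\<^sup>2"
  using polar_mult[OF det1[of i] det1[of "Suc i"]] by (simp add: delta_def)

lemma markoff: "(a i)\<^sup>2 + (a (Suc i))\<^sup>2 + (a (Suc (Suc i)))\<^sup>2
    = 3 * a i * a (Suc i) * a (Suc (Suc i))"
proof -
  have "(a i)\<^sup>2 + (a (Suc i))\<^sup>2 + (e i * delta i)\<^sup>2 = - 3 * (e i * delta i) * a i * a (Suc i)"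
    using polar_mult_a[of i] e_sq[of i] unfolding polar_Suc_delta
    by (simp add: power_mult_distrib power2_eq_square algebra_simps)
  moreover define d where "d = e i * delta i"
  ultimately show ?thesis
    unfolding a_Suc_Suc by (fold d_def) (simp add: power2_eq_square algebra_simps)
qed

text \<open>
  The three polar forms are three times the entries of a Markoff triple, so in the Gram determinant
  everything but the constant cancels.
\<close>
lemma det3_sq: "(det3 (pt i) (pt (Suc i)) (pt (Suc (Suc i))))\<^sup>2 = 4"
proof -
  have P: "polar (pt i) (pt (Suc i)) = 3 * (3 * a (Suc i) * a i - a (Suc (Suc i)))"
    unfolding polar_Suc_delta delta_eq using e_cases[of i] by auto
  show ?thesis
    unfolding gram_det3[OF det1 det1 det1 refl refl refl] P polar_Suc_Suc polar_Suc2
    using markoff[of i] by (simp add: power2_eq_square algebra_simps)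
qed

lemma a_nonzero: "a i \<noteq> 0"
proof
  assume "a i = 0"
  then have "- ((b i)\<^sup>2) = 1" using det1[of i] by simp
  then show False using zero_le_power2[of "b i"] by linarith
qed

end

section \<open>The limit of the ratios\<close>

lemma golden_sq: "golden * golden = golden + 1"
  by (simp add: golden_def field_simps)

lemma golden_bounds: "1 < golden" "golden < 1.7"
proof -
  have "sqrt 5 < 2.4" by (rule real_less_lsqrt) (simp_all add: power2_eq_square)
  moreover have "1 < sqrt 5" by simp
  ultimately show "1 < golden" "golden < 1.7" unfolding golden_def by simp_all
qed

text \<open>
  The upper left entries are positive and at least double from term to term, as they do along a zigzag;
  in a general sequence this may fail at first.
\<close>
locale markoff_seq = matrix_seq +
  assumes a_pos: "0 < a i"
    and a_grow: "2 * a i \<le> a (Suc i)"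
begin

lemma a_less_Suc: "a i < a (Suc i)"
  using a_pos[of i] a_grow[of i] by linarith

lemma strict_mono_a: "strict_mono a"
  using a_less_Suc by (simp add: strict_mono_Suc_iff)

lemma a_ge_power: "2 ^ i \<le> a i"
proof (induction i)
  case 0 then show ?case using a_pos[of 0] by simp
next
  case (Suc i) then show ?case using a_grow[of i] by simp
qed

lemma a_ge: "int i + 1 \<le> a i"
proof (induction i)
  case 0 then show ?case using a_pos[of 0] by simp
next
  case (Suc i) then show ?case using a_grow[of i] by simp
qed

lemma markoff_vieta:
  "a (Suc (Suc i)) * (3 * a (Suc i) * a i - a (Suc (Suc i))) = (a i)\<^sup>2 + (a (Suc i))\<^sup>2"
  using markoff[of i] by (simp add: power2_eq_square algebra_simps)

lemma a_upper: "a (Suc (Suc i)) < 3 * a (Suc i) * a i"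
proof -
  have "0 < a (Suc (Suc i)) * (3 * a (Suc i) * a i - a (Suc (Suc i)))"
    unfolding markoff_vieta using a_pos[of i] a_pos[of "Suc i"] by (simp add: add_pos_pos)
  then show ?thesis using a_pos[of "Suc (Suc i)"] by (simp add: zero_less_mult_iff)
qed

lemma a_lower: "2 * a (Suc i) * a i \<le> a (Suc (Suc i))"
proof (rule ccontr)
  assume "\<not> ?thesis"
  then have "a (Suc i) * a i < 3 * a (Suc i) * a i - a (Suc (Suc i))"
    by (simp add: algebra_simps)
  moreover have "a (Suc i) \<le> a (Suc i) * a i"
    using a_pos[of i] a_pos[of "Suc i"] by simp
  ultimately have 1: "a (Suc i) < 3 * a (Suc i) * a i - a (Suc (Suc i))" by linarith
  have "2 * a (Suc i) * a (Suc i) < a (Suc (Suc i)) * (3 * a (Suc i) * a i - a (Suc (Suc i)))"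
    using a_grow[of "Suc i"] 1 a_pos[of "Suc i"]
    by (intro mult_le_less_imp_less) simp_all
  also have "\<dots> \<le> (a (Suc i))\<^sup>2 + (a (Suc i))\<^sup>2"
    unfolding markoff_vieta using a_less_Suc[of i] a_pos[of i] by (simp add: power_mono)
  finally show False by (simp add: power2_eq_square)
qed

lemma delta_bound: "8 * \<bar>delta i\<bar> * a i \<le> 5 * a (Suc i)"
proof -
  have d: "\<bar>delta i\<bar> = 3 * a (Suc i) * a i - a (Suc (Suc i))"
    using a_upper[of i] e_cases[of i] unfolding delta_eq by auto
  have q: "4 * (a i)\<^sup>2 \<le> (a (Suc i))\<^sup>2"
    using power_mono[OF a_grow[of i], of 2] a_pos[of i] by (simp add: power_mult_distrib)
  have "4 * \<bar>delta i\<bar> * (2 * a (Suc i) * a i) \<le> 4 * \<bar>delta i\<bar> * a (Suc (Suc i))"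
    using a_lower[of i] by (intro mult_left_mono) simp_all
  also have "\<dots> = 4 * ((a i)\<^sup>2 + (a (Suc i))\<^sup>2)"
    unfolding d using markoff_vieta[of i] by (simp add: algebra_simps)
  also have "\<dots> \<le> 5 * (a (Suc i))\<^sup>2" using q by simp
  finally have "a (Suc i) * (8 * \<bar>delta i\<bar> * a i) \<le> a (Suc i) * (5 * a (Suc i))"
    by (simp add: power2_eq_square mult_ac)
  then show ?thesis using a_pos[of "Suc i"] by simp
qed

definition ratio :: "nat \<Rightarrow> real" where "ratio i = of_int (b i) / of_int (a i)"

lemma ratio_step: "\<bar>ratio i - ratio (Suc i)\<bar> \<le> 5 / 8 / (of_int (a i))\<^sup>2"
proof -
  have p: "0 < real_of_int (a i)" "0 < real_of_int (a (Suc i))" using a_pos by simp_all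
  have "ratio i - ratio (Suc i) = of_int (delta i) / (of_int (a i) * of_int (a (Suc i)))"
    using p by (simp add: ratio_def delta_def field_simps)
  then have 1: "\<bar>ratio i - ratio (Suc i)\<bar>
      = of_int \<bar>delta i\<bar> / (of_int (a i) * of_int (a (Suc i)))"
    using p by (simp add: abs_mult)
  have "of_int (8 * \<bar>delta i\<bar> * a i) \<le> (of_int (5 * a (Suc i)) :: real)"
    using delta_bound[of i] of_int_le_iff by blast
  then show ?thesis unfolding 1 using p by (simp add: field_simps power2_eq_square)
qed

text \<open>
  The steps are at most $5/(8 a_i^2)$ and $a_{i+1} \ge 2 a_i$, so by induction the total distance is at
  most $(5/8 + 1/4)/a_i^2$.
\<close>
lemma ratio_dist: "\<bar>ratio i - ratio (i + n)\<bar> \<le> 1 / (of_int (a i))\<^sup>2"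
proof (induction n arbitrary: i)
  case 0 then show ?case by simp
next
  case (Suc n)
  have p: "0 < real_of_int (a i)" using a_pos by simp
  have "2 * real_of_int (a i) \<le> real_of_int (a (Suc i))"
    using a_grow[of i] by linarith
  then have "(2 * real_of_int (a i))\<^sup>2 \<le> (real_of_int (a (Suc i)))\<^sup>2"
    using p by (intro power_mono) simp_all
  then have q: "1 / (real_of_int (a (Suc i)))\<^sup>2 \<le> 1 / 4 / (real_of_int (a i))\<^sup>2"
    using p a_pos[of "Suc i"] by (simp add: field_simps power_mult_distrib)
  have "\<bar>ratio i - ratio (i + Suc n)\<bar>
      \<le> \<bar>ratio i - ratio (Suc i)\<bar> + \<bar>ratio (Suc i) - ratio (Suc i + n)\<bar>" by simp
  also have "\<dots> \<le> 5 / 8 / (of_int (a i))\<^sup>2 + 1 / (real_of_int (a (Suc i)))\<^sup>2"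
    using ratio_step[of i] Suc.IH[of "Suc i"] by (rule add_mono)
  also have "\<dots> \<le> 5 / 8 / (of_int (a i))\<^sup>2 + 1 / 4 / (real_of_int (a i))\<^sup>2" using q by simp
  also have "\<dots> \<le> 1 / (of_int (a i))\<^sup>2" using p by (simp add: field_simps)
  finally show ?case .
qed

lemma inverse_a_le: "1 / (of_int (a i)) \<le> (1 / 2 :: real) ^ i"
proof -
  have "(2::real) ^ i \<le> of_int (a i)"
    using a_ge_power[of i] by (metis of_int_le_iff of_int_numeral of_int_power)
  then show ?thesis by (simp add: power_one_over frac_le)
qed

lemma inverse_a_tendsto: "(\<lambda>i. 1 / real_of_int (a i)) \<longlonglongrightarrow> 0"
proof (rule tendsto_sandwich[of "\<lambda>_. 0" _ _ "\<lambda>i. (1/2)^i"])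
  show "\<forall>\<^sub>F n in sequentially. 0 \<le> 1 / real_of_int (a n)"
    using a_pos by (simp add: less_imp_le)
  show "(\<lambda>i. (1 / 2 :: real) ^ i) \<longlonglongrightarrow> 0" by (rule LIMSEQ_power_zero) simp
qed (use inverse_a_le in auto)

text \<open>The number approximated by the sequence.\<close>
definition xi :: real where "xi = lim ratio"

lemma ratio_tendsto: "ratio \<longlonglongrightarrow> xi"
proof -
  have "Cauchy ratio"
  proof (rule metric_CauchyI)
    fix \<epsilon> :: real assume "0 < \<epsilon>"
    then have "\<forall>\<^sub>F i in sequentially. 1 / real_of_int (a i) < \<epsilon> / 2"
      by (intro order_tendstoD(2)[OF inverse_a_tendsto]) simp
    then obtain N where N: "1 / real_of_int (a N) < \<epsilon> / 2"
      by (auto simp: eventually_sequentially)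
    have d: "dist (ratio N) (ratio n) < \<epsilon> / 2" if "N \<le> n" for n
    proof -
      have "1 \<le> real_of_int (a N)" using a_pos[of N] by linarith
      then have "1 / (real_of_int (a N))\<^sup>2 \<le> 1 / real_of_int (a N)"
        by (intro frac_le) (simp_all add: power2_eq_square)
      moreover have "dist (ratio N) (ratio n) \<le> 1 / (real_of_int (a N))\<^sup>2"
        using ratio_dist[of N "n - N"] that by (simp add: dist_real_def)
      ultimately show ?thesis using N by linarith
    qed
    show "\<exists>M. \<forall>m\<ge>M. \<forall>n\<ge>M. dist (ratio m) (ratio n) < \<epsilon>"
      using d dist_triangle_half_r by blast
  qed
  then show ?thesis unfolding xi_def by (simp add: Cauchy_convergent_iff convergent_LIMSEQ_iff)
qed

text \<open>
  \<open>ell\<close> and \<open>omega\<close> are the coordinates of the matrix $x_i$ that are small because $x_i$ is close to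
  $a_i$ times the rank one matrix with rows $(1, \xi)$ and $(\xi, \xi^2)$: \<open>ell\<close> is linear and
  \<open>omega\<close> is the value of the quadratic form at $(\xi, -1)$.
\<close>
definition ell :: "nat \<Rightarrow> real" where "ell i = of_int (a i) * xi - of_int (b i)"
definition omega :: "nat \<Rightarrow> real" where
  "omega i = of_int (c i) - 2 * of_int (b i) * xi + of_int (a i) * xi\<^sup>2"

lemma ell_bound: "\<bar>ell i\<bar> \<le> 1 / of_int (a i)"
proof -
  have p: "0 < real_of_int (a i)" using a_pos by simp
  have "(\<lambda>n. \<bar>ratio i - ratio (n + i)\<bar>) \<longlonglongrightarrow> \<bar>ratio i - xi\<bar>"
    by (intro tendsto_intros LIMSEQ_ignore_initial_segment ratio_tendsto)
  then have "\<bar>ratio i - xi\<bar> \<le> 1 / (of_int (a i))\<^sup>2"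
    by (rule LIMSEQ_le_const2) (metis ratio_dist add.commute)
  then have "of_int (a i) * \<bar>ratio i - xi\<bar> \<le> 1 / of_int (a i)"
    using p by (simp add: field_simps power2_eq_square)
  moreover have "ell i = of_int (a i) * - (ratio i - xi)"
    using p by (simp add: ell_def ratio_def field_simps)
  ultimately show ?thesis using p by (simp add: abs_mult abs_minus_commute)
qed

lemma a_omega: "of_int (a i) * omega i = 1 + (ell i)\<^sup>2"
proof -
  have "real_of_int (a i * c i - (b i)\<^sup>2) = 1" by (simp only: det1 of_int_1)
  then show ?thesis
    by (simp add: omega_def ell_def power2_eq_square algebra_simps)
qed

lemma omega_bounds: "0 < omega i" "omega i \<le> 2 / of_int (a i)"
proof -
  have p: "1 \<le> real_of_int (a i)" using a_pos[of i] by linarith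
  then have "\<bar>ell i\<bar> \<le> 1" using ell_bound[of i] by (smt (verit) divide_le_eq_1_pos)
  then have "(ell i)\<^sup>2 \<le> 1" by (simp add: abs_square_le_1)
  then have "of_int (a i) * omega i \<le> 2" unfolding a_omega by simp
  then show "omega i \<le> 2 / of_int (a i)" using p by (simp add: field_simps)
  have "0 < of_int (a i) * omega i" unfolding a_omega by (simp add: add_pos_nonneg)
  then show "0 < omega i" using p by (simp add: zero_less_mult_iff)
qed

lemma b_eq: "of_int (b i) = of_int (a i) * xi - ell i"
  by (simp add: ell_def)

lemma c_eq: "of_int (c i) = of_int (a i) * xi\<^sup>2 - 2 * ell i * xi + omega i"
  by (simp add: ell_def omega_def algebra_simps power2_eq_square)

lemma eventually_a_gt: "\<forall>\<^sub>F i in sequentially. K < real_of_int (a i)"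
proof (rule eventually_sequentiallyI)
  fix i assume "nat \<lceil>K\<rceil> \<le> i"
  then show "K < real_of_int (a i)" using a_ge[of i] by linarith
qed

text \<open>
  An integral relation makes the integers $A a_i + B b_i + C c_i$ tend to 0, so they vanish from some
  point on; three consecutive matrices are linearly independent, so $A = B = C = 0$.
\<close>
lemma xi_no_quadratic:
  fixes A B C :: int
  assumes 0: "of_int A + of_int B * xi + of_int C * xi\<^sup>2 = 0"
  shows "A = 0 \<and> B = 0 \<and> C = 0"
proof -
  define T where "T i = A * a i + B * b i + C * c i" for i
  have T: "real_of_int (T i) = - of_int B * ell i + of_int C * (omega i - 2 * ell i * xi)" for i
  proof -
    have "real_of_int (T i) = of_int (a i) * (of_int A + of_int B * xi + of_int C * xi\<^sup>2)
        - of_int B * ell i + of_int C * (omega i - 2 * ell i * xi)"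
      unfolding T_def of_int_add of_int_mult b_eq c_eq by (simp add: algebra_simps)
    then show ?thesis using 0 by simp
  qed
  define K where "K = \<bar>of_int B\<bar> + \<bar>of_int C\<bar> * (2 + 2 * \<bar>xi\<bar>)"
  have bound: "\<bar>real_of_int (T i)\<bar> \<le> K / of_int (a i)" for i
  proof -
    have p: "0 < real_of_int (a i)" using a_pos by simp
    have "\<bar>real_of_int (T i)\<bar> \<le> \<bar>of_int B\<bar> * \<bar>ell i\<bar> + \<bar>of_int C\<bar> * (\<bar>omega i\<bar> + 2 * \<bar>ell i\<bar> * \<bar>xi\<bar>)"
    proof -
      have "\<bar>omega i - 2 * ell i * xi\<bar> \<le> \<bar>omega i\<bar> + 2 * \<bar>ell i\<bar> * \<bar>xi\<bar>"
        using abs_triangle_ineq4[of "omega i" "2 * ell i * xi"] by (simp add: abs_mult)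
      then have "\<bar>of_int C\<bar> * \<bar>omega i - 2 * ell i * xi\<bar>
          \<le> \<bar>of_int C\<bar> * (\<bar>omega i\<bar> + 2 * \<bar>ell i\<bar> * \<bar>xi\<bar>)"
        by (rule mult_left_mono) simp
      then show ?thesis unfolding T
        using abs_triangle_ineq[of "- of_int B * ell i" "of_int C * (omega i - 2 * ell i * xi)"]
        by (simp add: abs_mult)
    qed
    also have "\<dots> \<le> \<bar>of_int B\<bar> * (1 / of_int (a i))
        + \<bar>of_int C\<bar> * (2 / of_int (a i) + 2 * (1 / of_int (a i)) * \<bar>xi\<bar>)"
      using ell_bound[of i] omega_bounds[of i]
      by (intro add_mono mult_mono mult_nonneg_nonneg add_nonneg_nonneg) (simp_all add: a_pos less_imp_le)
    also have "\<dots> = K / of_int (a i)" using p by (simp add: K_def field_simps)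
    finally show ?thesis .
  qed
  have "\<forall>\<^sub>F i in sequentially. T i = 0"
    using eventually_a_gt[of K]
  proof eventually_elim
    case (elim i)
    then have "K / of_int (a i) < 1" using a_pos[of i] by simp
    then have "\<bar>real_of_int (T i)\<bar> < 1" using bound[of i] by linarith
    then show ?case by linarith
  qed
  then obtain N where N: "T i = 0" if "N \<le> i" for i
    by (auto simp: eventually_sequentially)
  define D where "D = det3 (pt N) (pt (Suc N)) (pt (Suc (Suc N)))"
  have "D \<noteq> 0" using det3_sq[of N] by (auto simp: D_def)
  moreover
  define a1 a2 b1 b2 c1 c2 where abc: "a1 = a (Suc N)" "a2 = a (Suc (Suc N))"
    "b1 = b (Suc N)" "b2 = b (Suc (Suc N))" "c1 = c (Suc N)" "c2 = c (Suc (Suc N))"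
  have "D * A = T N * (b1 * c2 - b2 * c1) - T (Suc N) * (b N * c2 - b2 * c N)
      + T (Suc (Suc N)) * (b N * c1 - b1 * c N)"
    "D * B = - T N * (a1 * c2 - a2 * c1) + T (Suc N) * (a N * c2 - a2 * c N)
      - T (Suc (Suc N)) * (a N * c1 - a1 * c N)"
    "D * C = T N * (a1 * b2 - a2 * b1) - T (Suc N) * (a N * b2 - a2 * b N)
      + T (Suc (Suc N)) * (a N * b1 - a1 * b N)"
    unfolding D_def T_def det3_def split abc[symmetric] by (simp_all add: algebra_simps)
  then have "D * A = 0" "D * B = 0" "D * C = 0" using N by simp_all
  ultimately show ?thesis by simp
qed

lemma xi_irrational: "xi \<notin> \<rat>"
proof
  assume "xi \<in> \<rat>"
  then obtain p q :: int where "q \<noteq> 0" "xi = of_int p / of_int q"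
    using Rats_cases'[of xi] less_irrefl by metis
  then have "of_int (- p) + of_int q * xi + of_int 0 * xi\<^sup>2 = 0" by simp
  from xi_no_quadratic[OF this] show False using \<open>q \<noteq> 0\<close> by simp
qed

lemma xi_not_quadratic: "\<not> quadratic_over_rat xi"
proof
  assume "quadratic_over_rat xi"
  then obtain p :: "rat poly" where p: "degree p = 2" "poly (map_poly of_rat p) xi = 0"
    unfolding quadratic_over_rat_def by blast
  have "degree (map_poly of_rat p :: real poly) = 2"
    using p(1) by (subst degree_map_poly) auto
  then have e: "of_rat (coeff p 0) + of_rat (coeff p 1) * xi + of_rat (coeff p 2) * xi\<^sup>2 = 0"
    using p(2) by (simp add: poly_altdef coeff_map_poly numeral_2_eq_2)
  have nz: "coeff p 2 \<noteq> 0" using p(1) by (metis coeff_0 degree_0 leading_coeff_0_iff zero_neq_numeral)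
  obtain n0 d0 where 0: "coeff p 0 = of_int n0 / of_int d0" "d0 > 0"
    by (metis quotient_of_div quotient_of_denom_pos surj_pair)
  obtain n1 d1 where 1: "coeff p 1 = of_int n1 / of_int d1" "d1 > 0"
    by (metis quotient_of_div quotient_of_denom_pos surj_pair)
  obtain n2 d2 where 2: "coeff p 2 = of_int n2 / of_int d2" "d2 > 0"
    by (metis quotient_of_div quotient_of_denom_pos surj_pair)
  have r: "of_int n0 = of_int d0 * (of_rat (coeff p 0) :: real)"
    "of_int n1 = of_int d1 * (of_rat (coeff p 1) :: real)"
    "of_int n2 = of_int d2 * (of_rat (coeff p 2) :: real)"
    using 0 1 2 by (simp_all add: of_rat_divide)
  have "of_int (n0 * d1 * d2) + of_int (n1 * d0 * d2) * xi + of_int (n2 * d0 * d1) * xi\<^sup>2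
     = of_int (d0 * d1 * d2) * (of_rat (coeff p 0) + of_rat (coeff p 1) * xi + of_rat (coeff p 2) * xi\<^sup>2)"
    unfolding of_int_mult r by (simp add: algebra_simps)
  then have "of_int (n0 * d1 * d2) + of_int (n1 * d0 * d2) * xi + of_int (n2 * d0 * d1) * xi\<^sup>2 = 0"
    unfolding e by simp
  from xi_no_quadratic[OF this] have "n2 * d0 * d1 = 0" by blast
  then have "n2 = 0" using 0(2) 1(2) by auto
  then show False using nz 2(1) by simp
qed

end

section \<open>Good approximations belong to the sequence\<close>

text \<open>
  The arithmetical core of \<open>rigidity\<close>: the form $f^2 + R f g + g^2$ takes the value 4 infinitely
  often, but within the range given by the two linear inequalities only on the axes.
\<close>
lemma binary_form_axis:
  fixes f g R :: int
  assumes R: "10 \<le> R" and form: "f\<^sup>2 + g\<^sup>2 + f * g * R = 4"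
    and P: "0 < 2 * f + g * R" "2 * f + g * R \<le> 2 * R + 4"
    and Q: "0 < f * R + 2 * g" "f * R + 2 * g \<le> 2 * R + 4"
  shows "f = 0 \<or> g = 0"
proof -
  have opp: False
    if fg: "0 < f" "g < 0" and P: "0 < 2 * f + g * R" and Q: "f * R + 2 * g \<le> 2 * R + 4" for f g :: int
  proof -
    have "1 * R \<le> (- g) * R" using fg R by (intro mult_right_mono) simp_all
    then have "5 < f" using P R by simp
    have "(f * R) * R \<le> (2 * R + 4 - 2 * g) * R" using Q R by (intro mult_right_mono) simp_all
    then have "f * (R * R) \<le> 2 * (R * R) + 4 * R + 2 * (- g * R)" by (simp add: algebra_simps)
    then have "f * (R * R - 4) \<le> 2 * (R * R) + 4 * R" using P by (simp add: algebra_simps)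
    moreover have RR: "10 * R \<le> R * R" using R by (intro mult_right_mono) simp_all
    moreover have "0 \<le> R * R - 4" using RR R by linarith
    then have "6 * (R * R - 4) \<le> f * (R * R - 4)"
      using \<open>5 < f\<close> by (intro mult_right_mono) simp_all
    ultimately have "6 * (R * R - 4) \<le> 2 * (R * R) + 4 * R" by (meson order_trans)
    then show False using R RR by simp
  qed
  have "\<not> 0 < f * g"
  proof
    assume "0 < f * g"
    then have "10 \<le> f * g * R" using R mult_mono[of 1 "f * g" 10 R] by simp
    then show False using form zero_le_power2[of f] zero_le_power2[of g] by linarith
  qed
  then consider "f = 0 \<or> g = 0" | "0 < f" "g < 0" | "0 < g" "f < 0"
    by (metis linorder_neqE_linordered_idom mult_pos_pos mult_neg_neg)
  then show ?thesis
  proof cases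
    case 1 then show ?thesis .
  next
    case 2 then show ?thesis using opp[of f g] P Q by blast
  next
    case 3 then show ?thesis using opp[of g f] P Q by (simp add: algebra_simps)
  qed
qed

text \<open>
  In the application \<open>u\<close> and \<open>v\<close> are upper left entries and \<open>B\<close> is the polar form, so that
  \<open>polar_mult\<close> provides the last assumption.
\<close>
lemma polar_estimate:
  fixes u v lu lv H B :: real
  assumes uv: "0 < u" "u \<le> v" and H: "0 \<le> H" and l: "\<bar>lu\<bar> \<le> H / u" "\<bar>lv\<bar> \<le> H / v"
    and B: "B * u * v = u\<^sup>2 + v\<^sup>2 + (u * lv - v * lu)\<^sup>2"
  shows "0 < B" "B \<le> v / u + 1 + 4 * H\<^sup>2 * v / u ^ 3"
proof -
  have v: "0 < v" using uv by simp
  have "\<bar>u * lv - v * lu\<bar> \<le> u * \<bar>lv\<bar> + v * \<bar>lu\<bar>"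
    using abs_triangle_ineq4[of "u * lv" "v * lu"] uv v by (simp add: abs_mult)
  also have "\<dots> \<le> u * (H / v) + v * (H / u)"
    using l uv v by (intro add_mono mult_left_mono) simp_all
  also have "\<dots> \<le> v * (H / u) + v * (H / u)"
  proof -
    have "u * (H / v) \<le> v * (H / u)" using uv v H
      by (intro mult_mono divide_left_mono) simp_all
    then show ?thesis by (rule add_right_mono)
  qed
  finally have "\<bar>u * lv - v * lu\<bar> \<le> 2 * H * v / u" by simp
  then have "\<bar>u * lv - v * lu\<bar>\<^sup>2 \<le> (2 * H * v / u)\<^sup>2" by (rule power_mono) simp
  then have d: "(u * lv - v * lu)\<^sup>2 \<le> 4 * H\<^sup>2 * v\<^sup>2 / u\<^sup>2"
    by (simp add: power_divide power_mult_distrib)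
  have Beq: "B = u / v + v / u + (u * lv - v * lu)\<^sup>2 / (u * v)"
  proof -
    have "B = (B * u * v) / (u * v)" using uv v by simp
    also have "\<dots> = u / v + v / u + (u * lv - v * lu)\<^sup>2 / (u * v)"
      unfolding B using uv v by (simp add: add_divide_distrib power2_eq_square)
    finally show ?thesis .
  qed
  then show "0 < B" using uv v by (simp add: add_pos_nonneg)
  have "(u * lv - v * lu)\<^sup>2 / (u * v) \<le> (4 * H\<^sup>2 * v\<^sup>2 / u\<^sup>2) / (u * v)"
    using d uv v by (intro divide_right_mono) simp_all
  also have "\<dots> = 4 * H\<^sup>2 * v / u ^ 3"
    using uv v by (simp add: field_simps power2_eq_square power3_eq_cube)
  finally show "B \<le> v / u + 1 + 4 * H\<^sup>2 * v / u ^ 3"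
    unfolding Beq using uv v by (simp add: add_mono)
qed

lemma minor_estimate:
  fixes l w l' w' H u v :: real
  assumes "0 < u" "0 < v" "\<bar>l\<bar> \<le> H / u" "\<bar>w\<bar> \<le> H / u" "\<bar>l'\<bar> \<le> H / v" "\<bar>w'\<bar> \<le> H / v"
  shows "\<bar>l * w' - l' * w\<bar> \<le> 2 * H\<^sup>2 / (u * v)"
proof -
  have "\<bar>l * w' - l' * w\<bar> \<le> \<bar>l\<bar> * \<bar>w'\<bar> + \<bar>l'\<bar> * \<bar>w\<bar>"
    using abs_triangle_ineq4[of "l * w'" "l' * w"] by (simp add: abs_mult)
  also have "\<dots> \<le> (H / u) * (H / v) + (H / v) * (H / u)"
    using assms by (intro add_mono mult_mono) (auto intro: order_trans[OF abs_ge_zero])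
  also have "\<dots> = 2 * H\<^sup>2 / (u * v)"
    by (simp add: power2_eq_square mult.commute)
  finally show ?thesis .
qed

text \<open>
  The columns of the determinant may be replaced by $a$, $a x - b$ and $c - 2 b x + a x^2$, of which the
  last two are small when $x$ is the number approximated.
\<close>
lemma det3_real:
  fixes x :: real
  defines "l \<equiv> \<lambda>a b. of_int a * x - of_int b"
    and "w \<equiv> \<lambda>a b c. of_int c - 2 * of_int b * x + of_int a * x\<^sup>2"
  shows "real_of_int (det3 (a, b, c) (a', b', c') (a'', b'', c'')) =
    of_int a * (l a'' b'' * w a' b' c' - l a' b' * w a'' b'' c'')
      - of_int a' * (l a'' b'' * w a b c - l a b * w a'' b'' c'')
      + of_int a'' * (l a' b' * w a b c - l a b * w a' b' c')"
  unfolding l_def w_def det3_def by (simp add: algebra_simps power2_eq_square)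

context markoff_seq
begin

lemma polar_self: "polar (pt i) (pt i) = 2"
  using det1[of i] by (simp add: polar_def power2_eq_square)

lemma point_estimate:
  fixes p q r :: int
  assumes p: "0 < p" and det: "p * r - q\<^sup>2 = 1" and C: "0 \<le> C"
    and l: "\<bar>of_int p * xi - of_int q\<bar> \<le> C / of_int p"
    and H: "1 + C\<^sup>2 \<le> H"
  shows "\<bar>of_int r - 2 * of_int q * xi + of_int p * xi\<^sup>2\<bar> \<le> H / of_int p"
proof -
  define L where "L = of_int p * xi - of_int q"
  define W where "W = of_int r - 2 * of_int q * xi + of_int p * xi\<^sup>2"
  have P: "1 \<le> real_of_int p" using p by linarith
  have "C / of_int p \<le> C" using P C by (simp add: divide_le_eq mult_le_cancel_left1)
  then have "\<bar>L\<bar> \<le> C" using l unfolding L_def by linarith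
  then have "L\<^sup>2 \<le> C\<^sup>2" using C abs_le_square_iff[of L C] by simp
  moreover have "real_of_int (p * r - q\<^sup>2) = 1" by (simp only: det of_int_1)
  then have PW: "of_int p * W = 1 + L\<^sup>2"
    by (simp add: L_def W_def power2_eq_square algebra_simps)
  ultimately have "of_int p * W \<le> H" "0 \<le> of_int p * W" using H by simp_all
  then show ?thesis using P unfolding W_def[symmetric]
    by (simp add: zero_le_mult_iff field_simps)
qed

text \<open>
  Every symmetric integral matrix of determinant 1 with large positive upper left entry $p$ and
  $|p \xi - q| \le C / p$ is a term of the sequence.
\<close>
lemma rigidity:
  assumes C: "0 \<le> C"
  shows "\<exists>P0 :: real. \<forall>p q r. 0 < p \<longrightarrow> p * r - q\<^sup>2 = 1 \<longrightarrow>
    \<bar>of_int p * xi - of_int q\<bar> \<le> C / of_int p \<longrightarrow> P0 \<le> of_int p \<longrightarrow> (\<exists>i. (p, q, r) = pt i)"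
proof -
  define H where "H = 2 + C + C\<^sup>2"
  have H: "2 \<le> H" "C \<le> H" "1 + C\<^sup>2 \<le> H" using C by (simp_all add: H_def)
  obtain I where I: "\<And>i. I \<le> i \<Longrightarrow> 8 * H\<^sup>2 + 4 < real_of_int (a i)"
    using eventually_a_gt[of "8 * H\<^sup>2 + 4"] by (auto simp: eventually_sequentially)
  have "\<exists>i. (p, q, r) = pt i"
    if p: "0 < p" and det: "p * r - q\<^sup>2 = 1"
      and l: "\<bar>of_int p * xi - of_int q\<bar> \<le> C / of_int p" and large: "of_int (a (I + 2)) \<le> real_of_int p"
    for p q r
  proof -
    have "p < a (nat p)" using a_ge[of "nat p"] p by simp
    then have ex: "\<exists>j. p < a j" by blast
    define j where "j = (LEAST j. p < a j)"
    have j: "p < a j" unfolding j_def using ex by (rule LeastI_ex)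
    have jl: "a i \<le> p" if "i < j" for i using not_less_Least[OF that[unfolded j_def]] by simp
    have "a (I + 2) < a j" using j large by simp
    then have "I + 2 < j" using strict_mono_a by (simp add: strict_mono_less)
    then obtain m where m: "j = Suc (Suc (Suc m))" "I \<le> m"
      by (intro that[of "j - 3"]) auto
    define n0 n1 n2 where n: "n0 = Suc m" "n1 = Suc n0" "n2 = Suc n1"
    define s A0 A1 A2 P where "s = real_of_int (a m)" and A: "A0 = real_of_int (a n0)"
      "A1 = real_of_int (a n1)" "A2 = real_of_int (a n2)" "P = real_of_int p"
    have s: "8 * H\<^sup>2 + 4 < s" using I m by (simp add: s_def)
    have H2: "0 \<le> H\<^sup>2" by simp
    have A1P: "A1 \<le> P" and PA2: "P < A2" and A0: "1 \<le> A0"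
      using jl[of n1] j m a_pos[of n0] by (simp_all add: A n)
    have up: "A2 \<le> 3 * A0 * A1"
    proof -
      have "a n2 \<le> 3 * a n0 * a n1" using a_upper[of n0] by (simp add: n mult_ac)
      then show ?thesis unfolding A by (metis of_int_le_iff of_int_mult of_int_numeral)
    qed
    have lo: "2 * A0 * s \<le> A1"
    proof -
      have "2 * a n0 * a m \<le> a n1" using a_lower[of m] by (simp add: n)
      then show ?thesis unfolding A s_def by (metis of_int_le_iff of_int_mult of_int_numeral)
    qed
    have "1 * s \<le> A0 * s" using A0 s H2 by (intro mult_right_mono) linarith+
    then have sA1: "2 * s \<le> A1" using lo by simp
    have pos: "0 < s" "0 < A1" "0 < A2" "0 < P" using s H2 sA1 A1P PA2 by linarith+
    define R where "R = 3 * a n0"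
    have R: "10 \<le> R"
    proof -
      have "4 < a m" using s H2 unfolding s_def by linarith
      then show ?thesis using a_grow[of m] unfolding R_def n by linarith
    qed
    have polR: "polar (pt n1) (pt n2) = R" unfolding n R_def by (rule polar_Suc_Suc)
    have A21: "A2 / A1 \<le> of_int R" using up pos by (simp add: R_def A field_simps)
    have cube: "4 * H\<^sup>2 * A2 \<le> A1 ^ 3"
    proof -
      have "4 * H\<^sup>2 * A2 \<le> (s / 2) * (3 * A0 * A1)"
        using s up pos A0 by (intro mult_mono) simp_all
      also have "\<dots> = 3 / 4 * A1 * (2 * A0 * s)" by simp
      also have "\<dots> \<le> 3 / 4 * A1 * A1" using lo pos by (intro mult_left_mono) simp_all
      also have "\<dots> \<le> A1 * A1 * A1"
      proof -
        have "3 / 4 * (A1 * A1) \<le> A1 * (A1 * A1)"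
          by (rule mult_right_mono) (use sA1 s H2 in linarith, simp)
        then show ?thesis by (simp add: mult_ac)
      qed
      finally show ?thesis by (simp add: power3_eq_cube)
    qed
    let ?l = "\<lambda>a b. of_int a * xi - of_int b"
    let ?w = "\<lambda>a b c. of_int c - 2 * of_int b * xi + of_int a * xi\<^sup>2"
    have lw: "\<bar>?l (a i) (b i)\<bar> \<le> H / of_int (a i)" "\<bar>?w (a i) (b i) (c i)\<bar> \<le> H / of_int (a i)" for i
    proof -
      have ai: "0 < real_of_int (a i)" using a_pos by simp
      then have "1 / of_int (a i) \<le> H / of_int (a i)" "2 / of_int (a i) \<le> H / of_int (a i)"
        using H by (simp_all add: divide_right_mono)
      then show "\<bar>?l (a i) (b i)\<bar> \<le> H / of_int (a i)" "\<bar>?w (a i) (b i) (c i)\<bar> \<le> H / of_int (a i)"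
        using ell_bound[of i] omega_bounds[of i] unfolding ell_def omega_def by linarith+
    qed
    note lw1 = lw[of n1, folded A] and lw2 = lw[of n2, folded A]
    have "C / P \<le> H / P" using H pos by (simp add: divide_right_mono)
    then have ly: "\<bar>?l p q\<bar> \<le> H / P" using l unfolding A by linarith
    have wy: "\<bar>?w p q r\<bar> \<le> H / P" unfolding A
      by (rule point_estimate[OF p det C l H(3)])

    \<comment> \<open>The matrix lies in the plane spanned by the terms \<open>n1\<close> and \<open>n2\<close> that enclose it in size.\<close>
    define E where "E = det3 (p, q, r) (pt n1) (pt n2)"
    have "E = 0"
    proof -
      have "\<bar>real_of_int E\<bar> \<le> P * (2 * H\<^sup>2 / (A2 * A1)) + A1 * (2 * H\<^sup>2 / (A2 * P)) + A2 * (2 * H\<^sup>2 / (A1 * P))"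
      proof -
        have tri: "\<bar>u * x - v * y + w * z\<bar> \<le> u * \<bar>x\<bar> + v * \<bar>y\<bar> + w * \<bar>z\<bar>"
          if "0 < u" "0 < v" "0 < w" for u v w x y z :: real
        proof -
          have "\<bar>u * x - v * y + w * z\<bar> \<le> \<bar>u * x\<bar> + \<bar>v * y\<bar> + \<bar>w * z\<bar>" by linarith
          then show ?thesis using that by (simp add: abs_mult)
        qed
        show ?thesis
          unfolding E_def det3_real[where x = xi] A[symmetric]
          by (rule order_trans[OF tri[OF pos(4,2,3)]], intro add_mono mult_left_mono minor_estimate)
            (use lw1 lw2 ly[folded A] wy[folded A] pos in simp_all)
      qed
      also have "\<dots> \<le> 2 * H\<^sup>2 * (1 / s) + 2 * H\<^sup>2 * (1 / s) + 2 * H\<^sup>2 * (3 / 2 / s)"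
      proof -
        have "P / (A2 * A1) \<le> 1 / s"
        proof -
          have "P * s \<le> A2 * A1" using PA2 sA1 pos by (intro mult_mono) simp_all
          then show ?thesis using pos by (simp add: field_simps)
        qed
        moreover have "A1 / (A2 * P) \<le> 1 / s"
        proof -
          have "A1 * s \<le> A2 * P" using PA2 sA1 pos A1P by (intro mult_mono) simp_all
          then show ?thesis using pos by (simp add: field_simps)
        qed
        moreover have "A2 / (A1 * P) \<le> 3 / 2 / s"
        proof -
          have "A2 * (2 * s) \<le> (3 * A0 * A1) * (2 * s)" using up pos by (intro mult_right_mono) simp_all
          also have "\<dots> = 3 * A1 * (2 * A0 * s)" by simp
          also have "\<dots> \<le> 3 * A1 * P" using lo A1P pos by (intro mult_left_mono) simp_all
          finally show ?thesis using pos by (simp add: field_simps)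
        qed
        ultimately have "2 * H\<^sup>2 * (P / (A2 * A1)) + 2 * H\<^sup>2 * (A1 / (A2 * P)) + 2 * H\<^sup>2 * (A2 / (A1 * P))
          \<le> 2 * H\<^sup>2 * (1 / s) + 2 * H\<^sup>2 * (1 / s) + 2 * H\<^sup>2 * (3 / 2 / s)"
          by (intro add_mono mult_left_mono) simp_all
        then show ?thesis by (simp add: mult_ac)
      qed
      also have "\<dots> = 7 * H\<^sup>2 / s" by (simp add: field_simps)
      also have "\<dots> < 1" using s H2 pos by (simp add: field_simps)
      finally show "E = 0" by linarith
    qed

    define B1 B2 where B: "B1 = polar (pt n1) (p, q, r)" "B2 = polar (p, q, r) (pt n2)"
    have "B1 * a n1 * p = (a n1)\<^sup>2 + p\<^sup>2 + (p * b n1 - q * a n1)\<^sup>2"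
      unfolding B by (rule polar_mult[OF det1 det])
    then have "of_int B1 * A1 * P = A1\<^sup>2 + P\<^sup>2 + (A1 * (P * xi - of_int q) - P * (A1 * xi - of_int (b n1)))\<^sup>2"
      unfolding A by (auto simp: algebra_simps power2_eq_square dest!: arg_cong[of _ _ real_of_int])
    note B1 = polar_estimate[OF pos(2) A1P _ lw1(1) ly[folded A] this]
    have "B2 * p * a n2 = p\<^sup>2 + (a n2)\<^sup>2 + (a n2 * q - b n2 * p)\<^sup>2"
      unfolding B by (rule polar_mult[OF det det1])
    then have "of_int B2 * P * A2 = P\<^sup>2 + A2\<^sup>2 + (P * (A2 * xi - of_int (b n2)) - A2 * (P * xi - of_int q))\<^sup>2"
      unfolding A by (auto simp: algebra_simps power2_eq_square dest!: arg_cong[of _ _ real_of_int])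
    note B2 = polar_estimate[OF pos(4) less_imp_le[OF PA2] _ ly[folded A] lw2(1) this]
    have "of_int B1 \<le> real_of_int R + 2"
    proof -
      have "P / A1 \<le> A2 / A1" using PA2 pos by (simp add: divide_right_mono)
      moreover have "4 * H\<^sup>2 * P / A1 ^ 3 \<le> 1"
      proof -
        have "4 * H\<^sup>2 * P \<le> 4 * H\<^sup>2 * A2" using PA2 by (intro mult_left_mono) simp_all
        then show ?thesis using cube pos by (simp add: divide_le_eq)
      qed
      ultimately show ?thesis using B1(2) A21 H by linarith
    qed
    then have B1u: "B1 \<le> R + 2" by linarith
    have "of_int B2 \<le> real_of_int R + 2"
    proof -
      have "A2 / P \<le> A2 / A1" using A1P pos by (simp add: divide_left_mono)
      moreover have "4 * H\<^sup>2 * A2 / P ^ 3 \<le> 1"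
      proof -
        have "A1 ^ 3 \<le> P ^ 3" using A1P pos by (intro power_mono) simp_all
        then have "4 * H\<^sup>2 * A2 \<le> P ^ 3" using cube by (rule order_trans[rotated])
        then show ?thesis using pos by (simp add: divide_le_eq)
      qed
      ultimately show ?thesis using B2(2) A21 H by linarith
    qed
    then have B2u: "B2 \<le> R + 2" by linarith
    have Bpos: "0 < B1" "0 < B2" using B1(1) B2(1) H by simp_all

    \<comment> \<open>By Cramer's rule the coefficients in that plane have denominator at most 2.\<close>
    obtain f g where fg: "2 * p = f * a n1 + g * a n2" "2 * q = f * b n1 + g * b n2"
      "2 * r = f * c n1 + g * c n2"
    proof -
      define D where "D = det3 (pt n0) (pt n1) (pt n2)"
      have "D\<^sup>2 = 4" unfolding D_def n by (rule det3_sq)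
      then have D: "D = 2 \<or> D = -2" using square_eq_iff[of D 2] by (simp add: power2_eq_square)
      define F G where "F = det3 (pt n0) (p, q, r) (pt n2)" and "G = det3 (pt n0) (pt n1) (p, q, r)"
      have "D * p = F * a n1 + G * a n2" "D * q = F * b n1 + G * b n2" "D * r = F * c n1 + G * c n2"
        using cramer3[of "pt n0" "pt n1" "pt n2" "(p, q, r)"] \<open>E = 0\<close>
        unfolding D_def F_def G_def E_def by simp_all
      then show thesis using D that[of F G] that[of "- F" "- G"] by auto
    qed
    have "4 * (p * r - q\<^sup>2) = (2 * p) * (2 * r) - (2 * q)\<^sup>2" by (simp add: power2_eq_square algebra_simps)
    also have "\<dots> = f\<^sup>2 * (a n1 * c n1 - (b n1)\<^sup>2) + g\<^sup>2 * (a n2 * c n2 - (b n2)\<^sup>2) + f * g * polar (pt n1) (pt n2)"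
      unfolding fg polar_def by (simp add: power2_eq_square algebra_simps)
    finally have form: "f\<^sup>2 + g\<^sup>2 + f * g * R = 4" using det by (simp add: det1 polR)
    have "2 * B1 = a n1 * (2 * r) + c n1 * (2 * p) - 2 * b n1 * (2 * q)"
      unfolding B polar_def by simp
    also have "\<dots> = f * polar (pt n1) (pt n1) + g * polar (pt n1) (pt n2)"
      unfolding fg polar_def by (simp add: algebra_simps)
    finally have 1: "2 * B1 = 2 * f + g * R" by (simp add: polR polar_self)
    have "2 * B2 = (2 * p) * c n2 + (2 * r) * a n2 - 2 * (2 * q) * b n2"
      unfolding B polar_def by simp
    also have "\<dots> = f * polar (pt n1) (pt n2) + g * polar (pt n2) (pt n2)"
      unfolding fg polar_def by (simp add: algebra_simps)
    finally have 2: "2 * B2 = f * R + 2 * g" by (simp add: polR polar_self)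
    have "f = 0 \<or> g = 0"
      by (rule binary_form_axis[OF R form]) (use 1 2 B1u B2u Bpos in linarith)+
    then show ?thesis
    proof
      assume "f = 0"
      then have "0 < g * a n2" "g\<^sup>2 = 2\<^sup>2" using fg(1) p form by simp_all
      then have "g = 2" using a_pos[of n2] power2_eq_imp_eq[of g 2] by (simp add: zero_less_mult_iff)
      then show ?thesis using fg \<open>f = 0\<close> by (intro exI[of _ n2]) simp
    next
      assume "g = 0"
      then have "0 < f * a n1" "f\<^sup>2 = 2\<^sup>2" using fg(1) p form by simp_all
      then have "f = 2" using a_pos[of n1] power2_eq_imp_eq[of f 2] by (simp add: zero_less_mult_iff)
      then show ?thesis using fg \<open>g = 0\<close> by (intro exI[of _ n1]) simp
    qed
  qed
  then show ?thesis by blast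
qed

end

section \<open>The sequence corresponds to its limit\<close>

lemma contracting_recurrence_bounded:
  fixes D :: "nat \<Rightarrow> real"
  assumes "0 \<le> k" "k < 1" "0 \<le> t" and step: "\<And>i. \<bar>D (Suc i)\<bar> \<le> k * \<bar>D i\<bar> + t"
  shows "\<bar>D i\<bar> \<le> \<bar>D 0\<bar> + t / (1 - k)"
proof (induction i)
  case 0 then show ?case using assms by simp
next
  case (Suc i)
  have "\<bar>D (Suc i)\<bar> \<le> k * (\<bar>D 0\<bar> + t / (1 - k)) + t"
    using step[of i] Suc mult_left_mono[OF Suc assms(1)] by linarith
  also have "\<dots> = k * \<bar>D 0\<bar> + t / (1 - k)" using assms by (simp add: field_simps)
  also have "\<dots> \<le> \<bar>D 0\<bar> + t / (1 - k)"
    using assms mult_right_mono[of k 1 "\<bar>D 0\<bar>"] by simp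
  finally show ?case .
qed

context markoff_seq
begin

text \<open>
  Since $a_{i+2} / (a_{i+1} a_i)$ lies between 1 and 3 and $\gamma^2 = \gamma + 1$, the quantity
  $D_i = \log a_{i+1} - \gamma \log a_i$ satisfies $D_{i+1} = (1 - \gamma) D_i + O(1)$, where
  $|1 - \gamma| < 1$.
\<close>
lemma a_growth:
  "\<exists>K>0. \<forall>i. real_of_int (a i) powr golden / K \<le> of_int (a (Suc i)) \<and>
     of_int (a (Suc i)) \<le> K * real_of_int (a i) powr golden"
proof -
  define L where "L i = ln (real_of_int (a i))" for i
  define D where "D i = L (Suc i) - golden * L i" for i
  have p: "0 < real_of_int (a i)" for i using a_pos by simp
  have step: "\<bar>D (Suc i)\<bar> \<le> (golden - 1) * \<bar>D i\<bar> + ln 3" for i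
  proof -
    define t where "t = L (Suc (Suc i)) - L (Suc i) - L i"
    have "real_of_int (a (Suc i) * a i) \<le> of_int (a (Suc (Suc i)))"
      using a_lower[of i] a_pos[of i] a_pos[of "Suc i"] mult_pos_pos[of "a (Suc i)" "a i"]
      by (intro of_int_le_iff[THEN iffD2]) linarith
    then have "ln (real_of_int (a (Suc i) * a i)) \<le> L (Suc (Suc i))"
      unfolding L_def using p by (subst ln_le_cancel_iff) simp_all
    then have "0 \<le> t" unfolding t_def L_def using p[of i] p[of "Suc i"] by (simp add: ln_mult)
    have "real_of_int (a (Suc (Suc i))) \<le> of_int (3 * a (Suc i) * a i)"
      using a_upper[of i] by (intro of_int_le_iff[THEN iffD2]) simp
    then have "L (Suc (Suc i)) \<le> ln (real_of_int (3 * a (Suc i) * a i))"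
      unfolding L_def using p by (subst ln_le_cancel_iff) simp_all
    then have "t \<le> ln 3" unfolding t_def L_def using p[of i] p[of "Suc i"] by (simp add: ln_mult)
    have "D (Suc i) = (1 - golden) * D i + t + (1 + golden - golden * golden) * L i"
      by (simp add: D_def t_def algebra_simps)
    then have "D (Suc i) = (1 - golden) * D i + t" by (simp add: golden_sq)
    then have "\<bar>D (Suc i)\<bar> \<le> \<bar>(1 - golden) * D i\<bar> + \<bar>t\<bar>" by simp
    also have "\<bar>(1 - golden) * D i\<bar> = (golden - 1) * \<bar>D i\<bar>"
      using golden_bounds by (simp add: abs_mult)
    finally show ?thesis using \<open>0 \<le> t\<close> \<open>t \<le> ln 3\<close> by simp
  qed
  define B where "B = \<bar>D 0\<bar> + ln 3 / (1 - (golden - 1))"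
  have B: "\<bar>D i\<bar> \<le> B" for i
    unfolding B_def using golden_bounds step by (intro contracting_recurrence_bounded) simp_all
  have pw: "real_of_int (a i) powr golden = exp (golden * L i)" for i
    using p[of i] by (simp add: powr_def L_def)
  have ex: "of_int (a i) = exp (L i)" for i using p[of i] by (simp add: L_def)
  have "exp (golden * L i) / exp B \<le> exp (L (Suc i)) \<and> exp (L (Suc i)) \<le> exp B * exp (golden * L i)" for i
    using B[of i] unfolding D_def by (simp flip: exp_diff exp_add) linarith
  then show ?thesis unfolding pw ex[symmetric]
    by (intro exI[of _ "exp B"]) (simp add: ex pw)
qed

definition seq_mat :: "nat \<Rightarrow> int^2^2" where "seq_mat i = mat2 (a i) (b i) (b i) (c i)"

text \<open>A bound for the norm of $x_i$ relative to its upper left entry.\<close>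
definition kappa :: real where "kappa = (\<bar>xi\<bar> + 2)\<^sup>2"

lemma kappa_ge: "1 \<le> kappa"
proof -
  have "1\<^sup>2 \<le> (\<bar>xi\<bar> + 2)\<^sup>2" by (rule power_mono) simp_all
  then show ?thesis by (simp add: kappa_def)
qed

lemma norm_ge: "of_int (a i) \<le> infnorm (real_mat (seq_mat i))"
  using infnorm_matrix_ge[of "real_mat (seq_mat i)" 1 1] a_pos[of i] by (simp add: real_mat_nth seq_mat_def)

lemma norm_b_ge: "\<bar>of_int (b i)\<bar> \<le> infnorm (real_mat (seq_mat i))"
  using infnorm_matrix_ge[of "real_mat (seq_mat i)" 1 2] by (simp add: real_mat_nth seq_mat_def)

lemma norm_pos: "0 < infnorm (real_mat (seq_mat i))"
  using norm_ge[of i] a_pos[of i] by (smt (verit) of_int_pos)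

lemma norm_le: "infnorm (real_mat (seq_mat i)) \<le> kappa * of_int (a i)"
proof -
  define A where "A = real_of_int (a i)"
  have A: "1 \<le> A" using a_pos[of i] unfolding A_def by linarith
  then have "1 / A \<le> 1" "2 / A \<le> 2" by (simp_all add: divide_le_eq)
  then have e: "\<bar>ell i\<bar> \<le> 1" "0 \<le> omega i" "omega i \<le> 2"
    using ell_bound[of i] omega_bounds[of i] unfolding A_def by linarith+
  have kappa: "kappa * A = A * xi\<^sup>2 + A * (4 * \<bar>xi\<bar>) + A * 4"
    by (simp add: kappa_def power2_eq_square algebra_simps)
  have nn: "0 \<le> A * xi\<^sup>2" "1 * (4 * \<bar>xi\<bar>) \<le> A * (4 * \<bar>xi\<bar>)"
    using A by (simp, intro mult_right_mono, simp_all)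
  have "\<bar>A * xi\<bar> = A * \<bar>xi\<bar>" using A by (simp add: abs_mult)
  then have 2: "\<bar>of_int (b i)\<bar> \<le> kappa * A" unfolding b_eq A_def[symmetric] kappa using nn e A by linarith
  have "\<bar>ell i * xi\<bar> \<le> 1 * \<bar>xi\<bar>" unfolding abs_mult using e by (intro mult_right_mono) simp_all
  then have 3: "\<bar>of_int (c i)\<bar> \<le> kappa * A" unfolding c_eq A_def[symmetric] kappa using nn e A by linarith
  have 1: "\<bar>of_int (a i)\<bar> \<le> kappa * A" unfolding A_def[symmetric] kappa using nn A by simp
  have "\<forall>j k. \<bar>real_mat (seq_mat i) $ j $ k\<bar> \<le> kappa * A"
    using 1 2 3 by (simp add: forall_2 real_mat_nth seq_mat_def)
  then show ?thesis unfolding A_def by (intro infnorm_matrix_le) blast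
qed

lemma norm_growth:
  "asymp_eq (\<lambda>i. infnorm (real_mat (seq_mat (i + 1)))) (\<lambda>i. infnorm (real_mat (seq_mat i)) powr golden)"
proof -
  obtain B where B: "0 < B" and lo: "\<And>i. real_of_int (a i) powr golden / B \<le> of_int (a (Suc i))"
    and up: "\<And>i. of_int (a (Suc i)) \<le> B * real_of_int (a i) powr golden"
    using a_growth by blast
  let ?N = "\<lambda>i. infnorm (real_mat (seq_mat i))"
  have p: "0 < real_of_int (a i)" for i using a_pos by simp
  have kappa: "0 < kappa" using kappa_ge by simp
  have 1: "1 / (B * kappa powr golden) * ?N i powr golden \<le> ?N (i + 1)" for i
  proof -
    have "?N i powr golden \<le> (kappa * of_int (a i)) powr golden"
      using norm_le[of i] norm_pos[of i] golden_bounds by (intro powr_mono2) simp_all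
    also have "\<dots> = kappa powr golden * of_int (a i) powr golden"
      using p[of i] kappa by (simp add: powr_mult)
    also have "\<dots> \<le> kappa powr golden * (B * of_int (a (Suc i)))"
      using lo[of i] B by (intro mult_left_mono) (simp_all add: field_simps)
    also have "\<dots> \<le> kappa powr golden * (B * ?N (i + 1))"
      using norm_ge[of "i + 1"] B by (intro mult_left_mono) simp_all
    finally show ?thesis using B kappa by (simp add: field_simps)
  qed
  have 2: "?N (i + 1) \<le> kappa * B * ?N i powr golden" for i
  proof -
    have "?N (i + 1) \<le> kappa * of_int (a (Suc i))" using norm_le[of "i + 1"] by simp
    also have "\<dots> \<le> kappa * (B * of_int (a i) powr golden)"
      using up[of i] kappa by (intro mult_left_mono) simp_all
    also have "\<dots> \<le> kappa * (B * ?N i powr golden)"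
      using kappa B p[of i] norm_ge[of i] golden_bounds by (intro mult_left_mono powr_mono2) simp_all
    finally show ?thesis by simp
  qed
  show ?thesis unfolding asymp_eq_def
    by (rule exI[of _ "1 / (B * kappa powr golden)"], rule conjI, use B kappa in simp,
        rule exI[of _ "kappa * B"]) (use 1 2 B kappa in simp)
qed

lemma second_ell: "of_int (b i) * xi - of_int (c i) = ell i * xi - omega i"
  by (simp add: ell_def omega_def power2_eq_square algebra_simps)

lemma norm_approx:
  "asymp_eq (\<lambda>i. infnorm (vector [xi, -1] v* real_mat (seq_mat i)))
     (\<lambda>i. inverse (infnorm (real_mat (seq_mat i))))"
proof -
  let ?N = "\<lambda>i. infnorm (real_mat (seq_mat i))" and ?V = "\<lambda>i. infnorm (vector [xi, -1] v* real_mat (seq_mat i))"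
  have v1: "(vector [xi, -1] v* real_mat (seq_mat i)) $ 1 = ell i" for i
    unfolding seq_mat_def vector_mult_mat2_nth ell_def ..
  have v2: "(vector [xi, -1] v* real_mat (seq_mat i)) $ 2 = ell i * xi - omega i" for i
    unfolding seq_mat_def vector_mult_mat2_nth second_ell ..
  have p: "0 < real_of_int (a i)" for i using a_pos by simp
  have 1: "1 / 2 * inverse (?N i) \<le> ?V i" for i
  proof -
    have l: "\<bar>ell i\<bar> \<le> ?V i" using component_le_infnorm_cart[of "vector [xi, -1] v* real_mat (seq_mat i)" 1] v1 by simp
    have l2: "\<bar>ell i * xi - omega i\<bar> \<le> ?V i" using component_le_infnorm_cart[of "vector [xi, -1] v* real_mat (seq_mat i)" 2] v2 by simp
    \<comment> \<open>The lower bound comes from the determinant, which is an integral combination of both entries.\<close>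
    have "of_int (b i) * ell i - of_int (a i) * (ell i * xi - omega i) = of_int (a i * c i - (b i)\<^sup>2)"
      by (simp add: ell_def omega_def power2_eq_square algebra_simps)
    then have "of_int (b i) * ell i - of_int (a i) * (ell i * xi - omega i) = 1"
      by (simp only: det1 of_int_1)
    then have "1 \<le> \<bar>of_int (b i) * ell i\<bar> + \<bar>of_int (a i) * (ell i * xi - omega i)\<bar>" by linarith
    also have "\<dots> \<le> ?N i * ?V i + ?N i * ?V i"
      unfolding abs_mult using l l2 norm_ge[of i] norm_b_ge[of i] p[of i] norm_pos[of i]
      by (intro add_mono mult_mono) simp_all
    finally show ?thesis using norm_pos[of i] by (simp add: field_simps)
  qed
  define C where "C = (\<bar>xi\<bar> + 2) * kappa"
  have C: "0 < C" using kappa_ge by (simp add: C_def)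
  have 2: "?V i \<le> C * inverse (?N i)" for i
  proof -
    define A where "A = real_of_int (a i)"
    have A: "0 < A" using p by (simp add: A_def)
    have l: "\<bar>ell i\<bar> \<le> (\<bar>xi\<bar> + 2) / A"
      using ell_bound[of i] A unfolding A_def[symmetric] by (simp add: field_simps)
    have "\<bar>ell i * xi - omega i\<bar> \<le> \<bar>ell i\<bar> * \<bar>xi\<bar> + \<bar>omega i\<bar>"
      using abs_triangle_ineq4[of "ell i * xi" "omega i"] by (simp add: abs_mult)
    also have "\<dots> \<le> 1 / A * \<bar>xi\<bar> + 2 / A"
      unfolding A_def using ell_bound[of i] omega_bounds[of i] by (intro add_mono mult_right_mono) simp_all
    finally have l2: "\<bar>ell i * xi - omega i\<bar> \<le> (\<bar>xi\<bar> + 2) / A" by (simp add: add_divide_distrib)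
    have "\<forall>j. \<bar>(vector [xi, -1] v* real_mat (seq_mat i)) $ j\<bar> \<le> (\<bar>xi\<bar> + 2) / A"
      unfolding forall_2 v1 v2 using l l2 by simp
    then have "?V i \<le> (\<bar>xi\<bar> + 2) / A" by (intro infnorm_vector_le) blast
    also have "\<dots> \<le> C * inverse (?N i)"
    proof -
      have "(\<bar>xi\<bar> + 2) * ?N i \<le> (\<bar>xi\<bar> + 2) * (kappa * A)"
        using norm_le[of i] unfolding A_def by (intro mult_left_mono) simp_all
      then show ?thesis using A norm_pos[of i] by (simp add: C_def field_simps)
    qed
    finally show ?thesis .
  qed
  show ?thesis unfolding asymp_eq_def
    by (rule exI[of _ "1 / 2"], rule conjI, simp, rule exI[of _ C]) (use 1 2 C in simp)
qed

lemma xi_extremal: "extremal xi"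
proof -
  obtain B where B: "0 < B" and up: "\<And>i. of_int (a (Suc i)) \<le> B * real_of_int (a i) powr golden"
    using a_growth by blast
  have g: "0 < golden" using golden_bounds by simp
  have p: "1 \<le> real_of_int (a i)" for i using a_pos[of i] by linarith
  define k where "k = 2 * \<bar>xi\<bar> + 2"
  define c1 where "c1 = k * B powr (1 / golden)"
  define c2 where "c2 = (\<bar>xi\<bar> + xi\<^sup>2) * real_of_int (a 0) powr (1 / golden)"
  have k: "1 \<le> k" by (simp add: k_def)
  have c1: "0 < c1" using k B by (simp add: c1_def)
  have c2: "0 \<le> c2" by (simp add: c2_def)
  have "\<exists>x0 x1 x2 :: int. (x0, x1, x2) \<noteq> (0, 0, 0) \<and> \<bar>of_int x0\<bar> \<le> X \<and>
      \<bar>of_int x0 * xi - of_int x1\<bar> \<le> (c1 + c2) * X powr (- 1 / golden) \<and>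
      \<bar>of_int x0 * xi\<^sup>2 - of_int x2\<bar> \<le> (c1 + c2) * X powr (- 1 / golden)" if X: "1 \<le> X" for X :: real
  proof (cases "X < of_int (a 0)")
    case True
    \<comment> \<open>The point \<open>(1, 0, 0)\<close> serves for \<open>X\<close> below all the upper left entries; this fixes \<open>c2\<close>.\<close>
    have "real_of_int (a 0) powr (- 1 / golden) \<le> X powr (- 1 / golden)"
      using True X g by (intro powr_mono2') simp_all
    then have "c2 * real_of_int (a 0) powr (- 1 / golden) \<le> c2 * X powr (- 1 / golden)"
      using c2 by (rule mult_left_mono)
    moreover have "c2 * real_of_int (a 0) powr (- 1 / golden) = \<bar>xi\<bar> + xi\<^sup>2"
      using p[of 0] by (simp add: c2_def powr_minus field_simps)
    moreover have "0 \<le> c1 * X powr (- 1 / golden)" using c1 by simp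
    ultimately have "\<bar>xi\<bar> + xi\<^sup>2 \<le> (c1 + c2) * X powr (- 1 / golden)" by (simp add: distrib_right)
    then have "\<bar>xi\<bar> \<le> (c1 + c2) * X powr (- 1 / golden)" "\<bar>xi\<^sup>2\<bar> \<le> (c1 + c2) * X powr (- 1 / golden)"
      by (smt (verit) zero_le_power2)+
    then show ?thesis using X by (intro exI[of _ 1] exI[of _ 0]) simp
  next
    case False
    obtain N where N: "X < real_of_int (a N)"
      using eventually_a_gt[of X] by (auto simp: eventually_sequentially)
    define j where "j = (LEAST j. X < real_of_int (a j))"
    have j: "X < real_of_int (a j)" unfolding j_def using N by (rule LeastI)
    then obtain i where ji: "j = Suc i" using False by (cases j) auto
    have aX: "of_int (a i) \<le> X"
      using not_less_Least[of i "\<lambda>j. X < real_of_int (a j)"] ji unfolding j_def by simp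
    define A where "A = real_of_int (a i)"
    have A: "1 \<le> A" using p by (simp add: A_def)
    have "X \<le> B * A powr golden" using j up[of i] unfolding ji A_def by simp
    then have "X powr (1 / golden) \<le> (B * A powr golden) powr (1 / golden)"
      using X g by (intro powr_mono2) simp_all
    also have "\<dots> = B powr (1 / golden) * A"
      using B A g by (simp add: powr_mult powr_powr)
    finally have "1 / A \<le> B powr (1 / golden) * X powr (- 1 / golden)"
      using A X by (simp add: powr_minus field_simps)
    then have "k * (1 / A) \<le> k * (B powr (1 / golden) * X powr (- 1 / golden))"
      using k by (intro mult_left_mono) simp_all
    then have "k / A \<le> c1 * X powr (- 1 / golden)" by (simp add: c1_def mult.assoc)
    moreover have "0 \<le> c2 * X powr (- 1 / golden)" using c2 by simp
    ultimately have main: "k / A \<le> (c1 + c2) * X powr (- 1 / golden)" by (simp add: distrib_right)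
    have "\<bar>ell i\<bar> \<le> 1 / A" using ell_bound by (simp add: A_def)
    also have "\<dots> \<le> k / A" using k A by (simp add: divide_right_mono)
    finally have 1: "\<bar>of_int (a i) * xi - of_int (b i)\<bar> \<le> k / A" by (simp add: ell_def)
    have "of_int (a i) * xi\<^sup>2 - of_int (c i) = 2 * (ell i * xi) - omega i"
      by (simp add: ell_def omega_def power2_eq_square algebra_simps)
    then have "\<bar>of_int (a i) * xi\<^sup>2 - of_int (c i)\<bar> \<le> 2 * (\<bar>ell i\<bar> * \<bar>xi\<bar>) + \<bar>omega i\<bar>"
      unfolding abs_mult[symmetric] by linarith
    also have "\<dots> \<le> 2 * (1 / A * \<bar>xi\<bar>) + 2 / A"
      unfolding A_def using ell_bound[of i] omega_bounds[of i]
      by (intro add_mono mult_left_mono mult_right_mono) simp_all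
    also have "\<dots> = k / A" by (simp add: k_def add_divide_distrib)
    finally have 2: "\<bar>of_int (a i) * xi\<^sup>2 - of_int (c i)\<bar> \<le> k / A" .
    show ?thesis using a_pos[of i] aX 1 2 main
      by (intro exI[of _ "a i"] exI[of _ "b i"] exI[of _ "c i"]) auto
  qed
  then show ?thesis unfolding extremal_def
    using xi_irrational xi_not_quadratic c1 c2 by (intro conjI exI[of _ "c1 + c2"]) auto
qed

lemma corresponds_xi: "corresponds seq_mat xi"
  unfolding corresponds_def
proof (intro conjI allI)
  show "transpose (seq_mat i) = seq_mat i" "det (seq_mat i) = 1" for i
    using det1[of i] by (simp_all add: seq_mat_def transpose_mat2 det_mat2 power2_eq_square)
  show "\<not> bdd_above (range (\<lambda>i. infnorm (real_mat (seq_mat i))))"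
  proof
    assume "bdd_above (range (\<lambda>i. infnorm (real_mat (seq_mat i))))"
    then obtain M where "\<And>i. infnorm (real_mat (seq_mat i)) \<le> M" by (auto simp: bdd_above_def)
    then have M: "of_int (a i) \<le> M" for i using norm_ge order_trans by blast
    obtain i where "M < of_int (a i)" using eventually_a_gt[of M] by (auto simp: eventually_sequentially)
    then show False using M[of i] by simp
  qed
qed (rule xi_extremal norm_growth norm_approx)+

lemma shift: "markoff_seq (\<lambda>i. a (i + n)) (\<lambda>i. b (i + n)) (\<lambda>i. c (i + n)) (\<lambda>i. e (i + n))"
  by unfold_locales ((unfold add_Suc)?, rule e_sq e_Suc det1 rec_a rec_b rec_b' rec_c a_pos a_grow)+

lemma shift_xi: "markoff_seq.xi (\<lambda>i. a (i + n)) (\<lambda>i. b (i + n)) = xi"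
proof -
  interpret s: markoff_seq "\<lambda>i. a (i + n)" "\<lambda>i. b (i + n)" "\<lambda>i. c (i + n)" "\<lambda>i. e (i + n)"
    by (rule shift)
  have "s.ratio = (\<lambda>i. ratio (i + n))" by (simp add: fun_eq_iff s.ratio_def ratio_def)
  then have "s.ratio \<longlonglongrightarrow> xi" using LIMSEQ_ignore_initial_segment[OF ratio_tendsto] by simp
  then show ?thesis using s.ratio_tendsto LIMSEQ_unique by blast
qed

lemma seq_mat_rec: "seq_mat (i + 2) = seq_mat (i + 1) ** mat2 3 (e i) (- e i) 0 ** seq_mat i"
proof -
  have "b (i + 2) = 3 * a (Suc i) * b i + e i * (a (Suc i) * c i - b (Suc i) * b i)"
     "b (i + 2) = 3 * b (Suc i) * a i + e i * (b (Suc i) * b i - c (Suc i) * a i)"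
    using rec_b[of i] rec_b'[of i] by simp_all
  then show ?thesis
    unfolding seq_mat_def mat2_mult mat2_eq_iff mat2_nth using rec_a[of i] rec_c[of i] by (simp add: algebra_simps)
qed

lemma e_eq_power: "e i = e 0 * (- 1) ^ i"
  by (induction i) (simp_all add: e_Suc)

lemma xi_E3_plus_aux:
  assumes "e 0 = 1"
  shows "xi \<in> E3_plus"
proof -
  have "M_alt (i + 2) = mat2 3 (e i) (- e i) 0" for i
    using assms e_eq_power[of i] by (simp add: M_alt_def)
  then have "\<forall>i. seq_mat (i + 2) = seq_mat (i + 1) ** M_alt (i + 2) ** seq_mat i"
    using seq_mat_rec by simp
  then show ?thesis unfolding E3_plus_def using xi_extremal corresponds_xi by blast
qed

text \<open>
  The matrices \<open>M_alt\<close> prescribe the sign $e_0 = 1$; if $e_0 = -1$, the first term is dropped.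
\<close>
lemma xi_E3_plus: "xi \<in> E3_plus"
proof (cases "e 0 = 1")
  case True
  then show ?thesis by (rule xi_E3_plus_aux)
next
  case False
  interpret s: markoff_seq "\<lambda>i. a (i + 1)" "\<lambda>i. b (i + 1)" "\<lambda>i. c (i + 1)" "\<lambda>i. e (i + 1)"
    by (rule shift)
  have "e (0 + 1) = 1" using False e_cases[of 0] e_Suc[of 0] by simp
  from s.xi_E3_plus_aux[OF this] show ?thesis unfolding shift_xi .
qed

end

section \<open>The extended Markoff tree\<close>

lemma Sigma_star_pos: "m \<in> Sigma_star \<Longrightarrow> 0 < fst m \<and> 0 < fst (snd m) \<and> 0 < snd (snd m)"
  using Sigma_star_cases[of m] by (auto simp: regular_def split: prod.splits)

lemma Sigma_star_less:
  "m \<in> Sigma_star \<Longrightarrow> fst (snd m) < fst m \<and> snd (snd m) < fst m"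
  using Sigma_star_cases[of m] by (auto simp: regular_def split: prod.splits)

lemma child_ge_double:
  assumes "m \<in> Sigma_star" "is_succ s m m'"
  shows "2 * fst m \<le> fst m'"
proof -
  obtain p q r where m: "m = (p, q, r)" by (cases m)
  have pos: "0 < p" "0 < q" "0 < r" "q < p" "r < p"
    using Sigma_star_pos[OF assms(1)] Sigma_star_less[OF assms(1)] by (simp_all add: m)
  have "3 * p * 1 \<le> 3 * p * q" "3 * p * 1 \<le> 3 * p * r"
    using pos by (intro mult_left_mono; simp)+
  then have "2 * p \<le> 3 * p * q - r" "2 * p \<le> 3 * p * r - q" using pos by linarith+
  then show ?thesis using assms(2) pos by (cases s) (simp_all add: is_succ_def m)
qed

lemma child_injective:
  assumes "child s m = child s m'" shows "m = m'"
proof (cases s)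
  case Lft
  then show ?thesis using assms by (cases m; cases m') auto
next
  case Rgt
  then show ?thesis using assms by (cases m; cases m') auto
qed

lemma parent_unique:
  assumes "n \<in> Sigma_star" "n' \<in> Sigma_star" "is_succ s n m" "is_succ s' n' m"
  shows "n = n'"
  using is_succ_side[OF assms] assms child_injective unfolding is_succ_def by metis

lemma coprime_vieta:
  fixes x y k :: int
  assumes "coprime x y" shows "coprime (k * y - x) y"
proof (rule coprimeI)
  fix d assume d: "d dvd k * y - x" "d dvd y"
  then have "d dvd k * y - (k * y - x)" by (meson dvd_diff dvd_mult)
  then show "is_unit d" using d(2) coprime_common_divisor[OF assms] by simp
qed

lemma Sigma_star_coprime:
  "m \<in> Sigma_star \<Longrightarrow> coprime (fst m) (fst (snd m)) \<and> coprime (fst m) (snd (snd m)) \<and>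
     coprime (fst (snd m)) (snd (snd m))"
proof (induction rule: Sigma_star.induct)
  case root
  then show ?case by simp
next
  case (succ m s m')
  obtain p q r where m: "m = (p, q, r)" by (cases m)
  have c: "coprime p q" "coprime p r" "coprime q r" using succ.IH by (simp_all add: m)
  have "coprime (3 * p * q - r) q" "coprime (3 * p * q - r) p"
    "coprime (3 * p * r - q) r" "coprime (3 * p * r - q) p"
    using coprime_vieta[of r q "3 * p"] coprime_vieta[of r p "3 * q"]
      coprime_vieta[of q r "3 * p"] coprime_vieta[of q p "3 * r"] c
    by (simp_all add: coprime_commute mult_ac)
  then show ?case using succ.hyps c
    by (cases s) (simp_all add: is_succ_def m coprime_commute)
qed

text \<open>A node is determined by its unordered triple.\<close>
lemma node_swap:
  "(p, q, r) \<in> Sigma_star \<Longrightarrow> (p, r, q) \<in> Sigma_star \<Longrightarrow> q = r"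
proof (induction "nat p" arbitrary: p q r rule: less_induct)
  case less
  show ?case
  proof (cases "(p, q, r) = (2, 1, 1)")
    case True
    then show ?thesis by simp
  next
    case False
    then have nz: "(p, q, r) \<noteq> (2, 1, 1)" "(p, r, q) \<noteq> (2, 1, 1)" by auto
    obtain n s where n: "n \<in> Sigma_star" "is_succ s n (p, q, r)"
      using Sigma_star.cases[OF less.prems(1)] nz by metis
    obtain n' s' where n': "n' \<in> Sigma_star" "is_succ s' n' (p, r, q)"
      using Sigma_star.cases[OF less.prems(2)] nz by metis
    obtain x y z where x: "n = (x, y, z)" by (cases n)
    obtain x' y' z' where x': "n' = (x', y', z')" by (cases n')
    have ord: "y < x" "z < x" "y' < x'" "z' < x'" "0 < x" 
      using Sigma_star_less[OF n(1)] Sigma_star_less[OF n'(1)] Sigma_star_pos[OF n(1)] x x' by simp_all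
    have sw: "n' = (x, z, y)" and ss: "s' = other s"
      using n(2) n'(2) ord unfolding x x' is_succ_def by (cases s; cases s'; simp)+
    have "x < p" using child_ge_double[OF n] ord x by simp
    then have "y = z" using less.hyps[of x y z] n(1) n'(1) ord unfolding x sw by simp
    then have "n = n'" by (simp add: x sw)
    then show ?thesis
    proof (cases "n = (2, 1, 1)")
      case True
      then show ?thesis using n(2) n'(2) \<open>n = n'\<close> ss by (auto simp: is_succ_def)
    next
      case False
      then have "regular n" using Sigma_star_cases[OF n(1)] by blast
      then show ?thesis using \<open>y = z\<close> by (simp add: x regular_def)
    qed
  qed
qed

text \<open>
  Vieta's involution replaces the largest entry by the other root, which is smaller than the second
  largest entry. The root has no right successor, but its two smaller entries are equal, so that its left
  successor serves in that case.
\<close>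
lemma markoff_descent:
  fixes p q r :: int
  assumes "0 < q" "0 < r" "q < p" "r < p" "p\<^sup>2 + q\<^sup>2 + r\<^sup>2 = 3 * p * q * r"
  shows "(p, q, r) \<in> Sigma_star \<or> (p, r, q) \<in> Sigma_star"
  using assms
proof (induction "nat p" arbitrary: p q r rule: less_induct)
  case less
  have step: "(p, q, r) \<in> Sigma_star \<or> (p, r, q) \<in> Sigma_star"
    if h: "0 < q" "q < r" "r < p" and M: "p\<^sup>2 + q\<^sup>2 + r\<^sup>2 = 3 * p * q * r" for q r
  proof -
    define p' where "p' = 3 * q * r - p"
    have vieta: "p * p' = q\<^sup>2 + r\<^sup>2" using M by (simp add: p'_def power2_eq_square algebra_simps)
    have "0 < p * p'" unfolding vieta using h by (simp add: add_pos_pos)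
    then have p': "0 < p'" using h by (simp add: zero_less_mult_iff)
    have "(r - p) * (r - p') = r\<^sup>2 - r * (3 * q * r) + p * p'"
      by (simp add: p'_def power2_eq_square algebra_simps)
    also have "\<dots> = 2 * r\<^sup>2 + q\<^sup>2 - 3 * (q * r\<^sup>2)" unfolding vieta by (simp add: power2_eq_square algebra_simps)
    also have "\<dots> < 0"
    proof -
      have "q\<^sup>2 < r\<^sup>2" using h by (intro power_strict_mono) simp_all
      moreover have "1 * r\<^sup>2 \<le> q * r\<^sup>2" using h by (intro mult_right_mono) simp_all
      ultimately show ?thesis by linarith
    qed
    finally have p'r: "p' < r" using h by (simp add: mult_less_0_iff)
    have "r\<^sup>2 + q\<^sup>2 + p'\<^sup>2 = 3 * r * q * p'"
      using M by (simp add: p'_def power2_eq_square algebra_simps)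
    then have "(r, q, p') \<in> Sigma_star \<or> (r, p', q) \<in> Sigma_star"
      using less.hyps[of r q p'] h p' p'r by simp
    then show ?thesis
    proof
      assume "(r, q, p') \<in> Sigma_star"
      then have "child Lft (r, q, p') \<in> Sigma_star" by (rule Sigma_star.succ[where s = Lft]) (simp add: is_succ_def)
      then show ?thesis by (simp add: p'_def mult_ac)
    next
      assume n: "(r, p', q) \<in> Sigma_star"
      show ?thesis
      proof (cases "(r, p', q) = (2, 1, 1)")
        case True
        then have "(r, q, p') \<in> Sigma_star" using n by simp
        then have "child Lft (r, q, p') \<in> Sigma_star" by (rule Sigma_star.succ[where s = Lft]) (simp add: is_succ_def)
        then show ?thesis by (simp add: p'_def mult_ac)
      next
        case False
        then have "child Rgt (r, p', q) \<in> Sigma_star" using n Sigma_star.succ by (metis is_succ_def)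
        then show ?thesis by (simp add: p'_def mult_ac)
      qed
    qed
  qed
  consider "q < r" | "r < q" | "q = r" by linarith
  then show ?case
  proof cases
    case 1
    then show ?thesis using step[of q r] less.prems by blast
  next
    case 2
    then show ?thesis using step[of r q] less.prems by (auto simp: algebra_simps)
  next
    case 3
    have M: "p\<^sup>2 + 2 * q\<^sup>2 = 3 * p * q\<^sup>2" using less.prems(5) 3 by (simp add: power2_eq_square)
    have "q\<^sup>2 dvd p\<^sup>2"
    proof
      show "p\<^sup>2 = q\<^sup>2 * (3 * p - 2)" using M by (simp add: algebra_simps)
    qed
    then have "q dvd p" by simp
    then obtain k where k: "p = q * k" by (elim dvdE)
    have "q\<^sup>2 * (k * k + 2) = q\<^sup>2 * (3 * (q * k))" using M unfolding k by (simp add: power2_eq_square algebra_simps)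
    then have kk: "k * k + 2 = 3 * (q * k)" using less.prems by simp
    then have "2 = k * (3 * q - k)" by (simp add: algebra_simps)
    then have "k dvd 2" by (metis dvd_triv_left)
    then have "k \<le> 2" by (rule zdvd_imp_le) simp
    moreover have "1 < k" using less.prems unfolding k by simp
    ultimately have "k = 2" by simp
    then have "p = 2" "q = 1" "r = 1" using kk k 3 by simp_all
    then show ?thesis using Sigma_star.root by simp
  qed
qed

section \<open>Zigzags\<close>

lemma zigzag_in: "zigzag z \<Longrightarrow> z i \<in> Sigma_star"
  by (simp add: zigzag_def)

lemma zigzag_step:
  assumes "zigzag z"
  obtains s where "is_succ s (z i) (z (Suc i))" "is_succ (other s) (z (Suc i)) (z (Suc (Suc i)))"
  using assms unfolding zigzag_def by (metis add_2_eq_Suc' Suc_eq_plus1)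

lemma zigzag_shift: "zigzag z \<Longrightarrow> zigzag (\<lambda>i. z (i + n))"
  unfolding zigzag_def by (metis add.commute add.left_commute)

lemma zigzag_tail_maximal:
  "zigzag z \<Longrightarrow> \<exists>z' p. maximal_zigzag z' \<and> (\<forall>i. z' (i + p) = z i)"
proof (induction "nat (fst (z 0))" arbitrary: z rule: less_induct)
  case less
  show ?case
  proof (cases "maximal_zigzag z")
    case True
    then show ?thesis by (intro exI[of _ z] exI[of _ 0]) simp
  next
    case False
    then obtain n where n: "zigzag (case_nat n z)" using less.prems unfolding maximal_zigzag_def by blast
    have nS: "n \<in> Sigma_star" using zigzag_in[OF n, of 0] by simp
    obtain s where s: "is_succ s n (z 0)" using zigzag_step[OF n, of 0] by auto
    have "fst n < fst (z 0)" "0 < fst n"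
      using child_ge_double[OF nS s] Sigma_star_pos[OF nS] by linarith+
    then obtain z' p where z': "maximal_zigzag z'" "\<And>i. z' (i + p) = case_nat n z i"
      using less.hyps[of "case_nat n z"] n by auto
    have "z' (i + Suc p) = z i" for i using z'(2)[of "Suc i"] by simp
    then show ?thesis using z'(1) by blast
  qed
qed

lemma zigzag_from_maximal:
  assumes "m \<in> Sigma_star"
  shows "maximal_zigzag (zigzag_from m)" "zigzag_from m 0 = m"
  using theI'[OF ex1_maximal_zigzag[OF assms]] by (simp_all add: zigzag_from_def)

lemma zigzag_from_eq: "maximal_zigzag z \<Longrightarrow> zigzag_from (z 0) = z"
  unfolding zigzag_from_def
  by (rule the1_equality[OF ex1_maximal_zigzag]) (auto simp: maximal_zigzag_def zigzag_def)

text \<open>Zigzags with a common tail agree as far back as both go, and a maximal one cannot be extended.\<close>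
lemma maximal_zigzag_unique:
  assumes z: "maximal_zigzag z" and z': "maximal_zigzag z'"
  shows "(\<And>i. z (i + u) = z' (i + v)) \<Longrightarrow> z = z'"
proof (induction u arbitrary: v)
  case 0
  show ?case
  proof (cases v)
    case 0
    then show ?thesis using "0.prems" by (simp add: fun_eq_iff)
  next
    case (Suc w)
    have "case_nat (z' w) z = (\<lambda>i. z' (i + w))"
      using "0.prems" unfolding Suc by (auto simp: fun_eq_iff split: nat.split)
    then have "zigzag (case_nat (z' w) z)" using zigzag_shift z' by (simp add: maximal_zigzag_def)
    then show ?thesis using z unfolding maximal_zigzag_def by blast
  qed
next
  case (Suc u)
  show ?case
  proof (cases v)
    case 0
    have "case_nat (z u) z' = (\<lambda>i. z (i + u))"
      using Suc.prems unfolding 0 by (auto simp: fun_eq_iff split: nat.split)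
    then have "zigzag (case_nat (z u) z')" using zigzag_shift z by (simp add: maximal_zigzag_def)
    then show ?thesis using z' unfolding maximal_zigzag_def by blast
  next
    case (Suc w)
    have zz: "zigzag z" "zigzag z'" using z z' by (simp_all add: maximal_zigzag_def)
    obtain s where s: "is_succ s (z u) (z (Suc u))" using zigzag_step[OF zz(1)] by blast
    obtain s' where s': "is_succ s' (z' w) (z' (Suc w))" using zigzag_step[OF zz(2)] by blast
    have "z (Suc u) = z' (Suc w)" using Suc.prems[of 0] Suc by simp
    then have eq: "z u = z' w" using parent_unique[OF zigzag_in[OF zz(1)] zigzag_in[OF zz(2)] s] s' by simp
    have "z (i + u) = z' (i + w)" for i
    proof (cases i)
      case 0
      then show ?thesis using eq by simp
    next
      case (Suc k)
      then show ?thesis using Suc.prems[of k] \<open>v = Suc w\<close> by simp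
    qed
    then show ?thesis by (rule Suc.IH)
  qed
qed

lemma zigzag_node:
  assumes "zigzag z"
  shows "z (Suc (Suc i)) = (fst (z (Suc (Suc i))), fst (z (Suc i)), fst (z i)) \<or>
    z (Suc (Suc i)) = (fst (z (Suc (Suc i))), fst (z i), fst (z (Suc i)))"
proof -
  obtain s where s: "is_succ s (z i) (z (Suc i))" "is_succ (other s) (z (Suc i)) (z (Suc (Suc i)))"
    using zigzag_step[OF assms] .
  obtain p q r where "z i = (p, q, r)" by (cases "z i")
  then show ?thesis using s by (cases s) (simp_all add: is_succ_def)
qed

lemma maximal_zigzag_determined:
  assumes z: "maximal_zigzag z" and z': "maximal_zigzag z'"
    and eq: "\<And>i. fst (z (i + u)) = fst (z' (i + v))"
  shows "z = z'"
proof (rule maximal_zigzag_unique[OF z z', of "u + 2" "v + 2"])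
  fix i
  have zz: "zigzag z" "zigzag z'" using z z' by (simp_all add: maximal_zigzag_def)
  have "fst (z (i + u)) = fst (z' (i + v))" "fst (z (Suc (i + u))) = fst (z' (Suc (i + v)))"
     "fst (z (Suc (Suc (i + u)))) = fst (z' (Suc (Suc (i + v))))"
    using eq[of i] eq[of "Suc i"] eq[of "Suc (Suc i)"] by simp_all
  then have "z (Suc (Suc (i + u))) = z' (Suc (Suc (i + v)))"
    using zigzag_node[OF zz(1), of "i + u"] zigzag_node[OF zz(2), of "i + v"] node_swap
      zigzag_in[OF zz(1), of "Suc (Suc (i + u))"] zigzag_in[OF zz(2), of "Suc (Suc (i + v))"]
    by metis
  then show "z (i + (u + 2)) = z' (i + (v + 2))" by simp
qed

section \<open>The tree of matrices\<close>

text \<open>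
  The matrix tree is extended to the root \<open>(2, 1, 1)\<close>: its left successor is the given root of the
  matrix tree, since $x_1 M x$ is the matrix with rows $(5, 3)$ and $(3, 2)$.
\<close>
definition root_mats :: mtriple where
  "root_mats = (mat2 2 1 1 1, mat2 1 1 1 2, mat2 1 0 0 1)"

text \<open>The triple of matrices at the position of a node, including the root of the extended tree.\<close>
definition node_mats :: "triple \<Rightarrow> mtriple" where
  "node_mats m = (if m = (2, 1, 1) then root_mats else (THE X. same_position m X))"

lemma x_mat_node_mats: "x_mat m = fst (node_mats m)"
  by (simp add: x_mat_def node_mats_def root_mats_def)

lemma same_position_node_mats:
  assumes "same_position m X" shows "node_mats m = X"
proof -
  have "m \<noteq> (2, 1, 1)" using same_position_regular[OF assms] by (auto simp: regular_def)
  moreover have "(THE X. same_position m X) = X"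
    using assms same_position_unique by blast
  ultimately show ?thesis by (simp add: node_mats_def)
qed

lemma node_mats_child:
  assumes m: "m \<in> Sigma_star" and s: "is_succ s m m'"
  shows "node_mats m' = mchild s (node_mats m)"
proof (cases "m = (2, 1, 1)")
  case True
  then have "m' = (5, 1, 2)" "s = Lft" using s by (simp_all add: is_succ_def)
  then show ?thesis using same_position_node_mats[OF same_position.root] True
    by (simp add: node_mats_def root_mats_def M_mat_def mat2_mult)
next
  case False
  then obtain X where X: "same_position m X" using Sigma_star_same_position[OF m] by blast
  then have "same_position m' (mchild s X)" using s same_position.child by (auto simp: is_succ_def)
  then show ?thesis using same_position_node_mats X by metis
qed

text \<open>A symmetric matrix of determinant 1 with upper left entry \<open>n\<close>.\<close>
definition sym_mat :: "int \<Rightarrow> int^2^2 \<Rightarrow> bool" where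
  "sym_mat n X \<longleftrightarrow> X $ 1 $ 1 = n \<and> X $ 1 $ 2 = X $ 2 $ 1 \<and> n * X $ 2 $ 2 - (X $ 1 $ 2)\<^sup>2 = 1"

text \<open>For positive upper left entry $a$, this says that $1/2 \le b/a \le 1$.\<close>
definition ratio_in_range :: "int^2^2 \<Rightarrow> bool" where
  "ratio_in_range X \<longleftrightarrow> X $ 1 $ 1 \<le> 2 * X $ 1 $ 2 \<and> X $ 1 $ 2 \<le> X $ 1 $ 1"

text \<open>The invariant that links a node to its matrices.\<close>
fun markoff_mats :: "triple \<Rightarrow> mtriple \<Rightarrow> bool" where
  "markoff_mats (m, m1, m2) (X, X1, X2) \<longleftrightarrow>
     sym_mat m X \<and> sym_mat m1 X1 \<and> sym_mat m2 X2 \<and> X = X1 ** M_mat ** X2"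

lemma sym_matE:
  assumes "sym_mat n X"
  obtains k l where "X = mat2 n k k l" "n * l - k\<^sup>2 = 1"
  using assms that[of "X $ 1 $ 2" "X $ 2 $ 2"] unfolding sym_mat_def mat2_eq_iff by auto

lemma sym_mat_mat2: "sym_mat n (mat2 n' k k' l) \<longleftrightarrow> n' = n \<and> k' = k \<and> n * l - k\<^sup>2 = 1"
  by (auto simp: sym_mat_def)

lemma sym_mat_det: "X $ 1 $ 1 = n \<Longrightarrow> X $ 1 $ 2 = X $ 2 $ 1 \<Longrightarrow> det X = 1 \<Longrightarrow> sym_mat n X"
  by (simp add: sym_mat_def det_2 power2_eq_square)

lemma product_mat2:
  "mat2 a b b c ** M_mat ** mat2 a' b' b' c' =
     mat2 (3 * a * a' + (a * b' - b * a')) (3 * a * b' + (a * c' - b * b'))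
       (3 * b * a' + (b * b' - c * a')) (3 * b * b' + (b * c' - c * b'))"
  by (simp add: M_mat_def mat2_mult mat2_eq_iff algebra_simps)

lemma markoff_mats_child:
  assumes "markoff_mats m X"
  shows "markoff_mats (child s m) (mchild s X)"
proof -
  obtain n n1 n2 where m: "m = (n, n1, n2)" by (cases m)
  obtain Y Y1 Y2 where X: "X = (Y, Y1, Y2)" by (cases X)
  have *: "sym_mat n Y" "sym_mat n1 Y1" "sym_mat n2 Y2" "Y = Y1 ** M_mat ** Y2"
    using assms unfolding m X markoff_mats.simps by blast+
  obtain k l where Y: "Y = mat2 n k k l" "n * l - k\<^sup>2 = 1" using *(1) by (elim sym_matE)
  obtain k1 l1 where Y1: "Y1 = mat2 n1 k1 k1 l1" "n1 * l1 - k1\<^sup>2 = 1" using *(2) by (elim sym_matE)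
  obtain k2 l2 where Y2: "Y2 = mat2 n2 k2 k2 l2" "n2 * l2 - k2\<^sup>2 = 1" using *(3) by (elim sym_matE)
  have "n = 3 * n1 * n2 + 1 * (n1 * k2 - k1 * n2)" "k = 3 * n1 * k2 + 1 * (n1 * l2 - k1 * k2)"
    "k = 3 * k1 * n2 + 1 * (k1 * k2 - l1 * n2)" "l = 3 * k1 * k2 + 1 * (k1 * l2 - l1 * k2)"
    using *(4) unfolding Y(1) Y1(1) Y2(1) product_mat2 mat2_eq_iff mat2_nth by simp_all
  note step = symmetric_product[OF Y2(2) Y1(2) this, unfolded polar_def split]
  have d: "det (Y1 ** M_mat ** Y) = 1" "det (Y ** M_mat ** Y2) = 1"
    unfolding det_mul Y(1) Y1(1) Y2(1) M_mat_def det_mat2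
    using Y(2) Y1(2) Y2(2) by (simp_all add: power2_eq_square)
  have "sym_mat (3 * n * n1 - n2) (Y1 ** M_mat ** Y)"
    by (rule sym_mat_det[OF _ _ d(1)])
      (use step in \<open>simp_all add: Y(1) Y1(1) Y2(1) product_mat2 algebra_simps\<close>)
  moreover have "sym_mat (3 * n * n2 - n1) (Y ** M_mat ** Y2)"
    by (rule sym_mat_det[OF _ _ d(2)])
      (use step in \<open>simp_all add: Y(1) Y1(1) Y2(1) product_mat2 algebra_simps\<close>)
  ultimately show ?thesis using *(1-3) unfolding m X by (cases s) simp_all
qed

lemma Sigma_star_markoff_mats: "m \<in> Sigma_star \<Longrightarrow> markoff_mats m (node_mats m)"
proof (induction rule: Sigma_star.induct)
  case root
  then show ?case
    by (simp add: node_mats_def root_mats_def sym_mat_mat2 M_mat_def mat2_mult)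
next
  case (succ m s m')
  then show ?case using markoff_mats_child node_mats_child by (metis is_succ_def)
qed

text \<open>The ratio of the product lies strictly between the ratios of \<open>Y2\<close> and \<open>Y1\<close>.\<close>
lemma ratio_in_range_product:
  assumes "sym_mat n1 Y1" "sym_mat n2 Y2" "sym_mat n (Y1 ** M_mat ** Y2)" "0 < n1" "0 < n2" "0 < n"
    and "Y1 $ 1 $ 2 \<le> Y1 $ 1 $ 1" "Y2 $ 1 $ 1 \<le> 2 * Y2 $ 1 $ 2"
  shows "ratio_in_range (Y1 ** M_mat ** Y2)"
proof -
  obtain k1 l1 where Y1: "Y1 = mat2 n1 k1 k1 l1" "n1 * l1 - k1\<^sup>2 = 1" using assms(1) by (elim sym_matE)
  obtain k2 l2 where Y2: "Y2 = mat2 n2 k2 k2 l2" "n2 * l2 - k2\<^sup>2 = 1" using assms(2) by (elim sym_matE)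
  obtain k l where Y: "Y1 ** M_mat ** Y2 = mat2 n k k l" using assms(3) by (elim sym_matE)
  have "n = 3 * n1 * n2 + 1 * (n1 * k2 - k1 * n2)" "k = 3 * n1 * k2 + 1 * (n1 * l2 - k1 * k2)"
    "k = 3 * k1 * n2 + 1 * (k1 * k2 - l1 * n2)" "l = 3 * k1 * k2 + 1 * (k1 * l2 - l1 * k2)"
    using Y unfolding Y1(1) Y2(1) product_mat2 mat2_eq_iff mat2_nth by simp_all
  note step = symmetric_product(1,2)[OF Y2(2) Y1(2) this]
  have b: "k1 \<le> n1" "n2 \<le> 2 * k2" using assms(7,8) by (simp_all add: Y1 Y2)
  have "n1 * k < n1 * n"
    using step(1) mult_left_mono[OF b(1), of n] assms(5,6) by (simp add: algebra_simps)
  then have "k \<le> n" using assms(4) by simp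
  moreover have "n2 * n < n2 * (2 * k)"
  proof -
    have "n * n2 \<le> n * (2 * k2)" using b(2) assms(6) by (intro mult_left_mono) simp_all
    also have "\<dots> < n * (2 * k2) + 2 * n1" using assms(4) by simp
    also have "\<dots> = n2 * (2 * k)" using step(2) by (simp add: algebra_simps)
    finally show ?thesis by (simp add: mult.commute)
  qed
  then have "n \<le> 2 * k" using assms(5) by simp
  ultimately show ?thesis unfolding Y ratio_in_range_def by simp
qed

lemma Sigma_star_ratio_in_range:
  assumes "m \<in> Sigma_star"
  shows "ratio_in_range (x_mat m)"
proof -
  \<comment> \<open>The third matrix of the root has ratio 0; it does not enter any left successor.\<close>
  have "ratio_in_range (fst (node_mats m)) \<and> ratio_in_range (fst (snd (node_mats m))) \<and>
      (m \<noteq> (2, 1, 1) \<longrightarrow> ratio_in_range (snd (snd (node_mats m))))"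
    using assms
  proof (induction rule: Sigma_star.induct)
    case root
    then show ?case by (simp add: node_mats_def root_mats_def ratio_in_range_def)
  next
    case (succ m s m')
    obtain n n1 n2 where m: "m = (n, n1, n2)" by (cases m)
    obtain Y Y1 Y2 where Y: "node_mats m = (Y, Y1, Y2)" by (cases "node_mats m")
    have m'S: "m' \<in> Sigma_star" using succ.hyps Sigma_star.succ by blast
    have c: "node_mats m' = mchild s (Y, Y1, Y2)" using node_mats_child[OF succ.hyps] Y by simp
    have mm: "markoff_mats m (Y, Y1, Y2)" "markoff_mats m' (mchild s (Y, Y1, Y2))"
      using Sigma_star_markoff_mats[OF succ.hyps(1)] Sigma_star_markoff_mats[OF m'S] Y c by simp_all
    have pos: "0 < n" "0 < n1" "0 < n2" using Sigma_star_pos[OF succ.hyps(1)] m by simp_all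
    have pos': "0 < fst m'" using Sigma_star_pos[OF m'S] by simp
    have m': "m' = child s m" "m = (2, 1, 1) \<longrightarrow> s = Lft" using succ.hyps by (simp_all add: is_succ_def)
    show ?case
    proof (cases s)
      case Lft
      have "ratio_in_range (Y1 ** M_mat ** Y)"
        by (rule ratio_in_range_product[of n1 _ n _ "fst m'"])
          (use mm pos pos' succ.IH[unfolded Y] in \<open>simp_all add: m m' Lft ratio_in_range_def\<close>)
      then show ?thesis using succ.IH by (simp add: c Y Lft)
    next
      case Rgt
      then have nr: "m \<noteq> (2, 1, 1)" using m' by auto
      have "ratio_in_range (Y ** M_mat ** Y2)"
        by (rule ratio_in_range_product[of n _ n2 _ "fst m'"])
          (use mm pos pos' succ.IH[unfolded Y] nr in \<open>simp_all add: m m' Rgt ratio_in_range_def\<close>)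
      then show ?thesis using succ.IH nr by (simp add: c Y Rgt)
    qed
  qed
  then show ?thesis by (simp add: x_mat_node_mats)
qed

section \<open>The matrix sequence of a zigzag\<close>

text \<open>
  The entries of the matrices along a zigzag. The sign \<open>seq_e\<close> records the side of the next step: after
  a left step the new matrix is the left factor of the following product, after a right step the right
  one, and transposition turns the latter product into one with $M^T$ and the factors exchanged.
\<close>
definition seq_a :: "(nat \<Rightarrow> triple) \<Rightarrow> nat \<Rightarrow> int" where "seq_a z i = fst (z i)"
definition seq_b :: "(nat \<Rightarrow> triple) \<Rightarrow> nat \<Rightarrow> int" where "seq_b z i = x_mat (z i) $ 1 $ 2"
definition seq_c :: "(nat \<Rightarrow> triple) \<Rightarrow> nat \<Rightarrow> int" where "seq_c z i = x_mat (z i) $ 2 $ 2"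
definition seq_e :: "(nat \<Rightarrow> triple) \<Rightarrow> nat \<Rightarrow> int" where
  "seq_e z i = (if is_succ Lft (z i) (z (Suc i)) then 1 else -1)"

lemma x_mat_sym:
  assumes "m \<in> Sigma_star"
  shows "sym_mat (fst m) (x_mat m)"
  using Sigma_star_markoff_mats[OF assms] unfolding x_mat_node_mats
  by (cases m; cases "node_mats m") simp

lemma x_mat_seq:
  assumes "zigzag z"
  shows "x_mat (z i) = mat2 (seq_a z i) (seq_b z i) (seq_b z i) (seq_c z i)"
  using x_mat_sym[OF zigzag_in[OF assms]]
  unfolding sym_mat_def mat2_eq_iff seq_a_def seq_b_def seq_c_def by simp

lemma zigzag_products:
  assumes z: "zigzag z"
  shows "if is_succ Lft (z i) (z (Suc i))
    then x_mat (z (Suc (Suc i))) = x_mat (z (Suc i)) ** M_mat ** x_mat (z i)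
    else x_mat (z (Suc (Suc i))) = x_mat (z i) ** M_mat ** x_mat (z (Suc i))"
proof -
  obtain s where s: "is_succ s (z i) (z (Suc i))" "is_succ (other s) (z (Suc i)) (z (Suc (Suc i)))"
    using zigzag_step[OF z] .
  have L: "is_succ Lft (z i) (z (Suc i)) \<longleftrightarrow> s = Lft"
    using child_sides[OF zigzag_in[OF z] s(1)] s(1) by blast
  obtain Y Y1 Y2 where "node_mats (z i) = (Y, Y1, Y2)" by (cases "node_mats (z i)")
  then show ?thesis unfolding L x_mat_node_mats
    using node_mats_child[OF zigzag_in[OF z] s(1)] node_mats_child[OF zigzag_in[OF z] s(2)]
    by (cases s) simp_all
qed

lemma zigzag_markoff_seq:
  assumes z: "zigzag z"
  shows "markoff_seq (seq_a z) (seq_b z) (seq_c z) (seq_e z)"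
proof
  fix i
  show "seq_e z i * seq_e z i = 1" by (simp add: seq_e_def)
  show "0 < seq_a z i" using Sigma_star_pos[OF zigzag_in[OF z]] by (simp add: seq_a_def)
  obtain s where s: "is_succ s (z i) (z (Suc i))" "is_succ (other s) (z (Suc i)) (z (Suc (Suc i)))"
    using zigzag_step[OF z] .
  show "2 * seq_a z i \<le> seq_a z (Suc i)"
    using child_ge_double[OF zigzag_in[OF z] s(1)] by (simp add: seq_a_def)
  show "seq_e z (Suc i) = - seq_e z i"
    using child_sides[OF zigzag_in[OF z] s(1)] child_sides[OF zigzag_in[OF z] s(2)] s
    unfolding seq_e_def by (cases s) auto
  show "seq_a z i * seq_c z i - (seq_b z i)\<^sup>2 = 1"
    using x_mat_sym[OF zigzag_in[OF z], of i] unfolding sym_mat_def seq_a_def seq_b_def seq_c_def by blast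
  have "seq_a z (Suc (Suc i)) = 3 * seq_a z (Suc i) * seq_a z i
      + seq_e z i * (seq_a z (Suc i) * seq_b z i - seq_b z (Suc i) * seq_a z i) \<and>
    seq_b z (Suc (Suc i)) = 3 * seq_a z (Suc i) * seq_b z i
      + seq_e z i * (seq_a z (Suc i) * seq_c z i - seq_b z (Suc i) * seq_b z i) \<and>
    seq_b z (Suc (Suc i)) = 3 * seq_b z (Suc i) * seq_a z i
      + seq_e z i * (seq_b z (Suc i) * seq_b z i - seq_c z (Suc i) * seq_a z i) \<and>
    seq_c z (Suc (Suc i)) = 3 * seq_b z (Suc i) * seq_b z i
      + seq_e z i * (seq_b z (Suc i) * seq_c z i - seq_c z (Suc i) * seq_b z i)"
  proof (cases "is_succ Lft (z i) (z (Suc i))")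
    case True
    then show ?thesis using zigzag_products[OF z, of i]
      unfolding x_mat_seq[OF z] product_mat2 mat2_eq_iff mat2_nth seq_e_def if_P[OF True] mult_1 by blast
  next
    case False
    then show ?thesis using zigzag_products[OF z, of i]
      unfolding x_mat_seq[OF z] product_mat2 mat2_eq_iff mat2_nth seq_e_def by (simp add: algebra_simps)
  qed
  then show "seq_a z (Suc (Suc i)) = 3 * seq_a z (Suc i) * seq_a z i
      + seq_e z i * (seq_a z (Suc i) * seq_b z i - seq_b z (Suc i) * seq_a z i)"
    "seq_b z (Suc (Suc i)) = 3 * seq_a z (Suc i) * seq_b z i
      + seq_e z i * (seq_a z (Suc i) * seq_c z i - seq_b z (Suc i) * seq_b z i)"
    "seq_b z (Suc (Suc i)) = 3 * seq_b z (Suc i) * seq_a z i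
      + seq_e z i * (seq_b z (Suc i) * seq_b z i - seq_c z (Suc i) * seq_a z i)"
    "seq_c z (Suc (Suc i)) = 3 * seq_b z (Suc i) * seq_b z i
      + seq_e z i * (seq_b z (Suc i) * seq_c z i - seq_c z (Suc i) * seq_b z i)"
    by blast+
qed

section \<open>The limit attached to a zigzag\<close>

text \<open>The limit of the ratios $b/a$ along the zigzag; it is $\xi_m$ for the maximal zigzag starting at $m$.\<close>
definition zigzag_limit :: "(nat \<Rightarrow> triple) \<Rightarrow> real" where
  "zigzag_limit z = markoff_seq.xi (seq_a z) (seq_b z)"

lemma zigzag_limit_properties:
  assumes z: "zigzag z"
  shows "corresponds (\<lambda>i. x_mat (z i)) (zigzag_limit z)" "zigzag_limit z \<in> E3_plus"
    "(\<lambda>i. alpha (z i)) \<longlonglongrightarrow> zigzag_limit z" "(\<lambda>i. alpha_bar (z i) + 3) \<longlonglongrightarrow> zigzag_limit z"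
    "zigzag_limit z \<in> {1/2<..<1}"
proof -
  interpret s: markoff_seq "seq_a z" "seq_b z" "seq_c z" "seq_e z"
    by (rule zigzag_markoff_seq[OF z])
  have xi: "zigzag_limit z = s.xi" by (simp add: zigzag_limit_def)
  have "(\<lambda>i. x_mat (z i)) = s.seq_mat" by (simp add: fun_eq_iff s.seq_mat_def x_mat_seq[OF z])
  then show "corresponds (\<lambda>i. x_mat (z i)) (zigzag_limit z)" unfolding xi using s.corresponds_xi by simp
  show "zigzag_limit z \<in> E3_plus" unfolding xi by (rule s.xi_E3_plus)
  define w where "w i = sqrt (9 - 4 * (1 / real_of_int (seq_a z i))\<^sup>2)" for i
  have w: "sqrt (9 * (real_of_int (seq_a z i))\<^sup>2 - 4) = real_of_int (seq_a z i) * w i" for i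
  proof -
    have p: "0 < real_of_int (seq_a z i)" using s.a_pos by simp
    have "9 * (real_of_int (seq_a z i))\<^sup>2 - 4
        = (real_of_int (seq_a z i))\<^sup>2 * (9 - 4 * (1 / real_of_int (seq_a z i))\<^sup>2)"
      using p by (simp add: field_simps power2_eq_square)
    then show ?thesis using p by (simp add: w_def real_sqrt_mult)
  qed
  have "w \<longlonglongrightarrow> sqrt (9 - 4 * 0\<^sup>2)"
    unfolding w_def by (intro tendsto_intros s.inverse_a_tendsto)
  moreover have "sqrt 9 = (3::real)" by (rule real_sqrt_unique) simp_all
  ultimately have lw: "w \<longlonglongrightarrow> 3" by simp
  have al: "alpha (z i) = s.ratio i - 3 / 2 + w i / 2" "alpha_bar (z i) = s.ratio i - 3 / 2 - w i / 2" for i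
    using s.a_pos[of i] w[of i]
    by (simp_all add: alpha_def alpha_bar_def Let_def s.ratio_def field_simps
        flip: seq_a_def seq_b_def)
  have "(\<lambda>i. s.ratio i - 3 / 2 + w i / 2) \<longlonglongrightarrow> s.xi - 3 / 2 + 3 / 2"
    by (intro tendsto_intros s.ratio_tendsto lw) simp
  then show "(\<lambda>i. alpha (z i)) \<longlonglongrightarrow> zigzag_limit z" unfolding al xi by simp
  have "(\<lambda>i. s.ratio i - 3 / 2 - w i / 2 + 3) \<longlonglongrightarrow> s.xi - 3 / 2 - 3 / 2 + 3"
    by (intro tendsto_intros s.ratio_tendsto lw) simp
  then show "(\<lambda>i. alpha_bar (z i) + 3) \<longlonglongrightarrow> zigzag_limit z" unfolding al xi by simp
  have r: "1 / 2 \<le> s.ratio i" "s.ratio i \<le> 1" for i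
  proof -
    have "ratio_in_range (x_mat (z i))" by (rule Sigma_star_ratio_in_range[OF zigzag_in[OF z]])
    then have "seq_a z i \<le> 2 * seq_b z i" "seq_b z i \<le> seq_a z i"
      unfolding ratio_in_range_def x_mat_seq[OF z] by simp_all
    then have "real_of_int (seq_a z i) \<le> 2 * real_of_int (seq_b z i)"
      "real_of_int (seq_b z i) \<le> real_of_int (seq_a z i)" by linarith+
    then show "1 / 2 \<le> s.ratio i" "s.ratio i \<le> 1"
      using s.a_pos[of i] by (simp_all add: s.ratio_def field_simps)
  qed
  have "1 / 2 \<le> s.xi" by (rule LIMSEQ_le_const[OF s.ratio_tendsto]) (use r in blast)
  moreover have "s.xi \<le> 1" by (rule LIMSEQ_le_const2[OF s.ratio_tendsto]) (use r in blast)
  moreover have "s.xi \<noteq> 1 / 2" "s.xi \<noteq> 1"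
  proof -
    have "1 / 2 \<in> (\<rat> :: real set)" "1 \<in> (\<rat> :: real set)" by simp_all
    then show "s.xi \<noteq> 1 / 2" "s.xi \<noteq> 1" using s.xi_irrational by metis+
  qed
  ultimately show "zigzag_limit z \<in> {1/2<..<1}" unfolding xi by simp
qed

section \<open>Equivalence of numbers\<close>

lemma gl2z_equiv_iff:
  "gl2z_equiv \<xi> \<eta> \<longleftrightarrow> \<xi> \<notin> \<rat> \<and> \<eta> \<notin> \<rat> \<and>
     (\<exists>p q r s :: int. \<bar>p * s - q * r\<bar> = 1 \<and>
        \<eta> * (of_int r * \<xi> + of_int s) = of_int p * \<xi> + of_int q)"
proof -
  have nz: "of_int r * \<xi> + of_int s \<noteq> 0" if "\<xi> \<notin> \<rat>" "\<bar>p * s - q * r\<bar> = 1" for p q r s :: int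
  proof
    assume 0: "of_int r * \<xi> + of_int s = 0"
    show False
    proof (cases "r = 0")
      case True
      then show False using 0 that(2) by simp
    next
      case False
      then have "\<xi> = of_int (- s) / of_int r" using 0 by (simp add: field_simps)
      then show False using that(1) by (metis Rats_divide Rats_of_int)
    qed
  qed
  show ?thesis unfolding gl2z_equiv_def invertible_mat2_iff
    using nz by (metis (no_types, lifting) nonzero_eq_divide_eq)
qed

lemma gl2z_equiv_sym:
  assumes "gl2z_equiv \<xi> \<eta>" shows "gl2z_equiv \<eta> \<xi>"
proof -
  obtain p q r s :: int where irr: "\<xi> \<notin> \<rat>" "\<eta> \<notin> \<rat>" and det: "\<bar>p * s - q * r\<bar> = 1"
    and e: "\<eta> * (of_int r * \<xi> + of_int s) = of_int p * \<xi> + of_int q"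
    using assms unfolding gl2z_equiv_iff by blast
  have "\<bar>s * p - (- q) * (- r)\<bar> = 1" using det by (simp add: mult.commute)
  moreover have "\<xi> * (of_int (- r) * \<eta> + of_int p) = of_int s * \<eta> + of_int (- q)"
    using e by (simp add: algebra_simps)
  ultimately show ?thesis unfolding gl2z_equiv_iff using irr by blast
qed

lemma gl2z_equiv_trans:
  assumes "gl2z_equiv \<xi> \<eta>" "gl2z_equiv \<eta> \<zeta>" shows "gl2z_equiv \<xi> \<zeta>"
proof -
  obtain p q r s :: int where irr: "\<xi> \<notin> \<rat>" "\<eta> \<notin> \<rat>" and det: "\<bar>p * s - q * r\<bar> = 1"
    and e: "\<eta> * (of_int r * \<xi> + of_int s) = of_int p * \<xi> + of_int q"
    using assms(1) unfolding gl2z_equiv_iff by blast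
  obtain p' q' r' s' :: int where irr': "\<zeta> \<notin> \<rat>" and det': "\<bar>p' * s' - q' * r'\<bar> = 1"
    and e': "\<zeta> * (of_int r' * \<eta> + of_int s') = of_int p' * \<eta> + of_int q'"
    using assms(2) unfolding gl2z_equiv_iff by blast
  have "(p' * p + q' * r) * (r' * q + s' * s) - (p' * q + q' * s) * (r' * p + s' * r)
      = (p' * s' - q' * r') * (p * s - q * r)" by (simp add: algebra_simps)
  then have d: "\<bar>(p' * p + q' * r) * (r' * q + s' * s) - (p' * q + q' * s) * (r' * p + s' * r)\<bar> = 1"
    using det det' by (simp add: abs_mult)
  define h where "h = of_int r * \<xi> + of_int s"
  have "\<zeta> * (of_int (r' * p + s' * r) * \<xi> + of_int (r' * q + s' * s))
      = \<zeta> * (of_int r' * (\<eta> * h) + of_int s' * h)"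
    unfolding e[folded h_def] by (simp add: h_def algebra_simps)
  also have "\<dots> = (\<zeta> * (of_int r' * \<eta> + of_int s')) * h" by (simp add: algebra_simps)
  also have "\<dots> = of_int p' * (\<eta> * h) + of_int q' * h" unfolding e' by (simp add: algebra_simps)
  also have "\<dots> = of_int (p' * p + q' * r) * \<xi> + of_int (p' * q + q' * s)"
    unfolding e[folded h_def] by (simp add: h_def algebra_simps)
  finally show ?thesis unfolding gl2z_equiv_iff using irr irr' d by blast
qed

section \<open>Equivalent limits have a common tail\<close>

text \<open>
  The triples are those of $A x A^T$ and $A x' A^T$, where $A$ has rows $(s, r)$ and $(q, p)$.
\<close>
lemma polar_transform:
  fixes a b c a' b' c' p q r s :: int
  shows "polar (s\<^sup>2 * a + 2 * r * s * b + r\<^sup>2 * c, s * q * a + (s * p + r * q) * b + r * p * c,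
        q\<^sup>2 * a + 2 * p * q * b + p\<^sup>2 * c)
      (s\<^sup>2 * a' + 2 * r * s * b' + r\<^sup>2 * c', s * q * a' + (s * p + r * q) * b' + r * p * c',
        q\<^sup>2 * a' + 2 * p * q * b' + p\<^sup>2 * c')
    = (p * s - q * r)\<^sup>2 * polar (a, b, c) (a', b', c')"
  by (simp add: polar_def algebra_simps power2_eq_square)

text \<open>
  The equivalence maps $x_i$ to a matrix $(\alpha_i, \beta_i; \beta_i, \kappa_i)$ that approximates the
  second number, hence to a term with index $k(i)$ of the second sequence. The growth of both sequences
  forces $k(i+1) = k(i) + 1$ from some point on, and then the invariance of the polar form gives
  $3 a_i = 3 a'_{k(i)}$.
\<close>
lemma equivalent_common_tail:
  assumes "markoff_seq a b c e" "markoff_seq a' b' c' e'"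
    and equiv: "gl2z_equiv (markoff_seq.xi a b) (markoff_seq.xi a' b')"
  shows "\<exists>u v. \<forall>i. a (i + u) = a' (i + v)"
proof -
  interpret s: markoff_seq a b c e by fact
  interpret t: markoff_seq a' b' c' e' by fact
  obtain p q r s :: int where det: "\<bar>p * s - q * r\<bar> = 1"
    and eq: "t.xi * (of_int r * s.xi + of_int s) = of_int p * s.xi + of_int q"
    using equiv unfolding gl2z_equiv_iff by blast
  define D where "D = p * s - q * r"
  have D: "D\<^sup>2 = 1" using det power2_abs[of D] by (simp add: D_def)
  define h where "h = of_int r * s.xi + of_int s"
  have h: "h \<noteq> 0"
  proof
    assume "h = 0"
    then have "of_int s + of_int r * s.xi + of_int 0 * s.xi\<^sup>2 = 0" by (simp add: h_def)
    from s.xi_no_quadratic[OF this] show False using det by simp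
  qed
  define \<alpha> where "\<alpha> i = s\<^sup>2 * a i + 2 * r * s * b i + r\<^sup>2 * c i" for i
  define \<beta> where "\<beta> i = s * q * a i + (s * p + r * q) * b i + r * p * c i" for i
  define \<kappa> where "\<kappa> i = q\<^sup>2 * a i + 2 * p * q * b i + p\<^sup>2 * c i" for i
  have pol: "polar (\<alpha> i, \<beta> i, \<kappa> i) (\<alpha> j, \<beta> j, \<kappa> j) = polar (s.pt i) (s.pt j)" for i j
    unfolding \<alpha>_def \<beta>_def \<kappa>_def polar_transform D_def[symmetric] D by simp
  have det1: "\<alpha> i * \<kappa> i - (\<beta> i)\<^sup>2 = 1" for i
    using pol[of i i] s.polar_self[of i] unfolding polar_def by (simp add: power2_eq_square)
  have \<alpha>: "of_int (\<alpha> i) = of_int (a i) * h\<^sup>2 - 2 * of_int r * h * s.ell i + (of_int r)\<^sup>2 * s.omega i" for i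
    by (simp add: \<alpha>_def h_def s.ell_def s.omega_def algebra_simps power2_eq_square)
  have \<beta>: "h * (of_int (\<alpha> i) * t.xi - of_int (\<beta> i)) = of_int D * (h * s.ell i - of_int r * s.omega i)" for i
  proof -
    have "h * (of_int (\<alpha> i) * t.xi - of_int (\<beta> i)) = of_int (\<alpha> i) * (t.xi * h) - h * of_int (\<beta> i)"
      by (simp add: algebra_simps)
    also have "\<dots> = of_int D * (h * s.ell i - of_int r * s.omega i)"
      unfolding eq[folded h_def]
      by (simp add: \<alpha>_def \<beta>_def h_def D_def s.ell_def s.omega_def algebra_simps power2_eq_square)
    finally show ?thesis .
  qed
  define C0 where "C0 = 1 + 2 * \<bar>of_int r / h\<bar>"
  have C0: "1 \<le> C0" by (simp add: C0_def)
  have p1: "1 \<le> real_of_int (a i)" for i using s.a_pos[of i] by linarith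
  have approx: "\<bar>of_int (\<alpha> i) * t.xi - of_int (\<beta> i)\<bar> \<le> C0 / of_int (a i)" for i
  proof -
    have "of_int (\<alpha> i) * t.xi - of_int (\<beta> i) = of_int D * (s.ell i - of_int r / h * s.omega i)"
      using \<beta>[of i] h by (simp add: field_simps)
    moreover have "\<bar>real_of_int D\<bar> = 1" using det unfolding D_def by (metis of_int_abs of_int_1)
    ultimately have "\<bar>of_int (\<alpha> i) * t.xi - of_int (\<beta> i)\<bar> = \<bar>s.ell i - of_int r / h * s.omega i\<bar>"
      by (simp add: abs_mult)
    also have "\<dots> \<le> \<bar>s.ell i\<bar> + \<bar>of_int r / h\<bar> * \<bar>s.omega i\<bar>"
      using abs_triangle_ineq4[of "s.ell i" "of_int r / h * s.omega i"] by (simp add: abs_mult)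
    also have "\<dots> \<le> 1 / of_int (a i) + \<bar>of_int r / h\<bar> * (2 / of_int (a i))"
      using s.ell_bound[of i] s.omega_bounds[of i] by (intro add_mono mult_left_mono) simp_all
    also have "\<dots> = C0 / of_int (a i)" by (simp add: C0_def add_divide_distrib)
    finally show ?thesis .
  qed
  define C3 where "C3 = 2 * \<bar>of_int r * h\<bar> + 2 * (of_int r)\<^sup>2"
  have near: "\<bar>of_int (\<alpha> i) - of_int (a i) * h\<^sup>2\<bar> \<le> C3" for i
  proof -
    have "1 / real_of_int (a i) \<le> 1" "2 / real_of_int (a i) \<le> 2"
      using p1[of i] by (simp_all add: divide_le_eq)
    then have lw: "\<bar>s.ell i\<bar> \<le> 1" "\<bar>s.omega i\<bar> \<le> 2"
      using s.ell_bound[of i] s.omega_bounds[of i] by linarith+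
    have "\<bar>of_int (\<alpha> i) - of_int (a i) * h\<^sup>2\<bar> = \<bar>(of_int r)\<^sup>2 * s.omega i - 2 * (of_int r * h) * s.ell i\<bar>"
      unfolding \<alpha> by (simp add: algebra_simps)
    also have "\<dots> \<le> (of_int r)\<^sup>2 * \<bar>s.omega i\<bar> + 2 * \<bar>of_int r * h\<bar> * \<bar>s.ell i\<bar>"
      using abs_triangle_ineq4[of "(of_int r)\<^sup>2 * s.omega i" "2 * (of_int r * h) * s.ell i"]
      by (simp add: abs_mult)
    also have "\<dots> \<le> (of_int r)\<^sup>2 * 2 + 2 * \<bar>of_int r * h\<bar> * 1"
      using lw by (intro add_mono mult_left_mono) simp_all
    finally show ?thesis by (simp add: C3_def)
  qed
  have h2: "0 < h\<^sup>2" using h by simp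
  define C where "C = 2 * C0 * h\<^sup>2"
  have C: "0 \<le> C" using C0 h2 by (simp add: C_def)
  obtain P0 where P0: "\<forall>p q r. 0 < p \<longrightarrow> p * r - q\<^sup>2 = 1 \<longrightarrow>
      \<bar>of_int p * t.xi - of_int q\<bar> \<le> C / of_int p \<longrightarrow> P0 \<le> real_of_int p \<longrightarrow> (\<exists>i. (p, q, r) = t.pt i)"
    using t.rigidity[OF C] ..
  obtain I where I: "\<And>i. I \<le> i \<Longrightarrow> max 2 (max (2 * C3 / h\<^sup>2) (2 * P0 / h\<^sup>2)) < real_of_int (a i)"
    using s.eventually_a_gt by (metis eventually_sequentially)
  have size: "of_int (a i) * h\<^sup>2 \<le> 2 * real_of_int (\<alpha> i)" "real_of_int (\<alpha> i) \<le> 2 * (of_int (a i) * h\<^sup>2)"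
    "P0 \<le> of_int (\<alpha> i)" "2 < real_of_int (a i)" if i: "I \<le> i" for i
  proof -
    have "2 * C3 / h\<^sup>2 < real_of_int (a i)" "2 * P0 / h\<^sup>2 < real_of_int (a i)"
      using I[OF i] by simp_all
    then have "2 * C3 < of_int (a i) * h\<^sup>2" "2 * P0 < of_int (a i) * h\<^sup>2"
      using h2 by (simp_all add: divide_less_eq)
    moreover have "0 < of_int (a i) * h\<^sup>2" using p1[of i] h2 by simp
    ultimately show "of_int (a i) * h\<^sup>2 \<le> 2 * real_of_int (\<alpha> i)" "real_of_int (\<alpha> i) \<le> 2 * (of_int (a i) * h\<^sup>2)"
      "P0 \<le> of_int (\<alpha> i)"
      using near[of i] by linarith+
    show "2 < real_of_int (a i)" using I[OF i] by simp
  qed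
  have pos: "0 < real_of_int (\<alpha> i)" if "I \<le> i" for i
  proof -
    have "0 < of_int (a i) * h\<^sup>2" using p1[of i] h2 by simp
    then show ?thesis using size(1)[OF that] by linarith
  qed
  have "\<exists>k. (\<alpha> i, \<beta> i, \<kappa> i) = t.pt k" if i: "I \<le> i" for i
  proof (rule P0[rule_format, OF _ det1])
    show "0 < \<alpha> i" using pos[OF i] by simp
    have "C0 / of_int (a i) \<le> C / of_int (\<alpha> i)"
    proof -
      have "C0 * of_int (\<alpha> i) \<le> C0 * (2 * (of_int (a i) * h\<^sup>2))"
        using size(2)[OF i] C0 by (intro mult_left_mono) simp_all
      then show ?thesis using pos[OF i] p1[of i] by (simp add: C_def field_simps)
    qed
    then show "\<bar>of_int (\<alpha> i) * t.xi - of_int (\<beta> i)\<bar> \<le> C / of_int (\<alpha> i)" using approx[of i] by linarith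
    show "P0 \<le> of_int (\<alpha> i)" by (rule size(3)[OF i])
  qed
  then obtain k where k: "\<And>i. I \<le> i \<Longrightarrow> (\<alpha> i, \<beta> i, \<kappa> i) = t.pt (k i)" by metis
  have \<alpha>k: "\<alpha> i = a' (k i)" if "I \<le> i" for i using k[OF that] by simp
  have k_less: "k (Suc i) > k i" if i: "I < i" for i
  proof -
    obtain n where n: "i = Suc n" "I \<le> n" using i by (cases i) auto
    have "2 * real_of_int (\<alpha> i) \<le> 4 * (of_int (a i) * h\<^sup>2)" using size(2)[of i] i by simp
    also have "\<dots> < (2 * of_int (a n)) * (of_int (a i) * h\<^sup>2)"
      using size(4)[OF n(2)] p1[of i] h2 by (intro mult_strict_right_mono) simp_all
    also have "\<dots> = real_of_int (2 * a i * a n) * h\<^sup>2" by simp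
    also have "\<dots> \<le> of_int (a (Suc i)) * h\<^sup>2"
      using s.a_lower[of n] h2 unfolding n by (intro mult_right_mono of_int_le_iff[THEN iffD2]) simp_all
    also have "\<dots> \<le> 2 * real_of_int (\<alpha> (Suc i))" using size(1)[of "Suc i"] i by simp
    finally have "a' (k i) < a' (k (Suc i))" using \<alpha>k[of i] \<alpha>k[of "Suc i"] i by simp
    then show ?thesis using t.strict_mono_a by (simp add: strict_mono_less)
  qed
  have k_ge: "j \<le> k (Suc I + j)" for j
  proof (induction j)
    case (Suc j)
    then show ?case using k_less[of "Suc I + j"] by simp
  qed simp
  \<comment> \<open>A jump by two indices would multiply the size by more than \<open>\<alpha> (Suc i)\<close> allows once \<open>a' (k i - 1)\<close>
    exceeds \<open>3 / h\<^sup>2\<close>.\<close>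
  define J where "J = Suc I + Suc (nat \<lceil>3 / h\<^sup>2\<rceil>)"
  have k_Suc: "k (Suc i) = Suc (k i)" if i: "J \<le> i" for i
  proof (rule ccontr)
    assume "k (Suc i) \<noteq> Suc (k i)"
    then have k2: "Suc (Suc (k i)) \<le> k (Suc i)" using k_less[of i] i by (simp add: J_def)
    have "i - Suc I \<le> k i" using k_ge[of "i - Suc I"] i by (simp add: J_def)
    then have "Suc (nat \<lceil>3 / h\<^sup>2\<rceil>) \<le> k i" using i by (simp add: J_def)
    then obtain l where l: "k i = Suc l" "nat \<lceil>3 / h\<^sup>2\<rceil> \<le> l" by (cases "k i") auto
    obtain n where n: "i = Suc n" using i by (cases i) (auto simp: J_def)
    have Ii: "I \<le> i" "I \<le> Suc i" using i by (simp_all add: J_def)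
    define A where "A = real_of_int (\<alpha> i)"
    have A: "0 < A" using pos[OF Ii(1)] by (simp add: A_def)
    have big: "3 / h\<^sup>2 < real_of_int (a' l)" using l(2) t.a_ge[of l] by linarith
    have "4 * A * A * of_int (a' l) \<le> real_of_int (\<alpha> (Suc i))"
    proof -
      have "2 * a' (k i) * a' l \<le> a' (Suc (k i))" using t.a_lower[of l] l by simp
      then have "2 * (2 * a' (k i) * a' l) * a' (k i) \<le> 2 * a' (Suc (k i)) * a' (k i)"
        using t.a_pos[of "k i"] by (intro mult_right_mono mult_left_mono) simp_all
      also have "\<dots> \<le> a' (Suc (Suc (k i)))" by (rule t.a_lower)
      also have "\<dots> \<le> a' (k (Suc i))" using t.strict_mono_a k2 by (simp add: strict_mono_less_eq)
      finally have "4 * \<alpha> i * \<alpha> i * a' l \<le> \<alpha> (Suc i)" using \<alpha>k Ii by (simp add: mult_ac)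
      then show ?thesis unfolding A_def by (metis of_int_le_iff of_int_mult of_int_numeral)
    qed
    moreover have "real_of_int (\<alpha> (Suc i)) * h\<^sup>2 \<le> 12 * A * A"
    proof -
      have "2 * a (Suc i) \<le> 3 * a i * (2 * a n)" using s.a_upper[of n] n by (simp add: mult_ac)
      also have "\<dots> \<le> 3 * a i * a i" using s.a_grow[of n] s.a_pos[of i] n by (intro mult_left_mono) simp_all
      finally have "2 * real_of_int (a (Suc i)) \<le> 3 * of_int (a i) * of_int (a i)"
        by (metis of_int_le_iff of_int_mult of_int_numeral)
      then have "2 * real_of_int (a (Suc i)) * (h\<^sup>2 * h\<^sup>2) \<le> 3 * of_int (a i) * of_int (a i) * (h\<^sup>2 * h\<^sup>2)"
        by (rule mult_right_mono) simp
      also have "\<dots> = 3 * ((of_int (a i) * h\<^sup>2) * (of_int (a i) * h\<^sup>2))" by simp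
      also have "\<dots> \<le> 3 * ((2 * A) * (2 * A))"
      proof -
        have v: "0 \<le> of_int (a i) * h\<^sup>2" "of_int (a i) * h\<^sup>2 \<le> 2 * A"
          using size(1)[OF Ii(1)] p1[of i] by (simp_all add: A_def)
        have "(of_int (a i) * h\<^sup>2) * (of_int (a i) * h\<^sup>2) \<le> (2 * A) * (2 * A)"
          by (rule mult_mono[OF v(2) v(2) _ v(1)]) (use A in simp)
        then show ?thesis by (rule mult_left_mono) simp
      qed
      finally have *: "2 * (of_int (a (Suc i)) * h\<^sup>2) * h\<^sup>2 \<le> 12 * A * A" by (simp add: mult_ac)
      have "real_of_int (\<alpha> (Suc i)) * h\<^sup>2 \<le> 2 * (of_int (a (Suc i)) * h\<^sup>2) * h\<^sup>2"
        using size(2)[OF Ii(2)] h2 by (intro mult_right_mono) simp_all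
      then show ?thesis using * by linarith
    qed
    ultimately have "4 * A * A * of_int (a' l) * h\<^sup>2 \<le> 12 * A * A"
      using h2 mult_right_mono[of "4 * A * A * of_int (a' l)" "of_int (\<alpha> (Suc i))" "h\<^sup>2"] by linarith
    then have "(4 * A * A) * (of_int (a' l) * h\<^sup>2) \<le> (4 * A * A) * 3" by simp
    then have "of_int (a' l) * h\<^sup>2 \<le> 3" using A by (simp add: mult_le_cancel_left_pos)
    then show False using big h2 by (simp add: divide_less_eq)
  qed
  have kJ: "k (i + J) = i + k J" for i
    by (induction i) (simp_all add: k_Suc)
  have "a (i + J) = a' (i + k J)" for i
  proof -
    have IJ: "I \<le> i + J" "I \<le> Suc (i + J)" "I \<le> Suc (Suc (i + J))" by (simp_all add: J_def)
    have ks: "k (Suc (i + J)) = Suc (k (i + J))" "k (Suc (Suc (i + J))) = Suc (Suc (k (i + J)))"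
      by (simp_all add: k_Suc)
    have "3 * a (i + J) = polar (s.pt (Suc (i + J))) (s.pt (Suc (Suc (i + J))))"
      by (rule s.polar_Suc_Suc[symmetric])
    also have "\<dots> = polar (t.pt (Suc (k (i + J)))) (t.pt (Suc (Suc (k (i + J)))))"
      unfolding pol[symmetric] k[OF IJ(2)] k[OF IJ(3)] ks ..
    also have "\<dots> = 3 * a' (k (i + J))" by (rule t.polar_Suc_Suc)
    finally show ?thesis by (simp add: kJ)
  qed
  then show ?thesis by blast
qed

lemma equivalent_zigzags_equal:
  assumes "maximal_zigzag z" "maximal_zigzag z'" "gl2z_equiv (zigzag_limit z) (zigzag_limit z')"
  shows "z = z'"
proof -
  have "zigzag z" "zigzag z'" using assms by (simp_all add: maximal_zigzag_def)
  from equivalent_common_tail[OF this[THEN zigzag_markoff_seq]] assms(3)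
  obtain u v where "\<And>i. seq_a z (i + u) = seq_a z' (i + v)" unfolding zigzag_limit_def by blast
  then show ?thesis using maximal_zigzag_determined[OF assms(1,2), of u v] by (simp add: seq_a_def)
qed

section \<open>Every number of the class is equivalent to a limit\<close>

text \<open>
  Since $a_i a_{i+1} a_{i+2} > 0$ by Markoff's equation, the signs of the $a_i$ are multiplicative along
  the recurrence and can be removed.
\<close>
lemma (in matrix_seq) normalize_signs:
  "matrix_seq (\<lambda>i. \<bar>a i\<bar>) (\<lambda>i. sgn (a i) * b i) (\<lambda>i. sgn (a i) * c i) e"
proof -
  define \<sigma> where "\<sigma> i = sgn (a i)" for i
  have sq: "\<sigma> i * \<sigma> i = 1" for i
    using a_nonzero[of i] by (simp add: \<sigma>_def sgn_if)
  have abs: "\<bar>a i\<bar> = \<sigma> i * a i" for i by (simp add: \<sigma>_def abs_sgn mult.commute)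
  have s2: "\<sigma> (Suc (Suc i)) = \<sigma> (Suc i) * \<sigma> i" for i
  proof -
    have "0 < (a i)\<^sup>2 + (a (Suc i))\<^sup>2 + (a (Suc (Suc i)))\<^sup>2"
      using a_nonzero[of i] by (simp add: add_pos_nonneg)
    then have "0 < a i * a (Suc i) * a (Suc (Suc i))" unfolding markoff by simp
    then have "\<sigma> i * \<sigma> (Suc i) * \<sigma> (Suc (Suc i)) = 1"
      unfolding \<sigma>_def by (metis sgn_mult sgn_pos)
    then show ?thesis using sq[of i] sq[of "Suc i"] sq[of "Suc (Suc i)"] by algebra
  qed
  show ?thesis unfolding \<sigma>_def[symmetric]
  proof
    fix i
    show "e i * e i = 1" "e (Suc i) = - e i" by (rule e_sq, rule e_Suc)
    have "\<bar>a i\<bar> * (\<sigma> i * c i) - (\<sigma> i * b i)\<^sup>2 = (\<sigma> i * \<sigma> i) * (a i * c i - (b i)\<^sup>2)"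
      unfolding abs by (simp add: algebra_simps power2_eq_square)
    then show "\<bar>a i\<bar> * (\<sigma> i * c i) - (\<sigma> i * b i)\<^sup>2 = 1" by (simp only: sq det1 mult_1)
    show "\<bar>a (Suc (Suc i))\<bar> = 3 * \<bar>a (Suc i)\<bar> * \<bar>a i\<bar>
        + e i * (\<bar>a (Suc i)\<bar> * (\<sigma> i * b i) - \<sigma> (Suc i) * b (Suc i) * \<bar>a i\<bar>)"
      unfolding abs s2 unfolding rec_a[of i] by (simp add: algebra_simps)
    show "\<sigma> (Suc (Suc i)) * b (Suc (Suc i)) = 3 * \<bar>a (Suc i)\<bar> * (\<sigma> i * b i)
        + e i * (\<bar>a (Suc i)\<bar> * (\<sigma> i * c i) - \<sigma> (Suc i) * b (Suc i) * (\<sigma> i * b i))"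
      unfolding abs s2 unfolding rec_b[of i] by (simp add: algebra_simps)
    show "\<sigma> (Suc (Suc i)) * b (Suc (Suc i)) = 3 * (\<sigma> (Suc i) * b (Suc i)) * \<bar>a i\<bar>
        + e i * (\<sigma> (Suc i) * b (Suc i) * (\<sigma> i * b i) - \<sigma> (Suc i) * c (Suc i) * \<bar>a i\<bar>)"
      unfolding abs s2 unfolding rec_b'[of i] by (simp add: algebra_simps)
    show "\<sigma> (Suc (Suc i)) * c (Suc (Suc i)) = 3 * (\<sigma> (Suc i) * b (Suc i)) * (\<sigma> i * b i)
        + e i * (\<sigma> (Suc i) * b (Suc i) * (\<sigma> i * c i) - \<sigma> (Suc i) * c (Suc i) * (\<sigma> i * b i))"
      unfolding abs s2 unfolding rec_c[of i] by (simp add: algebra_simps)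
  qed
qed

text \<open>
  Before a left step the node lists the previous entry second, before a right step third; so the entry
  that is dropped is always the oldest.
\<close>
lemma markoff_tail_zigzag:
  fixes A :: "nat \<Rightarrow> int"
  assumes pos: "\<And>i. 0 < A i"
    and M: "(A j)\<^sup>2 + (A (Suc j))\<^sup>2 + (A (Suc (Suc j)))\<^sup>2 = 3 * A j * A (Suc j) * A (Suc (Suc j))"
    and rec: "\<And>i. A (Suc (Suc (Suc i))) = 3 * A (Suc (Suc i)) * A (Suc i) - A i"
    and max: "A j < A (Suc (Suc j))" "A (Suc j) < A (Suc (Suc j))"
  shows "\<exists>z. zigzag z \<and> (\<forall>k. fst (z k) = A (Suc (Suc (k + j))))"
proof -
  let ?node = "\<lambda>s i. if s = Lft then (A (Suc (Suc i)), A (Suc i), A i) else (A (Suc (Suc i)), A i, A (Suc i))"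
  have "(A (Suc (Suc j)), A (Suc j), A j) \<in> Sigma_star \<or> (A (Suc (Suc j)), A j, A (Suc j)) \<in> Sigma_star"
    by (rule markoff_descent) (use pos M max in \<open>simp_all add: algebra_simps\<close>)
  then obtain s where s: "?node s j \<in> Sigma_star" "?node s j = (2, 1, 1) \<longrightarrow> s = Lft"
  proof (cases "(A (Suc (Suc j)), A (Suc j), A j) \<in> Sigma_star")
    case True
    then show thesis using that[of Lft] by simp
  next
    case False
    moreover assume "(A (Suc (Suc j)), A (Suc j), A j) \<in> Sigma_star \<or> (A (Suc (Suc j)), A j, A (Suc j)) \<in> Sigma_star"
    ultimately have "(A (Suc (Suc j)), A j, A (Suc j)) \<in> Sigma_star" by blast
    moreover have "(A (Suc (Suc j)), A j, A (Suc j)) \<noteq> (2, 1, 1)"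
      using False Sigma_star.root by auto
    ultimately show thesis using that[of Rgt] by simp
  qed
  define z where "z = zz s (?node s j)"
  have "zigzag z" unfolding z_def using s by (rule zigzag_zz)
  moreover have "z k = ?node (if even k then s else other s) (k + j)" for k
  proof (induction k)
    case 0
    then show ?case by (simp add: z_def)
  next
    case (Suc k)
    define t where "t = (if even k then s else other s)"
    have "z (Suc k) = child t (z k)" by (simp add: z_def t_def)
    also have "\<dots> = ?node (other t) (Suc k + j)"
      unfolding Suc.IH[folded t_def] by (cases t) (simp_all add: rec mult_ac)
    finally show ?case by (simp add: t_def)
  qed
  then have "fst (z k) = A (Suc (Suc (k + j)))" for k by simp
  ultimately show ?thesis by blast
qed

text \<open>
  The recurrence determines $a_{i+1} b_i - b_{i+1} a_i$ up to the sign of $e_i$, so that the vectors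
  $b - \epsilon b'$ and $a$ are proportional; coprimality makes the factor integral.
\<close>
lemma same_denominators_equivalent:
  fixes A B B' e e' :: "nat \<Rightarrow> int"
  assumes sgn: "\<And>k. e k * e k = 1" "\<And>k. e' k * e' k = 1" "\<And>k. e (Suc k) = - e k" "\<And>k. e' (Suc k) = - e' k"
    and pos: "\<And>k. 0 < A k" and coprime: "coprime (A 0) (A (Suc 0))"
    and rec: "\<And>k. A (Suc (Suc k)) = 3 * A (Suc k) * A k + e k * (A (Suc k) * B k - B (Suc k) * A k)"
      "\<And>k. A (Suc (Suc k)) = 3 * A (Suc k) * A k + e' k * (A (Suc k) * B' k - B' (Suc k) * A k)"
  shows "\<exists>\<epsilon> t. \<bar>\<epsilon>\<bar> = 1 \<and> (\<forall>k. B k = \<epsilon> * B' k + t * A k)"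
proof -
  define \<epsilon> where "\<epsilon> = e 0 * e' 0"
  have e1: "e k = 1 \<or> e k = -1" "e' k = 1 \<or> e' k = -1" for k
    using sgn(1,2)[of k] by (simp_all add: square_eq_1_iff)
  have eps: "e k * e' k = \<epsilon>" for k
    by (induction k) (simp_all add: \<epsilon>_def sgn)
  have abs: "\<bar>\<epsilon>\<bar> = 1" unfolding \<epsilon>_def using e1[of 0] by auto
  define d where "d k = B k - \<epsilon> * B' k" for k
  have step: "A (Suc k) * d k = A k * d (Suc k)" for k
  proof -
    have "e k * (A (Suc k) * B k - B (Suc k) * A k) = e' k * (A (Suc k) * B' k - B' (Suc k) * A k)"
      using rec[of k] by simp
    then have "A (Suc k) * B k - B (Suc k) * A k = e k * e' k * (A (Suc k) * B' k - B' (Suc k) * A k)"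
      using e1(1)[of k] by auto
    then show ?thesis unfolding eps d_def by (simp add: algebra_simps)
  qed
  have "A 0 dvd A (Suc 0) * d 0" unfolding step by simp
  then have "A 0 dvd d 0" using coprime by (simp add: coprime_dvd_mult_right_iff)
  then obtain t where t: "d 0 = A 0 * t" by (elim dvdE)
  have "d k = A k * t" for k
  proof (induction k)
    case 0 show ?case by (rule t)
  next
    case (Suc k)
    then have "A k * d (Suc k) = A (Suc k) * (A k * t)" using step[of k] by metis
    then have "A k * d (Suc k) = A k * (A (Suc k) * t)" by (simp only: mult.left_commute)
    moreover have "A k \<noteq> 0" using pos[of k] by simp
    ultimately show ?case using mult_left_cancel by blast
  qed
  then have "B k = \<epsilon> * B' k + t * A k" for k
    using d_def[of k] by (simp add: algebra_simps)
  then show ?thesis using abs by blast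
qed

lemma E3_plus_equivalent_zigzag:
  assumes "\<eta> \<in> E3_plus"
  shows "\<exists>z. maximal_zigzag z \<and> gl2z_equiv \<eta> (zigzag_limit z)"
proof -
  obtain x where x: "corresponds x \<eta>" "\<And>i. x (i + 2) = x (i + 1) ** M_alt (i + 2) ** x i"
    using assms unfolding E3_plus_def by blast
  define a b c where "a i = x i $ 1 $ 1" and "b i = x i $ 1 $ 2" and "c i = x i $ 2 $ 2" for i
  have sym: "x i $ 2 $ 1 = b i" "det (x i) = 1" for i
  proof -
    have T: "transpose (x i) = x i" and "det (x i) = 1" using x(1) by (simp_all add: corresponds_def)
    then show "det (x i) = 1" by simp
    have "x i $ 2 $ 1 = transpose (x i) $ 1 $ 2" by (simp add: transpose_def)
    then show "x i $ 2 $ 1 = b i" unfolding T b_def .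
  qed
  have xm: "x i = mat2 (a i) (b i) (b i) (c i)" for i
    unfolding mat2_eq_iff a_def b_def c_def using sym(1)[of i] by (simp add: b_def)
  interpret m: matrix_seq a b c "\<lambda>i. (- 1) ^ i"
  proof
    fix i
    show "(- 1 :: int) ^ i * (- 1) ^ i = 1" by (simp flip: power_mult_distrib)
    show "a i * c i - (b i)\<^sup>2 = 1" using sym(2)[of i] unfolding xm det_mat2 by (simp add: power2_eq_square)
    have M: "M_alt (i + 2) = mat2 3 ((- 1) ^ i) (- ((- 1) ^ i)) 0" by (simp add: M_alt_def)
    have "mat2 (a (Suc (Suc i))) (b (Suc (Suc i))) (b (Suc (Suc i))) (c (Suc (Suc i))) =
        mat2 (a (Suc i)) (b (Suc i)) (b (Suc i)) (c (Suc i)) ** mat2 3 ((- 1) ^ i) (- ((- 1) ^ i)) 0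
          ** mat2 (a i) (b i) (b i) (c i)"
      using x(2)[of i] unfolding M xm by simp
    then show "a (Suc (Suc i)) = 3 * a (Suc i) * a i + (- 1) ^ i * (a (Suc i) * b i - b (Suc i) * a i)"
      "b (Suc (Suc i)) = 3 * a (Suc i) * b i + (- 1) ^ i * (a (Suc i) * c i - b (Suc i) * b i)"
      "b (Suc (Suc i)) = 3 * b (Suc i) * a i + (- 1) ^ i * (b (Suc i) * b i - c (Suc i) * a i)"
      "c (Suc (Suc i)) = 3 * b (Suc i) * b i + (- 1) ^ i * (b (Suc i) * c i - c (Suc i) * b i)"
      unfolding mat2_mult mat2_eq_iff mat2_nth by (auto simp: algebra_simps)
  qed simp

  define N where "N i = infnorm (real_mat (x i))" for i
  obtain C where C: "0 < C" "\<And>i. infnorm (vector [\<eta>, -1] v* real_mat (x i)) \<le> C * inverse (N i)"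
  proof -
    have "asymp_eq (\<lambda>i. infnorm (vector [\<eta>, -1] v* real_mat (x i))) (\<lambda>i. inverse (N i))"
      using x(1) by (simp add: corresponds_def N_def)
    then show thesis unfolding asymp_eq_def using that by metis
  qed
  have aN: "\<bar>real_of_int (a i)\<bar> \<le> N i" for i
    using infnorm_matrix_ge[of "real_mat (x i)" 1 1] by (simp add: real_mat_nth N_def a_def)
  have a1: "1 \<le> \<bar>real_of_int (a i)\<bar>" for i
    using m.a_nonzero[of i] by linarith
  have CN: "C * inverse (N i) \<le> C / \<bar>real_of_int (a i)\<bar>" "C * inverse (N i) \<le> C" for i
  proof -
    have "inverse (N i) \<le> inverse \<bar>real_of_int (a i)\<bar>"
      using aN[of i] a1[of i] by (intro le_imp_inverse_le) simp_all
    then show 1: "C * inverse (N i) \<le> C / \<bar>real_of_int (a i)\<bar>"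
      using C by (simp add: divide_inverse mult_left_mono)
    have "inverse (N i) \<le> 1" using aN[of i] a1[of i] by (intro inverse_le_1_iff[THEN iffD2]) linarith
    then show "C * inverse (N i) \<le> C" using C by (simp add: mult_left_le)
  qed
  have ab: "\<bar>of_int (a i) * \<eta> - of_int (b i)\<bar> \<le> C * inverse (N i)"
    and bc: "\<bar>of_int (b i) * \<eta> - of_int (c i)\<bar> \<le> C * inverse (N i)" for i
    using component_le_infnorm_cart[of "vector [\<eta>, -1] v* real_mat (x i)" 1]
      component_le_infnorm_cart[of "vector [\<eta>, -1] v* real_mat (x i)" 2] C(2)[of i]
    unfolding xm vector_mult_mat2_nth by linarith+
  have approx: "\<bar>of_int (a i) * \<eta> - of_int (b i)\<bar> \<le> C / \<bar>real_of_int (a i)\<bar>" for i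
    using ab[of i] CN(1)[of i] by linarith
  have unbounded: "\<exists>i. L < \<bar>a i\<bar>" for L :: int
  proof (rule ccontr)
    assume "\<not> ?thesis"
    then have aL: "\<bar>real_of_int (a i)\<bar> \<le> of_int L" for i by (simp add: not_less flip: of_int_abs)
    define K1 where "K1 = of_int L * \<bar>\<eta>\<bar> + C"
    define K2 where "K2 = K1 * \<bar>\<eta>\<bar> + C"
    have bK: "\<bar>real_of_int (b i)\<bar> \<le> K1" for i
    proof -
      have "\<bar>of_int (a i) * \<eta>\<bar> \<le> of_int L * \<bar>\<eta>\<bar>"
        unfolding abs_mult using aL by (intro mult_right_mono) simp_all
      then show ?thesis using ab[of i] CN(2)[of i] unfolding K1_def by linarith
    qed
    have cK: "\<bar>real_of_int (c i)\<bar> \<le> K2" for i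
    proof -
      have "\<bar>of_int (b i) * \<eta>\<bar> \<le> K1 * \<bar>\<eta>\<bar>"
        unfolding abs_mult using bK by (intro mult_right_mono) simp_all
      then show ?thesis using bc[of i] CN(2)[of i] unfolding K2_def by linarith
    qed
    have "N i \<le> max (of_int L) (max K1 K2)" for i
      unfolding N_def
    proof (rule infnorm_matrix_le)
      have "\<forall>j k. \<bar>real_mat (x i) $ j $ k\<bar> \<le> max (of_int L) (max K1 K2)"
        using aL[of i] bK[of i] cK[of i] unfolding forall_2 real_mat_nth xm mat2_nth by linarith
      then show "\<bar>real_mat (x i) $ j $ k\<bar> \<le> max (of_int L) (max K1 K2)" for j k by blast
    qed
    then have "bdd_above (range N)" by (auto simp: bdd_above_def)
    then show False using x(1) unfolding corresponds_def N_def by blast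
  qed

  define A B where "A i = \<bar>a i\<bar>" and "B i = sgn (a i) * b i" for i
  interpret s: matrix_seq A B "\<lambda>i. sgn (a i) * c i" "\<lambda>i. (- 1) ^ i"
    unfolding A_def B_def by (rule m.normalize_signs)
  have Apos: "0 < A i" for i using m.a_nonzero by (simp add: A_def)
  have Aapprox: "\<bar>of_int (A i) * \<eta> - of_int (B i)\<bar> \<le> C / of_int (A i)" for i
  proof -
    have "of_int (A i) * \<eta> - of_int (B i) = of_int (sgn (a i)) * (of_int (a i) * \<eta> - of_int (b i))"
      by (simp add: A_def B_def abs_sgn algebra_simps)
    moreover have "\<bar>real_of_int (sgn (a i))\<bar> = 1" using m.a_nonzero[of i] by (simp add: sgn_if)
    ultimately show ?thesis using approx[of i] by (simp add: abs_mult A_def)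
  qed
  obtain j where j: "A j < A (Suc (Suc j))" "A (Suc j) < A (Suc (Suc j))"
  proof -
    define L where "L = max (A 0) (A 1)"
    have ex: "\<exists>n. L < A n" using unbounded by (simp add: A_def)
    define n where "n = (LEAST n. L < A n)"
    have n: "L < A n" unfolding n_def using ex by (rule LeastI_ex)
    have less: "A k \<le> L" if "k < n" for k
      using not_less_Least[OF that[unfolded n_def]] by simp
    have "A 0 \<le> L" "A 1 \<le> L" by (simp_all add: L_def)
    then have "n \<noteq> 0" "n \<noteq> 1" using n not_le by metis+
    then obtain j where "n = Suc (Suc j)" by (metis One_nat_def not0_implies_Suc)
    then show thesis using that[of j] n less[of j] less[of "Suc j"] by simp
  qed
  obtain z where z: "zigzag z" "\<And>k. fst (z k) = A (Suc (Suc (k + j)))"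
    using markoff_tail_zigzag[of A j, OF Apos s.markoff s.a_rec3 j] by blast
  obtain z' p where z': "maximal_zigzag z'" "\<And>i. z' (i + p) = z i"
    using zigzag_tail_maximal[OF z(1)] by blast
  have zz': "zigzag z'" using z' by (simp add: maximal_zigzag_def)
  interpret t: markoff_seq "seq_a z'" "seq_b z'" "seq_c z'" "seq_e z'"
    by (rule zigzag_markoff_seq[OF zz'])
  have a': "seq_a z' (k + p) = A (Suc (Suc (k + j)))" for k
    using z'(2)[of k] z(2)[of k] by (simp add: seq_a_def)
  have "coprime (A (Suc (Suc j))) (A (Suc (Suc (Suc j))))"
  proof -
    obtain w where "is_succ w (z 0) (z (Suc 0))" using zigzag_step[OF z(1)] by blast
    moreover obtain n n1 n2 where "z 0 = (n, n1, n2)" by (cases "z 0")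
    ultimately have "coprime (fst (z 0)) (fst (z (Suc 0)))"
      using Sigma_star_coprime[OF zigzag_in[OF z(1), of "Suc 0"]]
      by (cases w) (simp_all add: is_succ_def coprime_commute)
    then show ?thesis using z(2)[of 0] z(2)[of "Suc 0"] by simp
  qed
  then have "\<exists>\<epsilon> t. \<bar>\<epsilon>\<bar> = 1 \<and> (\<forall>k. B (Suc (Suc (k + j))) = \<epsilon> * seq_b z' (k + p) + t * A (Suc (Suc (k + j))))"
    using s.rec_a[of "Suc (Suc (_ + j))"] t.rec_a[of "_ + p"] a'[of "Suc _"] a'[of "Suc (Suc _)"]
    by (intro same_denominators_equivalent[of "\<lambda>k. (- 1) ^ (Suc (Suc (k + j)))" "\<lambda>k. seq_e z' (k + p)"])
      (simp_all add: Apos t.e_sq t.e_Suc a' s.e_sq flip: power_mult_distrib)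
  then obtain \<epsilon> t where \<epsilon>: "\<bar>\<epsilon>\<bar> = 1"
    and BB: "\<And>k. B (Suc (Suc (k + j))) = \<epsilon> * seq_b z' (k + p) + t * A (Suc (Suc (k + j)))" by blast
  have lim: "(\<lambda>k. of_int (B (Suc (Suc (k + j)))) / of_int (A (Suc (Suc (k + j))))) \<longlonglongrightarrow> \<eta>"
  proof (rule LIM_zero_cancel, rule tendsto_rabs_zero_cancel, rule tendsto_sandwich[OF _ _ tendsto_const])
    have "(\<lambda>k. C * (1 / real_of_int (seq_a z' (k + p)))) \<longlonglongrightarrow> C * 0"
      by (intro tendsto_intros LIMSEQ_ignore_initial_segment t.inverse_a_tendsto)
    then show "(\<lambda>k. C * (1 / real_of_int (A (Suc (Suc (k + j)))))) \<longlonglongrightarrow> 0" by (simp add: a')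
    have "\<bar>of_int (B i) / of_int (A i) - \<eta>\<bar> \<le> C * (1 / real_of_int (A i))" for i
    proof -
      have p: "1 \<le> real_of_int (A i)" using Apos[of i] by linarith
      have "\<bar>of_int (B i) / of_int (A i) - \<eta>\<bar> * of_int (A i) = \<bar>of_int (A i) * \<eta> - of_int (B i)\<bar>"
      proof -
        have "(of_int (B i) / of_int (A i) - \<eta>) * of_int (A i) = - (of_int (A i) * \<eta> - of_int (B i))"
          using p by (simp add: field_simps)
        then have "\<bar>(of_int (B i) / of_int (A i) - \<eta>) * of_int (A i)\<bar> = \<bar>of_int (A i) * \<eta> - of_int (B i)\<bar>"
          by simp
        then show ?thesis using p by (simp add: abs_mult)
      qed
      also have "\<dots> \<le> C / of_int (A i)" by (rule Aapprox)
      finally have "\<bar>of_int (B i) / of_int (A i) - \<eta>\<bar> * of_int (A i) \<le> C / of_int (A i)" .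
      moreover have "\<bar>of_int (B i) / of_int (A i) - \<eta>\<bar> * 1 \<le> \<bar>of_int (B i) / of_int (A i) - \<eta>\<bar> * of_int (A i)"
        using p by (intro mult_left_mono) simp_all
      ultimately show ?thesis by simp
    qed
    then show "\<forall>\<^sub>F k in sequentially. \<bar>of_int (B (Suc (Suc (k + j)))) / of_int (A (Suc (Suc (k + j)))) - \<eta>\<bar>
        \<le> C * (1 / real_of_int (A (Suc (Suc (k + j)))))" by simp
  qed simp
  have "(\<lambda>k. of_int \<epsilon> * t.ratio (k + p) + of_int t) \<longlonglongrightarrow> of_int \<epsilon> * t.xi + of_int t"
    by (intro tendsto_intros LIMSEQ_ignore_initial_segment t.ratio_tendsto)
  moreover have "of_int (B (Suc (Suc (k + j)))) / of_int (A (Suc (Suc (k + j))))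
      = of_int \<epsilon> * t.ratio (k + p) + of_int t" for k
    unfolding BB t.ratio_def a' using Apos[of "Suc (Suc (k + j))"] by (simp add: add_divide_distrib)
  ultimately have \<eta>: "\<eta> = of_int \<epsilon> * t.xi + of_int t"
    using lim LIMSEQ_unique by (simp only:) blast
  have irr: "\<eta> \<notin> \<rat>" using x(1) by (simp add: corresponds_def extremal_def)
  have "\<eta> * (of_int 0 * t.xi + of_int 1) = of_int \<epsilon> * t.xi + of_int t" by (simp add: \<eta>)
  moreover have "\<bar>\<epsilon> * 1 - t * 0\<bar> = 1" using \<epsilon> by simp
  ultimately have "gl2z_equiv t.xi \<eta>" unfolding gl2z_equiv_iff using t.xi_irrational irr by blast
  then have "gl2z_equiv \<eta> (zigzag_limit z')" unfolding zigzag_limit_def by (rule gl2z_equiv_sym)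
  then show ?thesis using z'(1) by blast
qed

theorem theorem3p6:
  shows "\<exists>\<xi> :: triple \<Rightarrow> real.
    (\<forall>m \<in> Sigma_star.
       corresponds (\<lambda>i. x_mat (zigzag_from m i)) (\<xi> m) \<and>
       \<xi> m \<in> E3_plus \<inter> {1/2 <..< 1} \<and>
       (\<lambda>i. alpha (zigzag_from m i)) \<longlonglongrightarrow> \<xi> m \<and>
       (\<lambda>i. alpha_bar (zigzag_from m i) + 3) \<longlonglongrightarrow> \<xi> m) \<and>
    (\<forall>\<eta> \<in> E3_plus. \<exists>!m. m \<in> Sigma_star \<and> gl2z_equiv \<eta> (\<xi> m))"
proof (intro exI[of _ "\<lambda>m. zigzag_limit (zigzag_from m)"] conjI ballI)
  fix m assume m: "m \<in> Sigma_star"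
  then have "zigzag (zigzag_from m)" using zigzag_from_maximal by (simp add: maximal_zigzag_def)
  note zigzag_limit_properties[OF this]
  then show "corresponds (\<lambda>i. x_mat (zigzag_from m i)) (zigzag_limit (zigzag_from m))"
    "zigzag_limit (zigzag_from m) \<in> E3_plus \<inter> {1/2<..<1}"
    "(\<lambda>i. alpha (zigzag_from m i)) \<longlonglongrightarrow> zigzag_limit (zigzag_from m)"
    "(\<lambda>i. alpha_bar (zigzag_from m i) + 3) \<longlonglongrightarrow> zigzag_limit (zigzag_from m)"
    by blast+
next
  fix \<eta> assume "\<eta> \<in> E3_plus"
  then obtain z where z: "maximal_zigzag z" "gl2z_equiv \<eta> (zigzag_limit z)"
    using E3_plus_equivalent_zigzag by blast
  show "\<exists>!m. m \<in> Sigma_star \<and> gl2z_equiv \<eta> (zigzag_limit (zigzag_from m))"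
  proof (rule ex1I[of _ "z 0"])
    show "z 0 \<in> Sigma_star \<and> gl2z_equiv \<eta> (zigzag_limit (zigzag_from (z 0)))"
      using z zigzag_from_eq[OF z(1)] zigzag_in[of z 0] by (simp add: maximal_zigzag_def)
  next
    fix m assume m: "m \<in> Sigma_star \<and> gl2z_equiv \<eta> (zigzag_limit (zigzag_from m))"
    then have "gl2z_equiv (zigzag_limit z) (zigzag_limit (zigzag_from m))"
      using z(2) gl2z_equiv_sym gl2z_equiv_trans by blast
    then have "z = zigzag_from m" using equivalent_zigzags_equal[OF z(1)] zigzag_from_maximal m by blast
    then show "m = z 0" using zigzag_from_maximal(2) m by metis
  qed
qed

end
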